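(* Hyperfiniteness is not local; that is, the class of hyperfinite $\mathrm{II}_1$ factors is not a local class.
   Context: A $\mathrm{II}_1$ factor $\mathcal{M}$ carries its unique trace $\tau$ (a faithful normal tracial state), and $\|x\|_2=\sqrt{\tau(x^*x)}$. For an ultrafilter $\mathcal{U}$ on an arbitrary set $I$, the ultrapower is $\mathcal{M}^{\mathcal{U}}=\ell^\infty_I(\mathcal{M})/\{(x_j):\lim_{j\to\mathcal{U}}\|x_j\|_2=0\}$, with trace $\tau((x_j))=\lim_{j\to\mathcal{U}}\tau(x_j)$; $\mathcal{M}$ is called an ultraroot of (anything isomorphic to) $\mathcal{M}^{\mathcal{U}}$. A class of $\mathrm{II}_1$ factors is local if it is closed under isomorphism, ultrapower and ultraroot (equivalently, closed under elementary equivalence in continuous logic). A property is identified with the class of objects having it. *)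

theory Defs
  imports "HOL-Algebra.QuotRing" "HOL-Algebra.Module" "HOL-Library.Nonpos_Ints"
begin

section \<open>Complex Hilbert spaces\<close>

definition complex_ring :: "complex ring" where
  "complex_ring = \<lparr>carrier = UNIV, monoid.mult = (*), one = 1, zero = 0, add = (+)\<rparr>"

text \<open>Only the additive group, the scalar multiplication and \<open>ip\<close> are used; the fields
  \<open>mult\<close> and \<open>one\<close> inherited from the record of modules are irrelevant.\<close>

record 'v ip_space = "(complex, 'v) module" +
  ip :: "'v \<Rightarrow> 'v \<Rightarrow> complex"

definition vnorm :: "'v ip_space \<Rightarrow> 'v \<Rightarrow> real" where
  "vnorm H x = sqrt (Re (ip H x x))"

locale hilbert_space = Module.module complex_ring H for H :: "'v ip_space" (structure) +
  assumes ip_add: "\<lbrakk>x \<in> carrier H; y \<in> carrier H; z \<in> carrier H\<rbrakk>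
      \<Longrightarrow> ip H (x \<oplus> y) z = ip H x z + ip H y z"
    and ip_smult: "\<lbrakk>x \<in> carrier H; z \<in> carrier H\<rbrakk> \<Longrightarrow> ip H (c \<odot> x) z = c * ip H x z"
    and ip_cnj: "\<lbrakk>x \<in> carrier H; y \<in> carrier H\<rbrakk> \<Longrightarrow> ip H y x = cnj (ip H x y)"
    and ip_nonneg: "x \<in> carrier H \<Longrightarrow> ip H x x \<in> \<real>\<^sub>\<ge>\<^sub>0"
    and ip_definite: "\<lbrakk>x \<in> carrier H; ip H x x = 0\<rbrakk> \<Longrightarrow> x = \<zero>"
    and complete: "\<And>s :: nat \<Rightarrow> 'v. \<lbrakk>range s \<subseteq> carrier H;
        \<forall>e>0. \<exists>n. \<forall>p\<ge>n. \<forall>q\<ge>n. vnorm H (s p \<ominus> s q) < e\<rbrakk>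
      \<Longrightarrow> \<exists>l\<in>carrier H. (\<lambda>n. vnorm H (s n \<ominus> l)) \<longlonglongrightarrow> 0"

section \<open>Unital *-algebras\<close>

record 'a star_algebra = "(complex, 'a) module" +
  star :: "'a \<Rightarrow> 'a"

definition star_isomorphic :: "'a star_algebra \<Rightarrow> 'b star_algebra \<Rightarrow> bool" where
  "star_isomorphic A B \<longleftrightarrow> (\<exists>h \<in> ring_iso A B.
     (\<forall>c. \<forall>x\<in>carrier A. h (c \<odot>\<^bsub>A\<^esub> x) = c \<odot>\<^bsub>B\<^esub> h x) \<and>
     (\<forall>x\<in>carrier A. h (star A x) = star B (h x)))"

definition star_subalgebra :: "'a star_algebra \<Rightarrow> 'a set \<Rightarrow> bool" where
  "star_subalgebra A S \<longleftrightarrow> S \<subseteq> carrier A \<and> \<zero>\<^bsub>A\<^esub> \<in> S \<and> \<one>\<^bsub>A\<^esub> \<in> S \<and>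
     (\<forall>x\<in>S. \<forall>y\<in>S. x \<oplus>\<^bsub>A\<^esub> y \<in> S \<and> x \<otimes>\<^bsub>A\<^esub> y \<in> S) \<and>
     (\<forall>c. \<forall>x\<in>S. c \<odot>\<^bsub>A\<^esub> x \<in> S) \<and> (\<forall>x\<in>S. star A x \<in> S)"

definition finite_dim :: "'a star_algebra \<Rightarrow> 'a set \<Rightarrow> bool" where
  "finite_dim A S \<longleftrightarrow> (\<exists>F. finite F \<and> F \<subseteq> S \<and>
     (\<forall>x\<in>S. \<exists>c. x = (\<Oplus>\<^bsub>A\<^esub>f\<in>F. c f \<odot>\<^bsub>A\<^esub> f)))"

text \<open>The quotient by a two-sided, *-closed ideal, extending \<^const>\<open>FactRing\<close>.\<close>

definition star_quotient :: "'a star_algebra \<Rightarrow> 'a set \<Rightarrow> 'a set star_algebra" where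
  "star_quotient A J =
     \<lparr>carrier = carrier (A Quot J), monoid.mult = mult (A Quot J), one = one (A Quot J),
      zero = zero (A Quot J), add = add (A Quot J),
      smult = (\<lambda>c X. \<Union>x\<in>X. J +>\<^bsub>A\<^esub> (c \<odot>\<^bsub>A\<^esub> x)),
      star = (\<lambda>X. \<Union>x\<in>X. J +>\<^bsub>A\<^esub> star A x)\<rparr>"

section \<open>Bounded operators\<close>

text \<open>Operators are functions that are \<^const>\<open>undefined\<close> outside the carrier, so that
  equality of functions is equality of operators.\<close>

definition bounded_ops :: "'v ip_space \<Rightarrow> ('v \<Rightarrow> 'v) set" where
  "bounded_ops H = {T \<in> carrier H \<rightarrow>\<^sub>E carrier H.
     (\<forall>x\<in>carrier H. \<forall>y\<in>carrier H. T (x \<oplus>\<^bsub>H\<^esub> y) = T x \<oplus>\<^bsub>H\<^esub> T y) \<and>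
     (\<forall>c. \<forall>x\<in>carrier H. T (c \<odot>\<^bsub>H\<^esub> x) = c \<odot>\<^bsub>H\<^esub> T x) \<and>
     (\<exists>C. \<forall>x\<in>carrier H. vnorm H (T x) \<le> C * vnorm H x)}"

definition op_norm :: "'v ip_space \<Rightarrow> ('v \<Rightarrow> 'v) \<Rightarrow> real" where
  "op_norm H T = Sup {vnorm H (T x) | x. x \<in> carrier H \<and> vnorm H x \<le> 1}"

definition adjoint :: "'v ip_space \<Rightarrow> ('v \<Rightarrow> 'v) \<Rightarrow> ('v \<Rightarrow> 'v)" where
  "adjoint H T = (THE S. S \<in> bounded_ops H \<and>
     (\<forall>x\<in>carrier H. \<forall>y\<in>carrier H. ip H (T x) y = ip H x (S y)))"

definition op_algebra :: "'v ip_space \<Rightarrow> ('v \<Rightarrow> 'v) star_algebra" where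
  "op_algebra H =
     \<lparr>carrier = bounded_ops H, monoid.mult = compose (carrier H),
      one = (\<lambda>x\<in>carrier H. x), zero = (\<lambda>x\<in>carrier H. \<zero>\<^bsub>H\<^esub>),
      add = (\<lambda>S T. \<lambda>x\<in>carrier H. S x \<oplus>\<^bsub>H\<^esub> T x),
      smult = (\<lambda>c T. \<lambda>x\<in>carrier H. c \<odot>\<^bsub>H\<^esub> T x), star = adjoint H\<rparr>"

definition op_le :: "'v ip_space \<Rightarrow> ('v \<Rightarrow> 'v) \<Rightarrow> ('v \<Rightarrow> 'v) \<Rightarrow> bool" where
  "op_le H S T \<longleftrightarrow> (\<forall>x\<in>carrier H. ip H (T x) x - ip H (S x) x \<in> \<real>\<^sub>\<ge>\<^sub>0)"

definition commutant :: "'v ip_space \<Rightarrow> ('v \<Rightarrow> 'v) set \<Rightarrow> ('v \<Rightarrow> 'v) set" where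
  "commutant H M = {T \<in> bounded_ops H.
     \<forall>S\<in>M. compose (carrier H) S T = compose (carrier H) T S}"

definition von_neumann_algebra :: "'v ip_space \<Rightarrow> ('v \<Rightarrow> 'v) set \<Rightarrow> bool" where
  "von_neumann_algebra H M \<longleftrightarrow> hilbert_space H \<and> M \<subseteq> bounded_ops H \<and>
     (\<forall>T\<in>M. adjoint H T \<in> M) \<and> commutant H (commutant H M) = M"

definition factor :: "'v ip_space \<Rightarrow> ('v \<Rightarrow> 'v) set \<Rightarrow> bool" where
  "factor H M \<longleftrightarrow> von_neumann_algebra H M \<and>
     M \<inter> commutant H M = {c \<odot>\<^bsub>op_algebra H\<^esub> \<one>\<^bsub>op_algebra H\<^esub> | c. True}"

section \<open>\<open>II\<^sub>1\<close> factors\<close>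

text \<open>A \<open>II\<^sub>1\<close> factor is bundled with a Hilbert space on which it acts and with its trace.
  As the trace is unique and is required to be \<^const>\<open>undefined\<close> off the algebra, bundling it
  adds no structure.\<close>

record 'v traced_algebra =
  hilb :: "'v ip_space"
  elems :: "('v \<Rightarrow> 'v) set"
  tr :: "('v \<Rightarrow> 'v) \<Rightarrow> complex"

definition algebra_of :: "'v traced_algebra \<Rightarrow> ('v \<Rightarrow> 'v) star_algebra" where
  "algebra_of M = (op_algebra (hilb M)) \<lparr>carrier := elems M\<rparr>"

definition tracial_state :: "'v traced_algebra \<Rightarrow> bool" where
  "tracial_state M \<longleftrightarrow> (let A = algebra_of M; \<tau> = tr M in
     \<tau> \<in> extensional (carrier A) \<and>
     (\<forall>x\<in>carrier A. \<forall>y\<in>carrier A. \<tau> (x \<oplus>\<^bsub>A\<^esub> y) = \<tau> x + \<tau> y) \<and>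
     (\<forall>c. \<forall>x\<in>carrier A. \<tau> (c \<odot>\<^bsub>A\<^esub> x) = c * \<tau> x) \<and>
     (\<forall>x\<in>carrier A. \<tau> (star A x \<otimes>\<^bsub>A\<^esub> x) \<in> \<real>\<^sub>\<ge>\<^sub>0) \<and>
     \<tau> \<one>\<^bsub>A\<^esub> = 1 \<and>
     (\<forall>x\<in>carrier A. \<forall>y\<in>carrier A. \<tau> (x \<otimes>\<^bsub>A\<^esub> y) = \<tau> (y \<otimes>\<^bsub>A\<^esub> x)))"

definition faithful_trace :: "'v traced_algebra \<Rightarrow> bool" where
  "faithful_trace M \<longleftrightarrow> (let A = algebra_of M in
     \<forall>x\<in>carrier A. tr M (star A x \<otimes>\<^bsub>A\<^esub> x) = 0 \<longrightarrow> x = \<zero>\<^bsub>A\<^esub>)"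

definition self_adjoint_elems :: "'v traced_algebra \<Rightarrow> ('v \<Rightarrow> 'v) set" where
  "self_adjoint_elems M = {x \<in> elems M. adjoint (hilb M) x = x}"

text \<open>Normality: the trace preserves suprema of bounded upward directed families of
  self-adjoint elements (boundedness is implied by the existence of the supremum \<open>s\<close>).\<close>

definition normal_trace :: "'v traced_algebra \<Rightarrow> bool" where
  "normal_trace M \<longleftrightarrow> (\<forall>D s.
     D \<subseteq> self_adjoint_elems M \<and> D \<noteq> {} \<and>
     (\<forall>x\<in>D. \<forall>y\<in>D. \<exists>z\<in>D. op_le (hilb M) x z \<and> op_le (hilb M) y z) \<and>
     s \<in> self_adjoint_elems M \<and> (\<forall>x\<in>D. op_le (hilb M) x s) \<and>
     (\<forall>t\<in>self_adjoint_elems M. (\<forall>x\<in>D. op_le (hilb M) x t) \<longrightarrow> op_le (hilb M) s t)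
     \<longrightarrow> tr M s = complex_of_real (SUP x\<in>D. Re (tr M x)))"

definition II1_factor :: "'v traced_algebra \<Rightarrow> bool" where
  "II1_factor M \<longleftrightarrow> factor (hilb M) (elems M) \<and>
     \<not> finite_dim (algebra_of M) (elems M) \<and>
     tracial_state M \<and> faithful_trace M \<and> normal_trace M"

definition norm2 :: "'v traced_algebra \<Rightarrow> ('v \<Rightarrow> 'v) \<Rightarrow> real" where
  "norm2 M x = sqrt (Re (tr M (star (algebra_of M) x \<otimes>\<^bsub>algebra_of M\<^esub> x)))"

text \<open>No separability is assumed, as ultrapowers are usually nonseparable: hyperfiniteness is
  approximability in the 2-norm of every finite set by a finite-dimensional *-subalgebra.\<close>

definition hyperfinite :: "'v traced_algebra \<Rightarrow> bool" where
  "hyperfinite M \<longleftrightarrow> (\<forall>F e. finite F \<and> F \<subseteq> elems M \<and> e > 0 \<longrightarrow>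
     (\<exists>N. star_subalgebra (algebra_of M) N \<and> finite_dim (algebra_of M) N \<and>
        (\<forall>x\<in>F. \<exists>y\<in>N. norm2 M (x \<ominus>\<^bsub>algebra_of M\<^esub> y) < e)))"

section \<open>Ultrapowers and local classes\<close>

definition ultrafilter_on :: "'i set \<Rightarrow> 'i filter \<Rightarrow> bool" where
  "ultrafilter_on I U \<longleftrightarrow> U \<noteq> bot \<and> eventually (\<lambda>i. i \<in> I) U \<and>
     (\<forall>P. eventually P U \<or> eventually (\<lambda>i. \<not> P i) U)"

definition l_infinity :: "'i set \<Rightarrow> 'v traced_algebra \<Rightarrow> ('i \<Rightarrow> ('v \<Rightarrow> 'v)) star_algebra" where
  "l_infinity I M = (let A = algebra_of M in
     \<lparr>carrier = {x \<in> I \<rightarrow>\<^sub>E elems M. \<exists>C. \<forall>i\<in>I. op_norm (hilb M) (x i) \<le> C},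
      monoid.mult = (\<lambda>x y. \<lambda>i\<in>I. x i \<otimes>\<^bsub>A\<^esub> y i), one = (\<lambda>i\<in>I. \<one>\<^bsub>A\<^esub>),
      zero = (\<lambda>i\<in>I. \<zero>\<^bsub>A\<^esub>), add = (\<lambda>x y. \<lambda>i\<in>I. x i \<oplus>\<^bsub>A\<^esub> y i),
      smult = (\<lambda>c x. \<lambda>i\<in>I. c \<odot>\<^bsub>A\<^esub> x i), star = (\<lambda>x. \<lambda>i\<in>I. star A (x i))\<rparr>)"

definition ultrapower ::
  "'v traced_algebra \<Rightarrow> 'i set \<Rightarrow> 'i filter \<Rightarrow> ('i \<Rightarrow> ('v \<Rightarrow> 'v)) set star_algebra" where
  "ultrapower M I U = star_quotient (l_infinity I M)
     {x \<in> carrier (l_infinity I M). ((\<lambda>i. norm2 M (x i)) \<longlongrightarrow> 0) U}"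

text \<open>The type \<open>'v\<close> plays the role of a universe: Hilbert spaces and index sets have their
  carriers in \<open>'v\<close>. An ultrapower is not literally an algebra of operators, so closure under
  ultrapower and ultraroot refers to all \<open>II\<^sub>1\<close> factors isomorphic to it. A *-isomorphism of
  \<open>II\<^sub>1\<close> factors automatically preserves the trace.\<close>

definition local_class :: "'v traced_algebra set \<Rightarrow> bool" where
  "local_class C \<longleftrightarrow> C \<subseteq> {M. II1_factor M} \<and>
     (\<forall>M N. M \<in> C \<and> II1_factor N \<and> star_isomorphic (algebra_of M) (algebra_of N)
        \<longrightarrow> N \<in> C) \<and>
     (\<forall>M N (I :: 'v set) U. M \<in> C \<and> II1_factor N \<and> ultrafilter_on I U \<and>
        star_isomorphic (algebra_of N) (ultrapower M I U) \<longrightarrow> N \<in> C) \<and>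
     (\<forall>M N (I :: 'v set) U. N \<in> C \<and> II1_factor M \<and> ultrafilter_on I U \<and>
        star_isomorphic (algebra_of N) (ultrapower M I U) \<longrightarrow> M \<in> C)"

end

theory Submission
  imports Defs "HOL-Analysis.Analysis" "HOL-Combinatorics.Perm" "HOL-Combinatorics.Permutations"
    "HOL-Computational_Algebra.Fundamental_Theorem_Algebra"
begin

text \<open>
  Let \<open>S\<close> be the group of finitary permutations of the natural numbers and \<open>R\<close> its group von Neumann
  algebra.  It is a hyperfinite \<open>II\<^sub>1\<close> factor, but its ultrapower along a free ultrafilter on the
  natural numbers, a \<open>II\<^sub>1\<close> factor as well, is not hyperfinite.  Both act on Hilbert spaces of the
  cardinality of the continuum and hence fit into the universe, so the class is not closed under
  ultrapowers.

  \<^item> \<open>R\<close> is hyperfinite (\<open>R_hyperfinite\<close>) since \<open>S\<close> is locally finite.  It is a factor because every element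
  is moved by some unitary of the group by at least its distance from the scalars
  (\<open>ex_noncommuting_lam\<close>); this is uniform and so passes to the ultrapower (\<open>NN_centre\<close>).

  \<^item> The ultrapower acts on the 2-norm closure \<open>hN\<close> of its symbols.  That it is a von Neumann algebra there
  means that each operator \<open>T\<close> commuting with the right multiplications comes from a bounded sequence
  (\<open>NN_eq\<close>).  The symbol of \<open>T\<close> is a 2-norm limit of symbols of bounded sequences, but without control of their
  operator norms.  The function \<open>2 t / (1 + t\<^sup>2)\<close> maps self-adjoint elements to contractions and is Lipschitz in
  the 2-norm, as in Kaplansky's density theorem; the unit ball of the ultrapower is complete in the
  2-norm, by saturation; and a small \<open>T\<close> can be recovered from \<open>2 T (1 + T\<^sup>2)\<^sup>-\<^sup>1\<close> by an iteration that preserves the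
  unit ball.

  \<^item> The ultrapower is not hyperfinite (\<open>NN_not_hyperfinite\<close>) because it contains five self-adjoint unitaries
  whose reduced words are orthonormal in the 2-norm: they come from permutations of finite balls in
  the 5-regular tree and generate a non-amenable group.  Suppose that they lie near a finite-dimensional
  *-subalgebra.  For a suitable ideal of the subalgebra (\<open>ex_good_ideal\<close>) they almost commute in
  the Hilbert-Schmidt norm with the projection \<open>P\<close> onto it.  Let \<open>Q w\<close> be the Hilbert-Schmidt inner product of \<open>P\<close>
  and its conjugate by the word \<open>w\<close>.  Then the sum of \<open>Q\<close> over the words of length \<open>n\<close> grows at least like
  \<open>(9/2)\<^sup>n\<close> along the powers \<open>n\<close> of two.  On the other hand \<open>Q\<close> is summable over the reduced words, by
  Bessel's inequality, and at most \<open>4\<^sup>n\<close> words of length \<open>n\<close> have a given reduction, so the same sum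
  is at most a constant times \<open>4\<^sup>n\<close>.
\<close>

section \<open>Complex Hilbert spaces as a type class\<close>

text \<open>A complex Hilbert space is kept as a real Hilbert space with an orthogonal complex structure
  \<open>im\<close>, the multiplication by the imaginary unit.  Orthonormal bases, Bessel's inequality and the
  spectral arguments below only ever need the real inner product; the complex one is \<open>cip\<close>.\<close>

class chilbert = real_inner + complete_space +
  fixes im :: "'a \<Rightarrow> 'a"
  assumes im_add: "im (x + y) = im x + im y"
    and im_scaleR: "im (r *\<^sub>R x) = r *\<^sub>R im x"
    and im_im [simp]: "im (im x) = - x"
    and im_inner [simp]: "inner (im x) (im y) = inner x y"

lemma norm_im [simp]: "norm (im x) = norm (x::'a::chilbert)"
  by (simp add: norm_eq_sqrt_inner)

lemma bounded_linear_im: "bounded_linear (im :: 'a::chilbert \<Rightarrow> 'a)"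
  by (rule bounded_linear_intro[of _ 1]) (auto simp: im_add im_scaleR)

lemma linear_im: "linear (im :: 'a::chilbert \<Rightarrow> 'a)"
  using bounded_linear_im bounded_linear.linear by blast

lemmas im_zero [simp] = linear_0[OF linear_im]
lemmas im_minus = linear_neg[OF linear_im]
lemmas im_diff = linear_diff[OF linear_im]
lemmas im_sum = linear_sum[OF linear_im]

lemma inner_im_left: "im x \<bullet> y = - (x \<bullet> im (y::'a::chilbert))"
  using im_inner[of x "im y"] by simp

lemma inner_im_self [simp]: "x \<bullet> im (x::'a::chilbert) = 0"
  using inner_im_left[of x x] by (simp add: inner_commute)

definition scaleC :: "complex \<Rightarrow> 'a \<Rightarrow> 'a::chilbert" where
  "scaleC c x = Re c *\<^sub>R x + Im c *\<^sub>R im x"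

definition cip :: "'a \<Rightarrow> 'a::chilbert \<Rightarrow> complex" where
  "cip x y = Complex (x \<bullet> y) (x \<bullet> im y)"

lemma scaleC_add_right: "scaleC c (x + y) = scaleC c x + scaleC c y"
  by (simp add: scaleC_def im_add algebra_simps)

lemma scaleC_diff_right: "scaleC c (x - y) = scaleC c x - scaleC c y"
  by (simp add: scaleC_def im_diff algebra_simps)

lemma scaleC_add_left: "scaleC (c + d) x = scaleC c x + scaleC d x"
  by (simp add: scaleC_def algebra_simps)

lemma scaleC_scaleC: "scaleC c (scaleC d x) = scaleC (c * d) x"
  by (simp add: scaleC_def im_add im_scaleR algebra_simps)

lemma scaleC_one [simp]: "scaleC 1 x = x"
  by (simp add: scaleC_def)

lemma scaleC_zero_left [simp]: "scaleC 0 x = 0"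
  by (simp add: scaleC_def)

lemma scaleC_zero_right [simp]: "scaleC c 0 = 0"
  by (simp add: scaleC_def)

lemma scaleC_of_real [simp]: "scaleC (of_real r) x = r *\<^sub>R x"
  by (simp add: scaleC_def)

lemma scaleC_ii [simp]: "scaleC \<i> x = im x"
  by (simp add: scaleC_def)

lemma scaleC_minus_left: "scaleC (- c) x = - scaleC c x"
  by (simp add: scaleC_def)

lemma norm_scaleC: "norm (scaleC c x) = cmod c * norm x"
proof -
  have "scaleC c x \<bullet> scaleC c x = ((Re c)\<^sup>2 + (Im c)\<^sup>2) * (x \<bullet> x)"
    by (simp add: scaleC_def inner_add_left inner_add_right inner_im_left
        power2_eq_square algebra_simps)
  then show ?thesis
    by (simp add: norm_eq_sqrt_inner[of "scaleC c x"] norm_eq_sqrt_inner[of x] real_sqrt_mult cmod_def)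
qed

lemma cip_add_left: "cip (x + y) z = cip x z + cip y z"
  by (simp add: cip_def inner_add_left complex_eq_iff)

lemma cip_scaleC_left: "cip (scaleC c x) z = c * cip x z"
  by (simp add: cip_def scaleC_def inner_add_left inner_im_left complex_eq_iff algebra_simps)

lemma cip_cnj: "cip y x = cnj (cip x y)"
proof -
  have "y \<bullet> im x = - (x \<bullet> im y)"
    using inner_commute[of y "im x"] inner_im_left[of x y] by (rule trans)
  then show ?thesis by (simp add: cip_def complex_eq_iff inner_commute[of y x])
qed

lemma cip_self: "cip x x = complex_of_real (x \<bullet> x)"
  by (simp add: cip_def complex_eq_iff)

lemma Re_cip [simp]: "Re (cip x y) = x \<bullet> y"
  by (simp add: cip_def)

lemma norm_mult_self: "norm x * norm x = x \<bullet> (x::'a::real_inner)"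
  by (metis power2_eq_square power2_norm_eq_inner)

section \<open>Adjoints\<close>

text \<open>The vector is the minimiser of \<open>|x|^2 - 2 f x\<close>; by the parallelogram law minimising sequences
  are Cauchy.\<close>

lemma riesz_representation:
  fixes f :: "'a::{real_inner,complete_space} \<Rightarrow> real"
  assumes f: "bounded_linear f"
  shows "\<exists>y. \<forall>x. f x = x \<bullet> y"
proof -
  interpret bounded_linear f by (rule f)
  define g where "g x = (norm x)\<^sup>2 - 2 * f x" for x
  obtain K where K: "\<And>x. norm (f x) \<le> norm x * K" using bounded by blast
  have lower: "g x \<ge> - K\<^sup>2" for x
  proof -
    have "f x \<le> norm x * K" using K[of x] by simp
    then have "g x \<ge> (norm x)\<^sup>2 - 2 * (norm x * K)" by (simp add: g_def)
    moreover have "(norm x - K)\<^sup>2 \<ge> 0" by simp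
    ultimately show ?thesis by (simp add: power2_diff algebra_simps)
  qed
  define m where "m = Inf (range g)"
  have bdd: "bdd_below (range g)" using lower by (auto intro!: bdd_belowI)
  have m_le: "m \<le> g x" for x unfolding m_def using bdd by (auto intro: cInf_lower)
  have "\<exists>x. g x < m + 1 / Suc n" for n
    using cInf_lessD[of "range g" "m + 1 / Suc n"] unfolding m_def by auto
  then obtain X where X: "\<And>n. g (X n) < m + 1 / Suc n" by metis
  have para: "(norm (x - y))\<^sup>2 = 2 * g x + 2 * g y - 4 * g ((1/2) *\<^sub>R (x + y))" for x y
    by (simp add: g_def add scaleR power2_norm_eq_inner inner_add_left inner_add_right
        inner_diff_left inner_diff_right inner_commute algebra_simps)
  have aux: "a < p \<Longrightarrow> b < q \<Longrightarrow> m \<le> c \<Longrightarrow> 2 * a + 2 * b - 4 * c < 2 * p + 2 * q - 4 * m" for a b c p q :: real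
    by linarith
  have dist_le: "(norm (X n - X k))\<^sup>2 < 2 / Suc n + 2 / Suc k" for n k
  proof -
    have "(norm (X n - X k))\<^sup>2 < 2 * (m + 1 / Suc n) + 2 * (m + 1 / Suc k) - 4 * m"
      unfolding para by (rule aux[OF X X m_le])
    also have "\<dots> = 2 / Suc n + 2 / Suc k" by simp
    finally show ?thesis .
  qed
  have "Cauchy X"
  proof (rule CauchyI)
    fix e :: real assume e: "e > 0"
    then obtain N where N: "N > 0" "4 / e\<^sup>2 < real N"
      using reals_Archimedean2[of "4/e\<^sup>2"] by (metis zero_less_divide_iff dual_order.strict_trans
        of_nat_0_less_iff zero_less_numeral zero_less_power)
    have "norm (X n - X k) < e" if "n \<ge> N" "k \<ge> N" for n k
    proof -
      have "2 / Suc n \<le> 2 / real N" "2 / Suc k \<le> 2 / real N"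
        using that N by (auto simp: frac_le)
      then have "(norm (X n - X k))\<^sup>2 < 4 / real N" using dist_le[of n k] by simp
      also have "\<dots> < e\<^sup>2" using N e by (simp add: field_simps)
      finally show ?thesis using e by (simp add: power2_less_imp_less)
    qed
    then show "\<exists>M. \<forall>m\<ge>M. \<forall>n\<ge>M. norm (X m - X n) < e" by blast
  qed
  then obtain y where y: "X \<longlonglongrightarrow> y" using Cauchy_convergent convergent_def by blast
  have "(\<lambda>n. g (X n)) \<longlonglongrightarrow> g y"
    unfolding g_def by (intro tendsto_intros y tendsto)
  moreover have "(\<lambda>n. m + 1 / Suc n) \<longlonglongrightarrow> m + 0"
    using tendsto_add[OF tendsto_const LIMSEQ_inverse_real_of_nat, of m] by (simp add: divide_inverse)
  ultimately have "g y \<le> m"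
    using LIMSEQ_le[of "\<lambda>n. g (X n)" "g y" "\<lambda>n. m + 1 / Suc n" m] X less_imp_le by auto
  then have min: "g y \<le> g z" for z using m_le[of z] by linarith
  have "f x = x \<bullet> y" for x
  proof -
    have q: "0 \<le> 2 * t * (x \<bullet> y - f x) + t\<^sup>2 * (x \<bullet> x)" for t
      using min[of "y + t *\<^sub>R x"]
      by (simp add: g_def add scaleR norm_mult_self inner_add_left inner_add_right
        inner_commute power2_eq_square algebra_simps)
    define b where "b = x \<bullet> y - f x"
    define c where "c = x \<bullet> x + 1"
    have c: "c > 0" by (simp add: c_def add_nonneg_pos)
    have "0 \<le> 2 * (- b / c) * b + (- b / c)\<^sup>2 * (x \<bullet> x)" using q b_def by blast
    also have "\<dots> \<le> 2 * (- b / c) * b + (- b / c)\<^sup>2 * c"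
      by (simp add: c_def mult_left_mono)
    also have "\<dots> = - (b\<^sup>2 / c)" using c by (simp add: power2_eq_square field_simps)
    finally have "b\<^sup>2 \<le> 0" using c by (simp add: field_simps)
    then show ?thesis by (simp add: b_def)
  qed
  then show ?thesis by blast
qed

definition adj :: "('a::real_inner \<Rightarrow> 'a) \<Rightarrow> 'a \<Rightarrow> 'a" where
  "adj T = (SOME S. \<forall>x y. T x \<bullet> y = x \<bullet> S y)"

lemma inner_ext: "(\<And>x. x \<bullet> a = x \<bullet> b) \<Longrightarrow> a = (b::'a::real_inner)"
  using inner_eq_zero_iff[of "a - b"] by (simp add: inner_diff_right)

lemma adj_unique: "(\<And>x y. T x \<bullet> y = x \<bullet> S y) \<Longrightarrow> adj T = S"
proof -
  assume a: "\<And>x y. T x \<bullet> y = x \<bullet> S y"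
  then have "\<forall>x y. T x \<bullet> y = x \<bullet> adj T y"
    unfolding adj_def by (rule_tac someI[of _ S]) blast
  with a have "x \<bullet> adj T y = x \<bullet> S y" for x y by metis
  then show ?thesis by (intro ext) (rule inner_ext)
qed

lemma adj_inner:
  fixes T :: "'a::{real_inner,complete_space} \<Rightarrow> 'a"
  assumes "bounded_linear T"
  shows "T x \<bullet> y = x \<bullet> adj T y"
proof -
  have "bounded_linear (\<lambda>x. T x \<bullet> y)" for y
    by (rule bounded_linear_compose[OF bounded_linear_inner_left assms])
  then have "\<forall>y. \<exists>z. \<forall>x. T x \<bullet> y = x \<bullet> z" using riesz_representation by blast
  then obtain S where "\<forall>y x. T x \<bullet> y = x \<bullet> S y" by metis
  then show ?thesis using adj_unique[of T S] by metis
qed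

lemma adj_inner': "bounded_linear T \<Longrightarrow> adj T x \<bullet> y = x \<bullet> T (y::'a::{real_inner,complete_space})"
  by (metis adj_inner inner_commute)

lemma adj_bound:
  fixes T :: "'a::{real_inner,complete_space} \<Rightarrow> 'a"
  assumes T: "bounded_linear T" and K: "\<And>x. norm (T x) \<le> K * norm x"
  shows "norm (adj T y) \<le> K * norm y"
proof -
  have "(norm (adj T y))\<^sup>2 = T (adj T y) \<bullet> y"
    by (simp add: power2_norm_eq_inner adj_inner[OF T])
  also have "\<dots> \<le> norm (T (adj T y)) * norm y" by (rule norm_cauchy_schwarz)
  also have "\<dots> \<le> K * norm (adj T y) * norm y" by (intro mult_right_mono K) simp
  finally have "norm (adj T y) * norm (adj T y) \<le> (K * norm y) * norm (adj T y)"
    by (simp add: power2_eq_square algebra_simps)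
  moreover have "0 \<le> K * norm y \<or> y = 0"
    using order_trans[OF norm_ge_zero K[of y]] by auto
  moreover have "adj T 0 = 0"
    by (rule inner_ext) (simp add: adj_inner[OF T, symmetric])
  ultimately show ?thesis by (cases "adj T y = 0") (auto simp: mult_le_cancel_right)
qed

lemma adj_bounded_linear:
  fixes T :: "'a::{real_inner,complete_space} \<Rightarrow> 'a"
  assumes T: "bounded_linear T"
  shows "bounded_linear (adj T)"
proof -
  obtain K where K: "\<And>x. norm (T x) \<le> norm x * K" using bounded_linear.bounded[OF T] by blast
  show ?thesis
  proof (rule bounded_linear_intro[of _ K])
    show "adj T (x + y) = adj T x + adj T y" for x y
      by (rule inner_ext) (simp add: adj_inner[OF T, symmetric] inner_add_right)
    show "adj T (r *\<^sub>R x) = r *\<^sub>R adj T x" for r x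
      by (rule inner_ext) (simp add: adj_inner[OF T, symmetric])
    show "norm (adj T x) \<le> norm x * K" for x
      using adj_bound[OF T, of K x] K by (simp add: mult.commute)
  qed
qed

lemma adj_adj: "bounded_linear T \<Longrightarrow> adj (adj T) = (T::'a::{real_inner,complete_space} \<Rightarrow> 'a)"
  by (rule adj_unique) (simp add: adj_inner')

definition clin :: "('a::chilbert \<Rightarrow> 'a) \<Rightarrow> bool" where
  "clin T \<longleftrightarrow> bounded_linear T \<and> (\<forall>x. T (im x) = im (T x))"

lemma clinD: "clin T \<Longrightarrow> bounded_linear T" "clin T \<Longrightarrow> T (im x) = im (T x)"
  by (auto simp: clin_def)

lemma clin_linear: "clin T \<Longrightarrow> linear T"
  by (auto simp: clin_def bounded_linear.linear)

lemma clin_scaleC: "clin T \<Longrightarrow> T (scaleC c x) = scaleC c (T x)"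
  by (simp add: scaleC_def clinD clin_linear linear_add linear_scale)

lemma clin_adj: assumes "clin T" shows "clin (adj T)"
proof -
  have "adj T (im y) = im (adj T y)" for y
  proof (rule inner_ext)
    fix x
    have "x \<bullet> adj T (im y) = T x \<bullet> im y" using assms by (simp add: adj_inner clinD)
    also have "\<dots> = - (im (T x) \<bullet> y)" by (simp add: inner_im_left)
    also have "\<dots> = - (im x \<bullet> adj T y)" using assms by (simp add: adj_inner[symmetric] clinD)
    also have "\<dots> = x \<bullet> im (adj T y)" by (simp add: inner_im_left)
    finally show "x \<bullet> adj T (im y) = x \<bullet> im (adj T y)" .
  qed
  then show ?thesis using assms by (simp add: clin_def adj_bounded_linear)
qed

lemma clin_id: "clin (\<lambda>x. x)"
  by (simp add: clin_def)

lemma clin_zero: "clin (\<lambda>x. 0)"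
  by (simp add: clin_def)

lemma clin_add: "clin S \<Longrightarrow> clin T \<Longrightarrow> clin (\<lambda>x. S x + T x)"
  by (auto simp: clin_def im_add intro: bounded_linear_add)

lemma clin_diff: "clin S \<Longrightarrow> clin T \<Longrightarrow> clin (\<lambda>x. S x - T x)"
  by (auto simp: clin_def im_diff intro: bounded_linear_sub)

lemma bounded_linear_scaleC: "bounded_linear (scaleC c)"
  unfolding scaleC_def
  by (intro bounded_linear_add bounded_linear_scaleR_right bounded_linear_compose[OF bounded_linear_scaleR_right]
     bounded_linear_im)

lemma im_scaleC: "im (scaleC c x) = scaleC c (im x)"
  by (simp add: scaleC_def im_add im_scaleR im_minus)

lemma clin_scaleC_op: "clin T \<Longrightarrow> clin (\<lambda>x. scaleC c (T x))"
  unfolding clin_def using bounded_linear_compose[OF bounded_linear_scaleC, of T c]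
  by (auto simp: im_scaleC)

lemma clin_comp: "clin S \<Longrightarrow> clin T \<Longrightarrow> clin (\<lambda>x. S (T x))"
  by (auto simp: clin_def intro: bounded_linear_compose)

lemma adj_comp: "bounded_linear S \<Longrightarrow> bounded_linear T \<Longrightarrow>
    adj (\<lambda>x. S (T x)) = (\<lambda>x. adj T (adj S (x::'a::{real_inner,complete_space})))"
  by (rule adj_unique) (simp add: adj_inner)

lemma adj_add: "bounded_linear S \<Longrightarrow> bounded_linear T \<Longrightarrow>
    adj (\<lambda>x. S x + T x) = (\<lambda>x. adj S x + adj T (x::'a::{real_inner,complete_space}))"
  by (rule adj_unique) (simp add: adj_inner inner_add_left inner_add_right)

lemma scaleC_inner: "scaleC c x \<bullet> y = x \<bullet> scaleC (cnj c) y"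
  by (simp add: scaleC_def inner_add_left inner_add_right inner_diff_right inner_im_left)

lemma adj_scaleC: "clin T \<Longrightarrow> adj (\<lambda>x. scaleC c (T x)) = (\<lambda>x. scaleC (cnj c) (adj T x))"
  by (rule adj_unique) (simp add: scaleC_inner adj_inner clinD clin_scaleC[OF clin_adj])

lemma cip_adj: "clin T \<Longrightarrow> cip (T x) y = cip x (adj T y)"
  by (simp add: cip_def adj_inner clinD clinD(2)[OF clin_adj])

section \<open>Coercive operators\<close>

text \<open>The Lax-Milgram theorem: for small \<open>e\<close> the map \<open>v \<mapsto> v - e (P v - w)\<close> is a contraction, and
  its fixed point solves \<open>P v = w\<close>.  It supplies the inverses of \<open>1 + a\<^sup>2\<close> for symmetric \<open>a\<close>.\<close>

lemma coercive_bij: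
  fixes P :: "'a::{real_inner,complete_space} \<Rightarrow> 'a"
  assumes P: "bounded_linear P" and coer: "\<And>x. x \<bullet> x \<le> P x \<bullet> x"
  shows "bij P" "bounded_linear (inv_into UNIV P)" "norm (inv_into UNIV P x) \<le> norm x"
proof -
  interpret bounded_linear P by (rule P)
  obtain K0 where K0: "\<And>x. norm (P x) \<le> norm x * K0" using bounded by blast
  define K where "K = max K0 1"
  have K: "norm (P x) \<le> norm x * K" for x
    by (rule order_trans[OF K0]) (simp add: K_def mult_left_mono)
  have K1: "K \<ge> 1" by (simp add: K_def)
  \<comment> \<open>with this step length the contraction factor is \<open>sqrt (1 - 1 / K^2)\<close>\<close>
  define e where "e = 1 / K\<^sup>2"
  define q where "q = sqrt (1 - 1 / K\<^sup>2)"
  have e: "e > 0" using K1 by (simp add: e_def)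
  have iK: "1 / K\<^sup>2 \<le> 1" "1 / K\<^sup>2 > 0" using K1 by auto
  have q: "0 \<le> q" "q < 1" using iK unfolding q_def by auto
  have contr: "norm (x - e *\<^sub>R P x) \<le> q * norm x" for x
  proof -
    have "(norm (x - e *\<^sub>R P x))\<^sup>2 = x \<bullet> x - 2 * e * (P x \<bullet> x) + e\<^sup>2 * (norm (P x))\<^sup>2"
      by (simp add: norm_mult_self inner_diff_left inner_diff_right inner_commute
          power2_eq_square algebra_simps)
    also have "\<dots> \<le> x \<bullet> x - 2 * e * (x \<bullet> x) + e\<^sup>2 * (norm x * K)\<^sup>2"
      using e coer[of x] by (intro add_mono diff_left_mono mult_left_mono power_mono K) auto
    also have "\<dots> = (q * norm x)\<^sup>2"
    proof -
      have q2: "q\<^sup>2 = 1 - e" unfolding q_def e_def using iK by simp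
      moreover have "e\<^sup>2 * (norm x * K)\<^sup>2 = e * (x \<bullet> x)"
        using K1 unfolding e_def by (simp add: power_mult_distrib norm_mult_self power2_eq_square)
      ultimately show ?thesis
        unfolding power_mult_distrib[of q] power2_norm_eq_inner q2 by (simp add: algebra_simps)
    qed
    finally show ?thesis by (rule power2_le_imp_le) (use q in simp)
  qed
  have ex: "\<exists>!v. v - e *\<^sub>R (P v - w) = v" for w
  proof (rule banach_fix_type[OF q], intro allI)
    fix x y
    show "dist (x - e *\<^sub>R (P x - w)) (y - e *\<^sub>R (P y - w)) \<le> q * dist x y"
      using contr[of "x - y"] by (simp add: dist_norm diff algebra_simps)
  qed
  then have uniq: "\<exists>!v. P v = w" for w
    using e by simp
  show bij: "bij P"
    unfolding bij_def inj_def surj_def using uniq by metis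
  have PP: "P (inv_into UNIV P x) = x" for x using bij by (simp add: bij_is_surj surj_f_inv_f)
  show nrm: "norm (inv_into UNIV P x) \<le> norm x" for x
  proof -
    have "norm (inv_into UNIV P x) * norm (inv_into UNIV P x) \<le> x \<bullet> inv_into UNIV P x"
      using coer[of "inv_into UNIV P x"] by (simp add: PP power2_norm_eq_inner[symmetric] power2_eq_square)
    also have "\<dots> \<le> norm x * norm (inv_into UNIV P x)" by (rule norm_cauchy_schwarz)
    finally show ?thesis by (cases "inv_into UNIV P x = 0") (auto simp: mult_le_cancel_right)
  qed
  show "bounded_linear (inv_into UNIV P)"
  proof (rule bounded_linear_intro[of _ 1])
    show "inv_into UNIV P (x + y) = inv_into UNIV P x + inv_into UNIV P y" for x y
      by (rule injD[OF bij_is_inj[OF bij]]) (simp add: PP add)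
    show "inv_into UNIV P (r *\<^sub>R x) = r *\<^sub>R inv_into UNIV P x" for r x
      by (rule injD[OF bij_is_inj[OF bij]]) (simp add: PP scaleR)
  qed (use nrm in simp)
qed

section \<open>Bounded monotone nets of operators\<close>

lemma positive_form_cauchy_schwarz:
  fixes P :: "'a::real_inner \<Rightarrow> 'a"
  assumes lin: "linear P" and sym: "\<And>x y. P x \<bullet> y = x \<bullet> P y" and pos: "\<And>x. 0 \<le> P x \<bullet> x"
  shows "(P x \<bullet> y)\<^sup>2 \<le> (P x \<bullet> x) * (P y \<bullet> y)"
proof -
  have "0 \<le> P x \<bullet> x + 2 * t * (P x \<bullet> y) + t\<^sup>2 * (P y \<bullet> y)" for t
  proof -
    have "P y \<bullet> x = P x \<bullet> y" using sym[of y x] by (simp add: inner_commute)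
    then show ?thesis
    using pos[of "x + t *\<^sub>R y"] lin
    by (simp add: linear_add linear_scale inner_add_left inner_add_right
        power2_eq_square algebra_simps)
  qed
  note q = this
  show ?thesis
  proof (cases "P y \<bullet> y = 0")
    case True
    have "P x \<bullet> y = 0"
    proof (rule ccontr)
      assume n: "P x \<bullet> y \<noteq> 0"
      have "0 \<le> P x \<bullet> x + 2 * (- (P x \<bullet> x + 1) / (2 * (P x \<bullet> y))) * (P x \<bullet> y)"
        using q[of "- (P x \<bullet> x + 1) / (2 * (P x \<bullet> y))"] True by simp
      moreover have "2 * (- (P x \<bullet> x + 1) / (2 * (P x \<bullet> y))) * (P x \<bullet> y) = - (P x \<bullet> x + 1)"
        using n by (simp add: field_simps)
      ultimately show False by linarith
    qed
    then show ?thesis using True by simp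
  next
    case False
    then have c: "P y \<bullet> y > 0" using pos[of y] by simp
    have "0 \<le> P x \<bullet> x + 2 * (- (P x \<bullet> y) / (P y \<bullet> y)) * (P x \<bullet> y) + (- (P x \<bullet> y) / (P y \<bullet> y))\<^sup>2 * (P y \<bullet> y)"
      by (rule q)
    also have "\<dots> = P x \<bullet> x - (P x \<bullet> y)\<^sup>2 / (P y \<bullet> y)"
      using c by (simp add: power2_eq_square field_simps)
    finally show ?thesis using c by (simp add: field_simps)
  qed
qed

text \<open>Cauchy-Schwarz for the form \<open>P x \<bullet> y\<close> at \<open>y = P x\<close>.  It turns convergence of the quadratic forms
  of a monotone net into strong convergence.\<close>

lemma positive_op_norm_le:
  fixes P :: "'a::real_inner \<Rightarrow> 'a"
  assumes lin: "linear P" and sym: "\<And>x y. P x \<bullet> y = x \<bullet> P y" and pos: "\<And>x. 0 \<le> P x \<bullet> x"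
    and le: "\<And>x. P x \<bullet> x \<le> C * (norm x)\<^sup>2"
  shows "(norm (P x))\<^sup>2 \<le> C * (P x \<bullet> x)"
proof -
  have "(norm (P x))\<^sup>2 * (norm (P x))\<^sup>2 = (P x \<bullet> P x)\<^sup>2"
    by (simp add: norm_mult_self power2_eq_square)
  also have "\<dots> \<le> (P x \<bullet> x) * (P (P x) \<bullet> P x)"
    by (rule positive_form_cauchy_schwarz[OF lin sym pos])
  also have "\<dots> \<le> (P x \<bullet> x) * (C * (norm (P x))\<^sup>2)"
    by (intro mult_left_mono le pos)
  finally have le4: "(norm (P x))\<^sup>2 * (norm (P x))\<^sup>2 \<le> (C * (P x \<bullet> x)) * (norm (P x))\<^sup>2"
    by (simp add: algebra_simps)
  have "C * (P x \<bullet> x) \<ge> 0 \<or> P x = 0"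
  proof (cases "x = 0")
    case False
    have "0 \<le> C * (norm x)\<^sup>2" using pos[of x] le[of x] by linarith
    then have "C \<ge> 0" using False by (simp add: zero_le_mult_iff)
    then show ?thesis using pos by simp
  qed (use lin in \<open>simp add: linear_0\<close>)
  then show ?thesis
    by (cases "P x = 0") (simp_all add: mult_right_le_imp_le[OF le4])
qed

definition op_below :: "('a::real_inner \<Rightarrow> 'a) \<Rightarrow> ('a \<Rightarrow> 'a) \<Rightarrow> bool" where
  "op_below S T \<longleftrightarrow> (\<forall>x. S x \<bullet> x \<le> T x \<bullet> x)"

text \<open>The analogue of Vigier's theorem.  The limit is taken along the filter of final segments,
  so that identities between operators of the net pass to the limit by uniqueness of limits.\<close>

lemma monotone_net_converges:
  fixes D :: "('a::{real_inner,complete_space} \<Rightarrow> 'a) set"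
  assumes ne: "D \<noteq> {}" and bl: "\<And>d. d \<in> D \<Longrightarrow> bounded_linear d"
    and sym: "\<And>d x y. d \<in> D \<Longrightarrow> d x \<bullet> y = x \<bullet> d y"
    and dir: "\<And>d e. d \<in> D \<Longrightarrow> e \<in> D \<Longrightarrow> \<exists>f\<in>D. op_below d f \<and> op_below e f"
    and s: "bounded_linear s" "\<And>d. d \<in> D \<Longrightarrow> op_below d s"
  shows "\<exists>F t. F \<noteq> bot \<and> (\<forall>d0\<in>D. \<forall>\<^sub>F d in F. d \<in> D \<and> op_below d0 d) \<and>
     (\<forall>x. ((\<lambda>d. d x) \<longlongrightarrow> t x) F)"
proof -
  define F where "F = (INF d0\<in>D. principal {d\<in>D. op_below d0 d})"
  have base: "eventually P F \<longleftrightarrow> (\<exists>d0\<in>D. \<forall>d\<in>D. op_below d0 d \<longrightarrow> P d)" for P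
    unfolding F_def
  proof (subst eventually_INF_base[OF ne])
    fix a b assume "a \<in> D" "b \<in> D"
    then obtain f where "f \<in> D" "op_below a f" "op_below b f" using dir by blast
    then show "\<exists>x\<in>D. principal {d\<in>D. op_below x d} \<le> inf (principal {d\<in>D. op_below a d}) (principal {d\<in>D. op_below b d})"
      unfolding op_below_def by (intro bexI[of _ f]) (auto intro: order_trans)
  qed (auto simp: eventually_principal)
  have refl: "op_below d d" for d :: "'a \<Rightarrow> 'a" by (simp add: op_below_def)
  have nb: "F \<noteq> bot" unfolding trivial_limit_def base using refl by blast
  have ev: "\<forall>d0\<in>D. \<forall>\<^sub>F d in F. d \<in> D \<and> op_below d0 d" unfolding base by auto
  have conv: "\<exists>l. ((\<lambda>d. d x) \<longlongrightarrow> l) F" for x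
  proof -
    obtain d0 where d0: "d0 \<in> D" using ne by blast
    have bls: "bounded_linear (\<lambda>y. s y - d0 y)" using s bl[OF d0] by (intro bounded_linear_sub)
    then obtain C0 where C0: "\<And>y. norm (s y - d0 y) \<le> norm y * C0" using bounded_linear.bounded by blast
    define C where "C = max C0 1"
    have Cpos: "C > 0" by (simp add: C_def)
    have C: "(s y - d0 y) \<bullet> y \<le> C * (norm y)\<^sup>2" for y
    proof -
      have "(s y - d0 y) \<bullet> y \<le> norm (s y - d0 y) * norm y" by (rule norm_cauchy_schwarz)
      also have "\<dots> \<le> (norm y * C0) * norm y" by (intro mult_right_mono C0) simp
      also have "\<dots> \<le> (norm y * C) * norm y" by (intro mult_right_mono mult_left_mono) (auto simp: C_def)
      finally show ?thesis by (simp add: power2_eq_square algebra_simps)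
    qed
    have key: "(norm (d x - d1 x))\<^sup>2 \<le> C * (d x \<bullet> x - d1 x \<bullet> x)"
      if "d \<in> D" "d1 \<in> D" "op_below d0 d1" "op_below d1 d" for d d1
    proof -
      have "(norm (d x - d1 x))\<^sup>2 \<le> C * ((d x - d1 x) \<bullet> x)"
      proof (rule positive_op_norm_le)
        show "linear (\<lambda>x. d x - d1 x)"
          using bl that bounded_linear_sub bounded_linear.linear by blast
        show "(d x - d1 x) \<bullet> y = x \<bullet> (d y - d1 y)" for x y
          using sym that by (simp add: inner_diff_left inner_diff_right)
        show "0 \<le> (d x - d1 x) \<bullet> x" for x
          using that by (simp add: inner_diff_left op_below_def)
        show "(d y - d1 y) \<bullet> y \<le> C * (norm y)\<^sup>2" for y
        proof -
          have "d y \<bullet> y \<le> s y \<bullet> y" "d0 y \<bullet> y \<le> d1 y \<bullet> y" using s(2) that by (auto simp: op_below_def)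
          then show ?thesis using C[of y] by (simp add: inner_diff_left)
        qed
      qed
      then show ?thesis by (simp add: inner_diff_left)
    qed
    define \<alpha> where "\<alpha> = (SUP d\<in>D. d x \<bullet> x)"
    have bdd: "bdd_above ((\<lambda>d. d x \<bullet> x) ` D)"
      using s(2) by (intro bdd_aboveI[of _ "s x \<bullet> x"]) (auto simp: op_below_def)
    have "cauchy_filter (filtermap (\<lambda>d. d x) F)"
      unfolding cauchy_filter_metric_filtermap
    proof (intro allI impI)
      fix e :: real assume e: "e > 0"
      define \<eta> where "\<eta> = e\<^sup>2 / (8 * C)"
      have \<eta>: "\<eta> > 0" using e Cpos by (simp add: \<eta>_def)
      obtain d2 where d2: "d2 \<in> D" "\<alpha> - \<eta> < d2 x \<bullet> x"
        using less_cSUP_iff[OF ne bdd, of "\<alpha> - \<eta>"] \<eta> unfolding \<alpha>_def by auto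
      obtain d1 where d1: "d1 \<in> D" "op_below d0 d1" "op_below d2 d1" using dir d0 d2(1) by blast
      have near: "norm (d x - d1 x) < e / 2" if d: "d \<in> D" "op_below d1 d" for d
      proof -
        have "d x \<bullet> x \<le> \<alpha>" unfolding \<alpha>_def using bdd d(1) by (intro cSUP_upper)
        moreover have "d2 x \<bullet> x \<le> d1 x \<bullet> x" using d1(3) by (simp add: op_below_def)
        ultimately have "d x \<bullet> x - d1 x \<bullet> x < \<eta>" using d2(2) by linarith
        then have "(norm (d x - d1 x))\<^sup>2 < C * \<eta>"
          using le_less_trans[OF key[OF d(1) d1(1,2) d(2)] mult_strict_left_mono] Cpos by blast
        also have "C * \<eta> = e\<^sup>2 / 8" using Cpos by (simp add: \<eta>_def)
        also have "\<dots> < (e/2)\<^sup>2" using e by (simp add: power_divide)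
        finally show ?thesis by (rule power2_less_imp_less) (use e in simp)
      qed
      show "\<exists>P. eventually P F \<and> (\<forall>d d'. P d \<and> P d' \<longrightarrow> dist (d x) (d' x) < e)"
      proof (intro exI[of _ "\<lambda>d. d \<in> D \<and> op_below d1 d"] conjI allI impI)
        show "eventually (\<lambda>d. d \<in> D \<and> op_below d1 d) F" using ev d1(1) by blast
        fix d d' assume a: "(d \<in> D \<and> op_below d1 d) \<and> d' \<in> D \<and> op_below d1 d'"
        have "dist (d x) (d' x) \<le> dist (d x) (d1 x) + dist (d' x) (d1 x)"
          by (metis dist_commute dist_triangle)
        then show "dist (d x) (d' x) < e" using near[of d] near[of d'] a by (simp add: dist_norm)
      qed
    qed
    moreover have "filtermap (\<lambda>d. d x) F \<noteq> bot" using nb by (simp add: filtermap_bot_iff)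
    ultimately obtain l where "filtermap (\<lambda>d. d x) F \<le> nhds l"
      using complete_uniform[THEN iffD1, OF complete_UNIV[where 'a='a], rule_format, of "filtermap (\<lambda>d. d x) F"]
      by auto
    then show ?thesis unfolding filterlim_def by (rule exI)
  qed
  then have "\<exists>t. \<forall>x. ((\<lambda>d. d x) \<longlongrightarrow> t x) F" by (intro choice allI)
  then obtain t where "\<forall>x. ((\<lambda>d. d x) \<longlongrightarrow> t x) F" by (rule exE)
  then show ?thesis using nb ev by (intro exI[of _ F] exI[of _ t] conjI)
qed

section \<open>Commutants\<close>

definition ocomm :: "('h::chilbert \<Rightarrow> 'h) set \<Rightarrow> ('h \<Rightarrow> 'h) set" where
  "ocomm A = {T. clin T \<and> (\<forall>S\<in>A. \<forall>x. S (T x) = T (S x))}"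

lemma ocomm_triple: "(\<And>S. S \<in> A \<Longrightarrow> clin S) \<Longrightarrow> ocomm (ocomm (ocomm A)) = ocomm A"
  unfolding ocomm_def by auto

text \<open>A monotone net of elements of a commutant converges strongly to an element \<open>t\<close> of that commutant,
  which is an upper bound; the supremum \<open>s\<close> of the net in the commutant therefore lies below \<open>t\<close>, and
  vector states see it as the supremum of their values on the net.  This is normality.\<close>

lemma ocomm_sup:
  fixes A :: "('h::chilbert \<Rightarrow> 'h) set"
  assumes A: "\<And>S. S \<in> A \<Longrightarrow> clin S"
    and D: "D \<subseteq> ocomm A" "D \<noteq> {}"
    and sym: "\<And>d x y. d \<in> D \<Longrightarrow> d x \<bullet> y = x \<bullet> d y"
    and dir: "\<And>d e. d \<in> D \<Longrightarrow> e \<in> D \<Longrightarrow> \<exists>f\<in>D. op_below d f \<and> op_below e f"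
    and s: "clin s" "\<And>d. d \<in> D \<Longrightarrow> op_below d s"
    and least: "\<And>t. t \<in> ocomm A \<Longrightarrow> (\<And>x y. t x \<bullet> y = x \<bullet> t y) \<Longrightarrow> (\<And>d. d \<in> D \<Longrightarrow> op_below d t)
      \<Longrightarrow> op_below s t"
  shows "s v \<bullet> v = (SUP d\<in>D. d v \<bullet> v)"
proof -
  have cl: "clin d" if "d \<in> D" for d using D that by (auto simp: ocomm_def)
  note bl = clinD(1)[OF cl]
  have "\<exists>F t. F \<noteq> bot \<and> (\<forall>d0\<in>D. \<forall>\<^sub>F d in F. d \<in> D \<and> op_below d0 d) \<and> (\<forall>x. ((\<lambda>d. d x) \<longlongrightarrow> t x) F)"
    by (rule monotone_net_converges[OF D(2) bl sym dir clinD(1)[OF s(1)] s(2)])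
  then obtain F t where Ft: "F \<noteq> bot \<and> (\<forall>d0\<in>D. \<forall>\<^sub>F d in F. d \<in> D \<and> op_below d0 d) \<and> (\<forall>x. ((\<lambda>d. d x) \<longlongrightarrow> t x) F)"
    by (elim exE)
  note nb = Ft[THEN conjunct1] and ev = Ft[THEN conjunct2, THEN conjunct1]
    and lim = Ft[THEN conjunct2, THEN conjunct2, rule_format]
  obtain d0 where d0: "d0 \<in> D" using D by blast
  have evD: "\<forall>\<^sub>F d in F. d \<in> D" by (rule eventually_mono[OF ev[rule_format, OF d0]]) simp
  have lim_eq: "a = b" if "((\<lambda>d. f d) \<longlongrightarrow> a) F" "((\<lambda>d. g d) \<longlongrightarrow> b) F" "\<And>d. d \<in> D \<Longrightarrow> f d = g d"
    for f g :: "('h \<Rightarrow> 'h) \<Rightarrow> 'b::t2_space" and a b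
  proof -
    have "(g \<longlongrightarrow> a) F"
      using that(1) by (rule tendsto_cong[THEN iffD1, rotated]) (rule eventually_mono[OF evD], rule that(3))
    then show ?thesis using tendsto_unique[OF nb] that(2) by blast
  qed
  have t_lin: "linear t"
  proof
    show "t (x + y) = t x + t y" for x y
      by (rule lim_eq[OF lim tendsto_add[OF lim[of x] lim[of y]]])
        (simp add: linear_add clin_linear cl)
    show "t (r *\<^sub>R x) = r *\<^sub>R t x" for r x
      by (rule lim_eq[OF lim tendsto_scaleR[OF tendsto_const lim[of x]]])
        (simp add: linear_scale clin_linear cl)
  qed
  have t_sym: "t x \<bullet> y = x \<bullet> t y" for x y
    by (rule lim_eq[OF tendsto_inner[OF lim tendsto_const] tendsto_inner[OF tendsto_const lim]])
      (rule sym)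
  have lower: "op_below d t" if d: "d \<in> D" for d
    unfolding op_below_def
  proof
    fix x
    show "d x \<bullet> x \<le> t x \<bullet> x"
    proof (rule tendsto_lowerbound[OF tendsto_inner[OF lim tendsto_const] _ nb])
      show "\<forall>\<^sub>F e in F. d x \<bullet> x \<le> e x \<bullet> x"
        by (rule eventually_mono[OF ev[rule_format, OF d]]) (simp add: op_below_def)
    qed
  qed
  have upper: "t x \<bullet> x \<le> b" if "\<And>d. d \<in> D \<Longrightarrow> d x \<bullet> x \<le> b" for x b
    by (rule tendsto_upperbound[OF tendsto_inner[OF lim tendsto_const] _ nb])
      (rule eventually_mono[OF evD], rule that)
  have t_bl: "bounded_linear t"
  proof -
    have "bounded_linear (\<lambda>y. s y - d0 y)" using clinD(1)[OF s(1)] bl[OF d0] by (intro bounded_linear_sub)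
    then obtain C0 where C0: "\<And>y. norm (s y - d0 y) \<le> norm y * C0" using bounded_linear.bounded by blast
    define C where "C = max C0 0"
    have C: "(s y - d0 y) \<bullet> y \<le> C * (norm y)\<^sup>2" for y
    proof -
      have "(s y - d0 y) \<bullet> y \<le> norm (s y - d0 y) * norm y" by (rule norm_cauchy_schwarz)
      also have "\<dots> \<le> (norm y * C0) * norm y" by (intro mult_right_mono C0) simp
      also have "\<dots> \<le> (norm y * C) * norm y" by (intro mult_right_mono mult_left_mono) (auto simp: C_def)
      finally show ?thesis by (simp add: power2_eq_square algebra_simps)
    qed
    have PC: "(t y - d0 y) \<bullet> y \<le> C * (norm y)\<^sup>2" for y
      using upper[of y "s y \<bullet> y"] s(2) C[of y] by (auto simp: op_below_def inner_diff_left)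
    have "(norm (t y - d0 y))\<^sup>2 \<le> C * ((t y - d0 y) \<bullet> y)" for y
    proof (rule positive_op_norm_le)
      show "linear (\<lambda>y. t y - d0 y)" by (intro linear_compose_sub t_lin clin_linear cl d0)
      show "(t x - d0 x) \<bullet> y = x \<bullet> (t y - d0 y)" for x y
        using sym[OF d0] t_sym by (simp add: inner_diff_left inner_diff_right)
      show "0 \<le> (t x - d0 x) \<bullet> x" for x using lower[OF d0] by (simp add: op_below_def inner_diff_left)
    qed (rule PC)
    then have "(norm (t y - d0 y))\<^sup>2 \<le> C * (C * (norm y)\<^sup>2)" for y
      using mult_left_mono[OF PC[of y], of C] by (fastforce simp: C_def intro: order_trans)
    then have "(norm (t y - d0 y))\<^sup>2 \<le> (C * norm y)\<^sup>2" for y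
      by (simp add: power2_eq_square algebra_simps)
    then have nb2: "norm (t y - d0 y) \<le> C * norm y" for y
      by (rule power2_le_imp_le) (simp add: C_def)
    have "bounded_linear (\<lambda>y. t y - d0 y)"
      by (rule bounded_linear_intro[of _ C])
        (use t_lin clin_linear[OF cl[OF d0]] nb2 in
          \<open>auto simp: linear_add linear_scale mult.commute algebra_simps\<close>)
    from bounded_linear_add[OF this bl[OF d0]] show ?thesis by simp
  qed
  have t_comm: "t \<in> ocomm A"
    unfolding ocomm_def clin_def
  proof (intro CollectI conjI ballI allI t_bl)
    show "t (im x) = im (t x)" for x
      by (rule lim_eq[OF lim bounded_linear.tendsto[OF bounded_linear_im lim]]) (simp add: cl clinD)
    fix S x assume S: "S \<in> A"
    show "S (t x) = t (S x)"
      by (rule lim_eq[OF bounded_linear.tendsto[OF clinD(1)[OF A[OF S]] lim] lim])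
        (use S D in \<open>auto simp: ocomm_def\<close>)
  qed
  have st: "s v \<bullet> v \<le> t v \<bullet> v"
    using least[OF t_comm t_sym lower] by (auto simp: op_below_def)
  have bdd: "bdd_above ((\<lambda>d. d v \<bullet> v) ` D)"
    using s(2) by (intro bdd_aboveI[of _ "s v \<bullet> v"]) (auto simp: op_below_def)
  show ?thesis
  proof (rule antisym)
    show "s v \<bullet> v \<le> (SUP d\<in>D. d v \<bullet> v)"
      by (rule order_trans[OF st upper]) (rule cSUP_upper[OF _ bdd])
    show "(SUP d\<in>D. d v \<bullet> v) \<le> s v \<bullet> v"
      using s(2) D(2) by (intro cSUP_least) (auto simp: op_below_def)
  qed
qed

section \<open>Standard representations of tracial algebras\<close>

text \<open>The common frame for the factor and its ultrapower: \<open>L\<close> is a *-closed family of left multiplications,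
  the antiunitary \<open>J\<close> extends \<open>x Om \<mapsto> x\<^sup>* Om\<close>, and \<open>J L J\<close> are the right multiplications.  The von Neumann
  algebra \<open>N\<close> is defined as the commutant of the right multiplications, so the double commutant
  property is automatic; what must be worked for in each instance is to know the elements of \<open>N\<close>.\<close>

locale tracial_rep =
  fixes L :: "('h::chilbert \<Rightarrow> 'h) set" and J :: "'h \<Rightarrow> 'h" and Om :: 'h
  assumes J_bl: "bounded_linear J" and J_im: "\<And>x. J (im x) = - im (J x)"
    and JJ [simp]: "\<And>x. J (J x) = x" and J_inner: "\<And>x y. J x \<bullet> J y = x \<bullet> y"
    and J_Om [simp]: "J Om = Om" and Om_Om [simp]: "Om \<bullet> Om = 1"
    and L_clin: "\<And>x. x \<in> L \<Longrightarrow> clin x" and L_adj: "\<And>x. x \<in> L \<Longrightarrow> adj x \<in> L"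
    and L_J: "\<And>x. x \<in> L \<Longrightarrow> J (x Om) = adj x Om"
    and L_total: "\<And>v. (\<And>x. x \<in> L \<Longrightarrow> v \<bullet> x Om = 0) \<Longrightarrow> v = 0"
    and L_comm: "\<And>x y v. x \<in> L \<Longrightarrow> y \<in> L \<Longrightarrow> x (J (y (J v))) = J (y (J (x v)))"
begin

definition N :: "('h \<Rightarrow> 'h) set" where
  "N = {T. clin T \<and> (\<forall>x\<in>L. \<forall>v. J (x (J (T v))) = T (J (x (J v))))}"

lemma J_left: "J x \<bullet> y = x \<bullet> J y"
  using J_inner[of x "J y"] by simp

lemma norm_J [simp]: "norm (J x) = norm x"
  by (simp add: norm_eq_sqrt_inner J_inner)

lemma J_lin: "linear J" using J_bl by (rule bounded_linear.linear)

lemma J_minus: "J (- x) = - J x" by (rule linear_neg[OF J_lin])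

lemma norm_Om [simp]: "norm Om = 1"
  by (simp add: norm_eq_sqrt_inner)

lemma clin_JJ: "clin T \<Longrightarrow> clin (\<lambda>v. J (T (J v)))"
  using bounded_linear_compose[OF J_bl bounded_linear_compose[OF _ J_bl, of T]]
  by (auto simp: clin_def J_im J_minus linear_neg bounded_linear.linear)

lemma N_ocomm: "N = ocomm ((\<lambda>x v. J (x (J v))) ` L)"
  by (auto simp: N_def ocomm_def)

lemma R_clin: "S \<in> (\<lambda>x v. J (x (J v))) ` L \<Longrightarrow> clin S"
  using L_clin clin_JJ by blast

lemma N_double_commutant: "ocomm (ocomm N) = N"
  unfolding N_ocomm by (rule ocomm_triple[OF R_clin])

lemma N_clin: "T \<in> N \<Longrightarrow> clin T"
  by (simp add: N_def)

lemma L_subset_N: "L \<subseteq> N"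
  using L_comm L_clin by (auto simp: N_def)

lemma N_id: "(\<lambda>x. x) \<in> N"
  by (simp add: N_def clin_id)

lemma R_linear: "x \<in> L \<Longrightarrow> linear (\<lambda>v. J (x (J v)))"
  using R_clin clin_linear by blast

lemma N_zero: "(\<lambda>x. 0) \<in> N"
  using linear_0[OF R_linear] by (auto simp: N_def clin_zero)

lemma N_add: "S \<in> N \<Longrightarrow> T \<in> N \<Longrightarrow> (\<lambda>x. S x + T x) \<in> N"
  using linear_add[OF R_linear] by (auto simp: N_def clin_add)

lemma N_diff: "S \<in> N \<Longrightarrow> T \<in> N \<Longrightarrow> (\<lambda>x. S x - T x) \<in> N"
  using linear_diff[OF R_linear] by (auto simp: N_def clin_diff)

lemma N_comp: "S \<in> N \<Longrightarrow> T \<in> N \<Longrightarrow> (\<lambda>x. S (T x)) \<in> N"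
  by (auto simp: N_def clin_comp)

lemma N_scaleC: "T \<in> N \<Longrightarrow> (\<lambda>x. scaleC c (T x)) \<in> N"
  using clin_scaleC[OF clin_JJ[OF L_clin]] by (auto simp: N_def clin_scaleC_op)

lemma N_scaleR: "T \<in> N \<Longrightarrow> (\<lambda>x. r *\<^sub>R T x) \<in> N"
  using N_scaleC[of T "of_real r"] by simp

lemma N_sum: "(\<And>i. i \<in> A \<Longrightarrow> f i \<in> N) \<Longrightarrow> (\<lambda>x. \<Sum>i\<in>A. f i x) \<in> N"
  by (induction A rule: infinite_finite_induct) (auto simp: N_zero N_add)

lemma N_adj: assumes T: "T \<in> N" shows "adj T \<in> N"
  unfolding N_def
proof (intro CollectI conjI ballI allI)
  show "clin (adj T)" using T by (simp add: N_clin clin_adj)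
  fix x v assume x: "x \<in> L"
  show "J (x (J (adj T v))) = adj T (J (x (J v)))"
  proof (rule inner_ext)
    fix u
    have "u \<bullet> J (x (J (adj T v))) = T (J (adj x (J u))) \<bullet> v"
      using x T by (simp add: J_left[symmetric] adj_inner'[symmetric] adj_inner L_clin N_clin clinD)
    also have "\<dots> = J (adj x (J (T u))) \<bullet> v"
      using T L_adj[OF x] by (simp add: N_def)
    also have "\<dots> = u \<bullet> adj T (J (x (J v)))"
      using x T by (simp add: J_left adj_inner' adj_inner[symmetric] L_clin N_clin clinD)
    finally show "u \<bullet> J (x (J (adj T v))) = u \<bullet> adj T (J (x (J v)))" .
  qed
qed

lemma zero_if_zero_on_L:
  assumes C: "clin C" and z: "\<And>x. x \<in> L \<Longrightarrow> C (x Om) = 0"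
  shows "C v = 0"
proof -
  have "adj C w = 0" for w
    by (rule L_total) (simp add: adj_inner' C clinD z)
  then have "C v \<bullet> C v = 0" by (simp add: adj_inner C clinD)
  then show ?thesis by simp
qed

lemma N_on_L: "T \<in> N \<Longrightarrow> x \<in> L \<Longrightarrow> T (x Om) = J (adj x (J (T Om)))"
  using L_J[OF L_adj, of x] L_adj[of x] by (simp add: N_def adj_adj L_clin clinD)

text \<open>An element of \<open>N\<close> is determined by its symbol \<open>T Om\<close>, and on symbols the adjoint is \<open>J\<close>.  All
  properties of the trace follow from this.\<close>

lemma N_adj_Om: assumes T: "T \<in> N" shows "adj T Om = J (T Om)"
proof -
  have "(adj T Om - J (T Om)) \<bullet> x Om = 0" if x: "x \<in> L" for x
  proof -
    have "adj T Om \<bullet> x Om = Om \<bullet> J (adj x (J (T Om)))"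
      using T x by (simp add: adj_inner' N_clin clinD N_on_L)
    also have "\<dots> = Om \<bullet> adj x (J (T Om))" by (simp add: J_left[symmetric])
    also have "\<dots> = J (T Om) \<bullet> x Om" using x by (simp add: adj_inner[symmetric] L_clin clinD inner_commute)
    finally show ?thesis by (simp add: inner_diff_left)
  qed
  then show ?thesis using L_total by fastforce
qed

lemma N_separating: assumes T: "T \<in> N" and z: "T Om = 0" shows "T v = 0"
proof (rule zero_if_zero_on_L[OF N_clin[OF T]])
  fix x assume x: "x \<in> L"
  show "T (x Om) = 0"
    using N_on_L[OF T x] z linear_0[OF J_lin] linear_0[OF clin_linear[OF clin_adj[OF L_clin[OF x]]]] by simp
qed

lemma N_eqI: assumes "S \<in> N" "T \<in> N" "S Om = T Om" shows "S = T"
  using N_separating[OF N_diff[OF assms(1,2)]] assms(3) by auto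

lemma J_N_J_Om: assumes "X \<in> N" "Y \<in> N" shows "J (Y (J (X Om))) = X (adj Y Om)"
proof -
  have "J (Y (J (X Om))) = J (Y (adj X Om))" using assms by (simp add: N_adj_Om)
  also have "\<dots> = adj (\<lambda>v. Y (adj X v)) Om"
    using assms by (simp add: N_adj_Om N_comp N_adj)
  also have "\<dots> = X (adj Y Om)"
    using assms by (simp add: adj_comp N_clin clinD clin_adj adj_adj)
  finally show ?thesis .
qed

text \<open>Both sides send \<open>x Om\<close> with \<open>x \<in> L\<close> to \<open>X (x (Y\<^sup>* Om))\<close>.\<close>

lemma N_comm_J_N_J: assumes X: "X \<in> N" and Y: "Y \<in> N" shows "X (J (Y (J v))) = J (Y (J (X v)))"
proof -
  have "X (J (Y (J v))) - J (Y (J (X v))) = 0"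
  proof (rule zero_if_zero_on_L[where C = "\<lambda>v. X (J (Y (J v))) - J (Y (J (X v)))"])
    show "clin (\<lambda>v. X (J (Y (J v))) - J (Y (J (X v))))"
      using N_clin[OF X] clin_JJ[OF N_clin[OF Y]] by (intro clin_diff) (auto intro: clin_comp)
    fix x assume "x \<in> L"
    then have x: "x \<in> N" using L_subset_N by blast
    show "X (J (Y (J (x Om)))) - J (Y (J (X (x Om)))) = 0"
      using J_N_J_Om[OF x Y] J_N_J_Om[OF N_comp[OF X x] Y] by simp
  qed
  then show ?thesis by simp
qed

lemma cip_J: "cip x (J y) = cip y (J x)"
proof -
  have "x \<bullet> im (J y) = y \<bullet> im (J x)"
  proof -
    have "x \<bullet> im (J y) = - (x \<bullet> J (im y))" by (simp add: J_im)
    also have "\<dots> = - (J x \<bullet> im y)" by (simp add: J_left)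
    also have "\<dots> = im (J x) \<bullet> y" by (simp add: inner_im_left)
    finally show ?thesis by (simp add: inner_commute)
  qed
  then show ?thesis by (simp add: cip_def J_left[symmetric] inner_commute[of "J x"] inner_commute[of y])
qed

lemma trace_comm: assumes "S \<in> N" "T \<in> N" shows "cip (S (T Om)) Om = cip (T (S Om)) Om"
proof -
  have "cip (S (T Om)) Om = cip (T Om) (J (S Om))"
    using assms by (simp add: cip_adj N_clin N_adj_Om)
  also have "\<dots> = cip (S Om) (J (T Om))" by (rule cip_J)
  also have "\<dots> = cip (T (S Om)) Om"
    using assms by (simp add: cip_adj N_clin N_adj_Om)
  finally show ?thesis .
qed

lemma norm_adj_Om: "T \<in> N \<Longrightarrow> norm (adj T Om) = norm (T Om)"
  by (simp add: N_adj_Om)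

text \<open>The trace gives \<open>|X w Om| = |w\<^sup>* X\<^sup>* Om| \<le> |w| |X Om|\<close>: right multiplication is bounded by the operator
  norm in the 2-norm.\<close>

lemma norm2_mult_right:
  assumes X: "X \<in> N" and w: "w \<in> N" and K: "\<And>v. norm (w v) \<le> K * norm v"
  shows "norm (X (w Om)) \<le> K * norm (X Om)"
proof -
  have "norm (X (w Om)) = norm (adj (\<lambda>v. X (w v)) Om)"
    using norm_adj_Om[OF N_comp[OF X w]] by simp
  also have "\<dots> = norm (adj w (adj X Om))" using X w by (simp add: adj_comp N_clin clinD)
  also have "\<dots> \<le> K * norm (adj X Om)" by (rule adj_bound[OF clinD(1)[OF N_clin[OF w]] K])
  finally show ?thesis using norm_adj_Om[OF X] by simp
qed

end

section \<open>Transport to algebras of operators on a prescribed universe\<close>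

text \<open>The operator algebras are built on the types \<open>'h\<close> of class \<^class>\<open>chilbert\<close>; an injection \<open>j\<close> of \<open>'h\<close> into the
  universe \<open>'v\<close> carries them over.\<close>

definition dec :: "('h \<Rightarrow> 'v) \<Rightarrow> 'v \<Rightarrow> 'h" where "dec j = inv_into UNIV j"

lemma dec_code [simp]: "inj j \<Longrightarrow> dec j (j x) = x"
  by (simp add: dec_def)

definition hilb_of :: "('h::chilbert \<Rightarrow> 'v) \<Rightarrow> 'v ip_space" where
  "hilb_of j = \<lparr>carrier = range j, monoid.mult = (\<lambda>x y. x), one = j 0, zero = j 0,
     add = (\<lambda>x y. j (dec j x + dec j y)), module.smult = (\<lambda>c x. j (scaleC c (dec j x))),
     ip = (\<lambda>x y. cip (dec j x) (dec j y))\<rparr>"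

definition op_of :: "('h \<Rightarrow> 'v) \<Rightarrow> ('h \<Rightarrow> 'h) \<Rightarrow> 'v \<Rightarrow> 'v" where
  "op_of j T = (\<lambda>x\<in>range j. j (T (dec j x)))"

lemma hilb_of_simps [simp]:
  "carrier (hilb_of j) = range j" "zero (hilb_of j) = j 0"
  "add (hilb_of j) x y = j (dec j x + dec j y)"
  "module.smult (hilb_of j) c x = j (scaleC c (dec j x))"
  "ip (hilb_of j) x y = cip (dec j x) (dec j y)"
  by (simp_all add: hilb_of_def)

lemma op_of_apply [simp]: "inj j \<Longrightarrow> op_of j T (j x) = j (T x)"
  by (simp add: op_of_def)

lemma op_of_eq_iff: "inj j \<Longrightarrow> op_of j S = op_of j T \<longleftrightarrow> S = T"
proof
  assume j: "inj j" and e: "op_of j S = op_of j T"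
  have "j (S x) = j (T x)" for x using fun_cong[OF e, of "j x"] j by simp
  then show "S = T" using j by (auto dest: injD)
qed simp

lemma vnorm_hilb_of [simp]: "inj j \<Longrightarrow> vnorm (hilb_of j) (j x) = norm x"
  by (simp add: vnorm_def cip_self norm_eq_sqrt_inner)

lemma cring_complex: "cring complex_ring"
proof (rule cringI)
  show "abelian_group complex_ring"
    by (rule abelian_groupI) (auto simp: complex_ring_def intro: exI[of _ "- x" for x] add.left_inverse)
  show "Group.comm_monoid complex_ring"
    by (rule Group.comm_monoidI) (auto simp: complex_ring_def)
qed (auto simp: complex_ring_def algebra_simps)

lemma abelian_group_hilb_of: "inj j \<Longrightarrow> abelian_group (hilb_of j)"
proof (rule abelian_groupI)
  assume j: "inj j"
  fix x assume "x \<in> carrier (hilb_of j)"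
  then obtain a where a: "x = j a" by auto
  show "\<exists>y\<in>carrier (hilb_of j). y \<oplus>\<^bsub>hilb_of j\<^esub> x = \<zero>\<^bsub>hilb_of j\<^esub>"
    by (rule bexI[of _ "j (- a)"]) (use a j in auto)
qed (auto simp: algebra_simps)

lemma hilb_of_minus: assumes j: "inj j" shows "j x \<ominus>\<^bsub>hilb_of j\<^esub> j y = j (x - y)"
proof -
  interpret abelian_group "hilb_of j" by (rule abelian_group_hilb_of[OF j])
  have "\<ominus>\<^bsub>hilb_of j\<^esub> j y = j (- y)"
    by (rule minus_equality) (use j in auto)
  then show ?thesis using j by (simp add: a_minus_def)
qed

lemma hilbert_space_hilb_of:
  fixes j :: "'h::chilbert \<Rightarrow> 'v"
  assumes j: "inj j" shows "hilbert_space (hilb_of j)"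
proof -
  have m: "Module.module complex_ring (hilb_of j)"
  proof (rule Module.moduleI[OF cring_complex abelian_group_hilb_of[OF j]])
  qed (use j in \<open>auto simp: complex_ring_def scaleC_add_left scaleC_add_right scaleC_scaleC\<close>)
  show ?thesis
  proof (intro hilbert_space.intro m hilbert_space_axioms.intro)
    fix s :: "nat \<Rightarrow> 'v"
    assume r: "range s \<subseteq> carrier (hilb_of j)"
      and c: "\<forall>e>0. \<exists>n. \<forall>p\<ge>n. \<forall>q\<ge>n. vnorm (hilb_of j) (s p \<ominus>\<^bsub>hilb_of j\<^esub> s q) < e"
    have s: "s n = j (dec j (s n))" for n
    proof -
      have "s n \<in> range j" using r by auto
      then show ?thesis unfolding dec_def by (simp only: f_inv_into_f)
    qed
    define X where "X n = dec j (s n)" for n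
    have sX: "s n = j (X n)" for n using s by (simp add: X_def)
    have "Cauchy X"
      using c by (intro CauchyI) (simp add: sX hilb_of_minus[OF j] j)
    then obtain l where "X \<longlonglongrightarrow> l" using Cauchy_convergent convergent_def by blast
    then have "(\<lambda>n. norm (X n - l)) \<longlonglongrightarrow> 0"
      by (simp add: tendsto_norm_zero_iff LIM_zero_iff)
    then show "\<exists>l\<in>carrier (hilb_of j). (\<lambda>n. vnorm (hilb_of j) (s n \<ominus>\<^bsub>hilb_of j\<^esub> l)) \<longlonglongrightarrow> 0"
      by (intro bexI[of _ "j l"]) (simp_all add: sX hilb_of_minus[OF j] j)
  next
    fix x assume "x \<in> carrier (hilb_of j)"
    then show "ip (hilb_of j) x x \<in> \<real>\<^sub>\<ge>\<^sub>0" by (simp add: cip_self nonneg_Reals_of_real_iff)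
  next
    fix x assume "x \<in> carrier (hilb_of j)" "ip (hilb_of j) x x = 0"
    then show "x = \<zero>\<^bsub>hilb_of j\<^esub>" using j by (auto simp: cip_self)
  qed (use j in \<open>auto simp: cip_add_left cip_scaleC_left intro: cip_cnj\<close>)
qed

lemma bounded_ops_hilb_of:
  fixes j :: "'h::chilbert \<Rightarrow> 'v"
  assumes j: "inj j" shows "bounded_ops (hilb_of j) = op_of j ` {T. clin T}"
proof (intro equalityI subsetI)
  fix B assume B: "B \<in> bounded_ops (hilb_of j)"
  define T where "T x = dec j (B (j x))" for x
  have BE: "B \<in> range j \<rightarrow>\<^sub>E range j" using B by (simp add: bounded_ops_def)
  have BT: "B (j x) = j (T x)" for x
    using BE unfolding T_def dec_def by (metis PiE_mem f_inv_into_f rangeI)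
  have add: "T (x + y) = T x + T y" for x y
  proof -
    have "B (j x \<oplus>\<^bsub>hilb_of j\<^esub> j y) = B (j x) \<oplus>\<^bsub>hilb_of j\<^esub> B (j y)" using B by (auto simp: bounded_ops_def)
    then show ?thesis using j by (simp add: BT inj_eq)
  qed
  have sc: "T (scaleC c x) = scaleC c (T x)" for c x
  proof -
    have "B (j (scaleC c (dec j (j x)))) = j (scaleC c (dec j (B (j x))))" using B by (auto simp: bounded_ops_def)
    then show ?thesis using j by (simp add: BT inj_eq)
  qed
  obtain C where "\<forall>x\<in>range j. vnorm (hilb_of j) (B x) \<le> C * vnorm (hilb_of j) x"
    using B by (auto simp: bounded_ops_def)
  then have C: "norm (T x) \<le> C * norm x" for x using j by (auto simp: BT)
  have "clin T" unfolding clin_def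
  proof
    show "bounded_linear T"
      by (rule bounded_linear_intro[of _ C]) (use add C sc[of "of_real r" for r] in \<open>auto simp: mult.commute\<close>)
    show "\<forall>x. T (im x) = im (T x)" using sc[of \<i>] by simp
  qed
  moreover have "B = op_of j T"
  proof
    fix x show "B x = op_of j T x"
    proof (cases "x \<in> range j")
      case True
      then obtain y where "x = j y" by blast
      then show ?thesis by (simp add: BT j)
    next
      case False
      then show ?thesis using PiE_arb[OF BE False] by (simp add: op_of_def)
    qed
  qed
  ultimately show "B \<in> op_of j ` {T. clin T}" by blast
next
  fix B assume "B \<in> op_of j ` {T. clin T}"
  then obtain T where T: "clin T" and B: "B = op_of j T" by blast
  obtain K where "\<And>x. norm (T x) \<le> norm x * K" using bounded_linear.bounded[OF clinD(1)[OF T]] by blast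
  then have "\<forall>x\<in>carrier (hilb_of j). vnorm (hilb_of j) (B x) \<le> K * vnorm (hilb_of j) x"
    using j by (auto simp: B mult.commute)
  then show "B \<in> bounded_ops (hilb_of j)"
    using T j unfolding bounded_ops_def
    by (auto simp: B clin_linear linear_add clin_scaleC) (auto simp: op_of_def)
qed

lemma op_of_bounded: "inj j \<Longrightarrow> clin T \<Longrightarrow> op_of j T \<in> bounded_ops (hilb_of j)"
  by (simp add: bounded_ops_hilb_of)

lemma compose_op_of: "inj j \<Longrightarrow> compose (range j) (op_of j S) (op_of j T) = op_of j (\<lambda>x. S (T x))"
  by (auto simp: compose_def op_of_def fun_eq_iff)

lemma cip_inject: "(\<And>x. cip x a = cip x b) \<Longrightarrow> a = b"
  by (rule inner_ext) (simp flip: Re_cip)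

lemma adjoint_op_of:
  fixes j :: "'h::chilbert \<Rightarrow> 'v"
  assumes j: "inj j" and T: "clin T" shows "Defs.adjoint (hilb_of j) (op_of j T) = op_of j (adj T)"
  unfolding Defs.adjoint_def
proof (rule the_equality)
  show "op_of j (adj T) \<in> bounded_ops (hilb_of j) \<and>
     (\<forall>x\<in>carrier (hilb_of j). \<forall>y\<in>carrier (hilb_of j). ip (hilb_of j) (op_of j T x) y = ip (hilb_of j) x (op_of j (adj T) y))"
    using j T by (auto simp: op_of_bounded clin_adj cip_adj)
next
  fix B assume B: "B \<in> bounded_ops (hilb_of j) \<and>
     (\<forall>x\<in>carrier (hilb_of j). \<forall>y\<in>carrier (hilb_of j). ip (hilb_of j) (op_of j T x) y = ip (hilb_of j) x (B y))"
  then obtain S where S: "clin S" "B = op_of j S" using bounded_ops_hilb_of[OF j] by auto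
  have "cip (T x) y = cip x (S y)" for x y using B j S by auto
  then have "cip x (adj T y) = cip x (S y)" for x y using T by (simp add: cip_adj)
  then have "adj T y = S y" for y by (rule cip_inject)
  then have "adj T = S" by (rule ext)
  then show "B = op_of j (adj T)" using S by simp
qed

lemma op_norm_op_of_le:
  fixes j :: "'h::chilbert \<Rightarrow> 'v"
  assumes j: "inj j" and K: "\<And>x. norm (T x) \<le> K * norm x" "K \<ge> 0"
  shows "op_norm (hilb_of j) (op_of j T) \<le> K"
  unfolding op_norm_def
proof (rule cSup_least)
  have "vnorm (hilb_of j) (op_of j T (j 0)) \<in> {vnorm (hilb_of j) (op_of j T x) |x. x \<in> carrier (hilb_of j) \<and> vnorm (hilb_of j) x \<le> 1}"
    using j by (intro CollectI exI[of _ "j 0"]) (auto)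
  then show "{vnorm (hilb_of j) (op_of j T x) |x. x \<in> carrier (hilb_of j) \<and> vnorm (hilb_of j) x \<le> 1} \<noteq> {}" by blast
  fix r assume "r \<in> {vnorm (hilb_of j) (op_of j T x) |x. x \<in> carrier (hilb_of j) \<and> vnorm (hilb_of j) x \<le> 1}"
  then obtain x where "r = norm (T x)" "norm x \<le> 1" using j by auto
  then show "r \<le> K" using K(1)[of x] mult_left_mono[OF _ K(2), of "norm x" 1] by simp
qed

lemma op_norm_op_of_ge:
  fixes j :: "'h::chilbert \<Rightarrow> 'v"
  assumes j: "inj j" and T: "clin T" and le: "op_norm (hilb_of j) (op_of j T) \<le> K"
  shows "norm (T x) \<le> K * norm x"
proof (cases "x = 0")
  case True then show ?thesis using clin_linear[OF T] by (simp add: linear_0)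
next
  case False
  define y where "y = (1 / norm x) *\<^sub>R x"
  have ny: "norm y = 1" using False by (simp add: y_def)
  obtain C where C: "\<And>x. norm (T x) \<le> norm x * C" "C \<ge> 0"
    using bounded_linear.nonneg_bounded[OF clinD(1)[OF T]] by blast
  have "vnorm (hilb_of j) (op_of j T (j y)) \<le> op_norm (hilb_of j) (op_of j T)"
    unfolding op_norm_def
  proof (rule cSup_upper)
    show "vnorm (hilb_of j) (op_of j T (j y)) \<in> {vnorm (hilb_of j) (op_of j T x) |x. x \<in> carrier (hilb_of j) \<and> vnorm (hilb_of j) x \<le> 1}"
      using j ny by (intro CollectI exI[of _ "j y"]) auto
    show "bdd_above {vnorm (hilb_of j) (op_of j T x) |x. x \<in> carrier (hilb_of j) \<and> vnorm (hilb_of j) x \<le> 1}"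
    proof (rule bdd_aboveI[of _ C])
      fix r assume "r \<in> {vnorm (hilb_of j) (op_of j T x) |x. x \<in> carrier (hilb_of j) \<and> vnorm (hilb_of j) x \<le> 1}"
      then obtain x where "r = norm (T x)" "norm x \<le> 1" using j by auto
      then show "r \<le> C" using C(1)[of x] mult_right_mono[OF _ C(2), of "norm x" 1] by simp
    qed
  qed
  then have "norm (T y) \<le> K" using le j by simp
  then show ?thesis using False clin_linear[OF T] by (simp add: y_def linear_scale field_simps)
qed

lemma commutant_op_of:
  fixes j :: "'h::chilbert \<Rightarrow> 'v"
  assumes j: "inj j"
  shows "commutant (hilb_of j) (op_of j ` A) = op_of j ` ocomm A"
proof -
  have "commutant (hilb_of j) (op_of j ` A) = op_of j ` {T. clin T \<and> (\<forall>S\<in>A. (\<lambda>x. S (T x)) = (\<lambda>x. T (S x)))}"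
    using j unfolding commutant_def bounded_ops_hilb_of[OF j]
    by (auto simp: compose_op_of op_of_eq_iff)
  then show ?thesis by (simp add: ocomm_def fun_eq_iff)
qed

lemma op_le_op_of:
  fixes j :: "'h::chilbert \<Rightarrow> 'v"
  assumes j: "inj j" and "\<And>x y. S x \<bullet> y = x \<bullet> S y" "\<And>x y. T x \<bullet> y = x \<bullet> T y" "clin S" "clin T"
  shows "op_le (hilb_of j) (op_of j S) (op_of j T) \<longleftrightarrow> op_below S T"
proof -
  have real: "cip (A x) x = of_real (A x \<bullet> x)" if "\<And>x y. A x \<bullet> y = x \<bullet> A y" "clin A" for A :: "'h \<Rightarrow> 'h" and x
  proof -
    have "A x \<bullet> im x = x \<bullet> im (A x)" using that by (simp add: clinD)
    also have "\<dots> = - (A x \<bullet> im x)" using inner_im_left[of x "A x"] by (simp add: inner_commute)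
    finally show ?thesis by (simp add: cip_def complex_eq_iff)
  qed
  show ?thesis unfolding op_le_def op_below_def using assms
    by (auto simp: real complex_nonneg_Reals_iff)
qed

definition talg :: "('h::chilbert \<Rightarrow> 'v) \<Rightarrow> ('h \<Rightarrow> 'h) set \<Rightarrow> 'h \<Rightarrow> 'v traced_algebra" where
  "talg j A Om = \<lparr>hilb = hilb_of j, elems = op_of j ` A,
     tr = (\<lambda>X\<in>op_of j ` A. cip (dec j (X (j Om))) Om)\<rparr>"

lemma talg_simps [simp]:
  "hilb (talg j A Om) = hilb_of j" "elems (talg j A Om) = op_of j ` A"
  "carrier (algebra_of (talg j A Om)) = op_of j ` A"
  by (simp_all add: talg_def algebra_of_def)

lemma tr_talg [simp]: "inj j \<Longrightarrow> T \<in> A \<Longrightarrow> tr (talg j A Om) (op_of j T) = cip (T Om) Om"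
  by (simp add: talg_def)

lemma algebra_of_talg [simp]:
  fixes j :: "'h::chilbert \<Rightarrow> 'v"
  assumes j: "inj j"
  shows "op_of j S \<otimes>\<^bsub>algebra_of (talg j A Om)\<^esub> op_of j T = op_of j (\<lambda>x. S (T x))"
    "op_of j S \<oplus>\<^bsub>algebra_of (talg j A Om)\<^esub> op_of j T = op_of j (\<lambda>x. S x + T x)"
    "c \<odot>\<^bsub>algebra_of (talg j A Om)\<^esub> op_of j T = op_of j (\<lambda>x. scaleC c (T x))"
    "\<one>\<^bsub>algebra_of (talg j A Om)\<^esub> = op_of j (\<lambda>x. x)"
    "\<zero>\<^bsub>algebra_of (talg j A Om)\<^esub> = op_of j (\<lambda>x. 0)"
    "clin T \<Longrightarrow> star (algebra_of (talg j A Om)) (op_of j T) = op_of j (adj T)"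
  using j by (auto simp: algebra_of_def op_algebra_def compose_op_of adjoint_op_of)
    (auto simp: op_of_def fun_eq_iff restrict_def)

definition findim :: "('h::chilbert \<Rightarrow> 'h) set \<Rightarrow> bool" where
  "findim S \<longleftrightarrow> (\<exists>F. finite F \<and> F \<subseteq> S \<and> (\<forall>x\<in>S. \<exists>c. x = (\<lambda>v. \<Sum>f\<in>F. scaleC (c f) (f v))))"

text \<open>Evaluation at a vector turns complex linear combinations into real ones of twice as many vectors.\<close>

lemma findim_span:
  assumes "findim S" shows "\<exists>G. finite G \<and> (\<lambda>T. T v) ` S \<subseteq> span G"
proof -
  obtain F where F: "finite F" and c: "\<forall>x\<in>S. \<exists>c. x = (\<lambda>v. \<Sum>f\<in>F. scaleC (c f) (f v))"
    using assms unfolding findim_def by blast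
  define G where "G = (\<lambda>f. f v) ` F \<union> (\<lambda>f. im (f v)) ` F"
  have "T v \<in> span G" if T: "T \<in> S" for T
  proof -
    obtain c where "T = (\<lambda>v. \<Sum>f\<in>F. scaleC (c f) (f v))" using bspec[OF c T] by (elim exE)
    then have "T v = (\<Sum>f\<in>F. scaleC (c f) (f v))" by simp
    moreover have "scaleC (c f) (f v) \<in> span G" if "f \<in> F" for f
      unfolding scaleC_def using that by (intro span_add span_scale span_base) (auto simp: G_def)
    ultimately show ?thesis using span_sum[of F "\<lambda>f. scaleC (c f) (f v)" G] by simp
  qed
  moreover have "finite G" using F by (simp add: G_def)
  ultimately show ?thesis by blast
qed

definition star_subalg :: "('h::chilbert \<Rightarrow> 'h) set \<Rightarrow> bool" where
  "star_subalg B \<longleftrightarrow> (\<lambda>v. 0) \<in> B \<and> (\<lambda>v. v) \<in> B \<and> (\<forall>x\<in>B. \<forall>y\<in>B. (\<lambda>v. x v + y v) \<in> B \<and> (\<lambda>v. x (y v)) \<in> B) \<and>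
     (\<forall>c. \<forall>x\<in>B. (\<lambda>v. scaleC c (x v)) \<in> B) \<and> (\<forall>x\<in>B. adj x \<in> B)"

lemma symmetric_iff_adj: "clin T \<Longrightarrow> adj T = T \<longleftrightarrow> (\<forall>x y. T x \<bullet> y = x \<bullet> T y)"
  by (metis adj_inner adj_unique clinD(1))

context tracial_rep
begin

context
  fixes j :: "'h \<Rightarrow> 'v"
  assumes j: "inj j"
begin

abbreviation M where "M \<equiv> talg j N Om"

lemma abelian_group_algebra: "abelian_group (algebra_of M)"
proof (rule abelian_groupI)
  fix x assume "x \<in> carrier (algebra_of M)"
  then obtain T where T: "T \<in> N" "x = op_of j T" by auto
  show "\<exists>y\<in>carrier (algebra_of M). y \<oplus>\<^bsub>algebra_of M\<^esub> x = \<zero>\<^bsub>algebra_of M\<^esub>"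
    by (rule bexI[of _ "op_of j (\<lambda>v. scaleC (- 1) (T v))"])
      (use T j N_scaleC[OF T(1), of "- 1"] in \<open>auto simp: scaleC_minus_left\<close>)
qed (use j N_add N_zero in \<open>auto simp: add.assoc add.commute add.left_commute\<close>)

lemma algebra_minus:
  assumes "S \<in> N" "T \<in> N"
  shows "op_of j S \<ominus>\<^bsub>algebra_of M\<^esub> op_of j T = op_of j (\<lambda>v. S v - T v)"
proof -
  interpret abelian_group "algebra_of M" by (rule abelian_group_algebra)
  have "\<ominus>\<^bsub>algebra_of M\<^esub> op_of j T = op_of j (\<lambda>v. scaleC (- 1) (T v))"
    by (rule minus_equality) (use assms N_scaleC[OF assms(2), of "- 1"] j in \<open>auto simp: scaleC_minus_left\<close>)
  then show ?thesis using j by (simp add: a_minus_def scaleC_minus_left)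
qed

lemma norm2_op_of: "T \<in> N \<Longrightarrow> norm2 M (op_of j T) = norm (T Om)"
  using j by (simp add: norm2_def N_clin N_comp N_adj norm_eq_sqrt_inner adj_inner' clinD)

lemma finsum_op_of:
  assumes "finite F" "F \<subseteq> N"
  shows "(\<Oplus>\<^bsub>algebra_of M\<^esub>X\<in>op_of j ` F. c X \<odot>\<^bsub>algebra_of M\<^esub> X) = op_of j (\<lambda>v. \<Sum>f\<in>F. scaleC (c (op_of j f)) (f v))"
  using assms
proof (induction F)
  interpret abelian_group "algebra_of M" by (rule abelian_group_algebra)
  case empty then show ?case using j by simp
next
  interpret abelian_group "algebra_of M" by (rule abelian_group_algebra)
  case (insert f F)
  have cl: "(\<lambda>X. c X \<odot>\<^bsub>algebra_of M\<^esub> X) \<in> op_of j ` F \<rightarrow> carrier (algebra_of M)"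
    using insert j N_scaleC by auto
  have nin: "op_of j f \<notin> op_of j ` F" using insert j by (auto simp: op_of_eq_iff)
  show ?case
    using insert j N_scaleC by (simp add: finsum_insert[OF _ nin cl])
qed

lemma finite_dim_op_of:
  assumes S: "S \<subseteq> N"
  shows "finite_dim (algebra_of M) (op_of j ` S) \<longleftrightarrow> findim S"
proof
  assume "finite_dim (algebra_of M) (op_of j ` S)"
  then obtain F' where F': "finite F'" "F' \<subseteq> op_of j ` S"
    and c: "\<forall>x\<in>op_of j ` S. \<exists>c. x = (\<Oplus>\<^bsub>algebra_of M\<^esub>f\<in>F'. c f \<odot>\<^bsub>algebra_of M\<^esub> f)"
    unfolding finite_dim_def by blast
  obtain F where F: "finite F" "F \<subseteq> S" "F' = op_of j ` F" using finite_subset_image[OF F'] by blast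
  have "\<exists>c. x = (\<lambda>v. \<Sum>f\<in>F. scaleC (c f) (f v))" if x: "x \<in> S" for x
  proof -
    obtain c where "op_of j x = (\<Oplus>\<^bsub>algebra_of M\<^esub>f\<in>F'. c f \<odot>\<^bsub>algebra_of M\<^esub> f)" using c x by blast
    then have "x = (\<lambda>v. \<Sum>f\<in>F. scaleC (c (op_of j f)) (f v))"
      using finsum_op_of[of F c] F S j by (simp add: op_of_eq_iff subset_trans)
    then show ?thesis by (intro exI)
  qed
  then show "findim S" unfolding findim_def using F by blast
next
  assume "findim S"
  then obtain F where F: "finite F" "F \<subseteq> S" and c: "\<forall>x\<in>S. \<exists>c. x = (\<lambda>v. \<Sum>f\<in>F. scaleC (c f) (f v))"
    unfolding findim_def by blast
  have inj: "inj_on (op_of j) F" using j by (auto simp: inj_on_def op_of_eq_iff)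
  have "\<exists>c. x = (\<Oplus>\<^bsub>algebra_of M\<^esub>f\<in>op_of j ` F. c f \<odot>\<^bsub>algebra_of M\<^esub> f)" if x: "x \<in> op_of j ` S" for x
  proof -
    obtain T where T: "x = op_of j T" "T \<in> S" using x by blast
    obtain c where c: "T = (\<lambda>v. \<Sum>f\<in>F. scaleC (c f) (f v))" using c T by blast
    have "(\<Oplus>\<^bsub>algebra_of M\<^esub>X\<in>op_of j ` F. c (inv_into F (op_of j) X) \<odot>\<^bsub>algebra_of M\<^esub> X) =
       op_of j (\<lambda>v. \<Sum>f\<in>F. scaleC (c (inv_into F (op_of j) (op_of j f))) (f v))"
      using F S by (intro finsum_op_of) auto
    also have "\<dots> = x" unfolding T(1) c
      by (intro arg_cong[of _ _ "op_of j"] ext sum.cong) (simp_all add: inv_into_f_f[OF inj])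
    finally show ?thesis by (intro exI) (rule sym)
  qed
  then show "finite_dim (algebra_of M) (op_of j ` S)" unfolding finite_dim_def using F by blast
qed

lemma von_neumann_algebra_N: "von_neumann_algebra (hilb_of j) (op_of j ` N)"
  unfolding von_neumann_algebra_def
  using j by (auto simp: hilbert_space_hilb_of op_of_bounded N_clin adjoint_op_of N_adj commutant_op_of N_double_commutant)

lemma factor_N:
  assumes centre: "\<And>T. T \<in> N \<Longrightarrow> (\<And>S v. S \<in> N \<Longrightarrow> S (T v) = T (S v)) \<Longrightarrow> \<exists>c. T = scaleC c"
  shows "factor (hilb_of j) (op_of j ` N)"
proof -
  have "op_of j ` N \<inter> op_of j ` ocomm N = {op_of j (scaleC c) |c. True}"
  proof (intro equalityI subsetI)
    fix x assume "x \<in> op_of j ` N \<inter> op_of j ` ocomm N"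
    then obtain T where "T \<in> N" "T \<in> ocomm N" "x = op_of j T" using j by (auto simp: op_of_eq_iff)
    then show "x \<in> {op_of j (scaleC c) |c. True}" using centre[of T] by (auto simp: ocomm_def)
  next
    fix x assume "x \<in> {op_of j (scaleC c) |c. True}"
    then obtain c where x: "x = op_of j (scaleC c)" by blast
    have "scaleC c \<in> N" using N_scaleC[OF N_id, of c] by simp
    moreover have "scaleC c \<in> ocomm N"
      using clin_scaleC_op[OF clin_id, of c] by (auto simp: ocomm_def N_clin clin_scaleC)
    ultimately show "x \<in> op_of j ` N \<inter> op_of j ` ocomm N" using x by blast
  qed
  moreover have "c \<odot>\<^bsub>op_algebra (hilb_of j)\<^esub> \<one>\<^bsub>op_algebra (hilb_of j)\<^esub> = op_of j (scaleC c)" for c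
    using j by (auto simp: op_algebra_def op_of_def fun_eq_iff)
  ultimately show ?thesis
    unfolding factor_def using von_neumann_algebra_N commutant_op_of[OF j, of N] by simp
qed

lemma tracial_state_M: "tracial_state M"
  unfolding tracial_state_def Let_def
proof (intro conjI ballI allI)
  show "tr M \<in> extensional (carrier (algebra_of M))" by (simp add: talg_def algebra_of_def)
  show "tr M \<one>\<^bsub>algebra_of M\<^esub> = 1" using j by (simp add: N_id cip_self)
  fix x assume "x \<in> carrier (algebra_of M)"
  then obtain X where X: "X \<in> N" "x = op_of j X" by auto
  show "tr M (c \<odot>\<^bsub>algebra_of M\<^esub> x) = c * tr M x" for c
    using X j by (simp add: N_scaleC cip_scaleC_left)
  show "tr M (star (algebra_of M) x \<otimes>\<^bsub>algebra_of M\<^esub> x) \<in> \<real>\<^sub>\<ge>\<^sub>0"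
  proof -
    have "cip (adj X (X Om)) Om = cip (X Om) (X Om)"
      using cip_adj[OF clin_adj[OF N_clin[OF X(1)]], of "X Om" Om] X by (simp add: adj_adj N_clin clinD)
    then show ?thesis using X j by (simp add: N_clin N_comp N_adj cip_self nonneg_Reals_of_real_iff)
  qed
  fix y assume "y \<in> carrier (algebra_of M)"
  then obtain Y where Y: "Y \<in> N" "y = op_of j Y" by auto
  show "tr M (x \<oplus>\<^bsub>algebra_of M\<^esub> y) = tr M x + tr M y"
    using X Y j by (simp add: N_add cip_add_left)
  show "tr M (x \<otimes>\<^bsub>algebra_of M\<^esub> y) = tr M (y \<otimes>\<^bsub>algebra_of M\<^esub> x)"
    using X Y j by (simp add: N_comp trace_comm)
qed

lemma faithful_M: "faithful_trace M"
  unfolding faithful_trace_def Let_def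
proof (intro ballI impI)
  fix x assume "x \<in> carrier (algebra_of M)" and z: "tr M (star (algebra_of M) x \<otimes>\<^bsub>algebra_of M\<^esub> x) = 0"
  then obtain X where X: "X \<in> N" "x = op_of j X" by auto
  have "cip (adj X (X Om)) Om = 0" using z X j by (simp add: N_clin N_comp N_adj)
  then have "adj X (X Om) \<bullet> Om = 0" by (metis Re_cip zero_complex.sel(1))
  then have "X Om = 0" using X by (simp add: adj_inner' N_clin clinD)
  then have "X = (\<lambda>v. 0)" using N_separating[OF X(1)] by auto
  then show "x = \<zero>\<^bsub>algebra_of M\<^esub>" using X j by simp
qed

lemma normal_M: "normal_trace M"
  unfolding normal_trace_def
proof (intro allI impI)
  fix D' s'
  assume a: "D' \<subseteq> self_adjoint_elems M \<and> D' \<noteq> {} \<and>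
     (\<forall>x\<in>D'. \<forall>y\<in>D'. \<exists>z\<in>D'. op_le (hilb M) x z \<and> op_le (hilb M) y z) \<and>
     s' \<in> self_adjoint_elems M \<and> (\<forall>x\<in>D'. op_le (hilb M) x s') \<and>
     (\<forall>t\<in>self_adjoint_elems M. (\<forall>x\<in>D'. op_le (hilb M) x t) \<longrightarrow> op_le (hilb M) s' t)"
  have sa: "self_adjoint_elems M = op_of j ` {T \<in> N. adj T = T}"
    using j by (auto simp: self_adjoint_elems_def adjoint_op_of N_clin op_of_eq_iff)
  define D where "D = {T \<in> N. adj T = T \<and> op_of j T \<in> D'}"
  have D': "D' = op_of j ` D" using a sa by (auto simp: D_def)
  obtain s where s: "s \<in> N" "adj s = s" "s' = op_of j s" using a sa by auto
  have le: "op_le (hilb M) (op_of j S) (op_of j T) \<longleftrightarrow> op_below S T"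
    if "S \<in> N" "T \<in> N" "adj S = S" "adj T = T" for S T
    using that j op_le_op_of[of j S T] symmetric_iff_adj[of S] symmetric_iff_adj[of T] by (simp add: N_clin)
  have DN: "d \<in> N" "adj d = d" if "d \<in> D" for d using that by (auto simp: D_def)
  have eq: "s Om \<bullet> Om = (SUP d\<in>D. d Om \<bullet> Om)"
  proof (rule ocomm_sup[of "(\<lambda>x v. J (x (J v))) ` L"])
    show "\<And>S. S \<in> (\<lambda>x v. J (x (J v))) ` L \<Longrightarrow> clin S" by (rule R_clin)
    show "D \<subseteq> ocomm ((\<lambda>x v. J (x (J v))) ` L)" unfolding N_ocomm[symmetric] using DN by blast
    show "D \<noteq> {}" using a D' by blast
    show "d x \<bullet> y = x \<bullet> d y" if "d \<in> D" for d x y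
      using symmetric_iff_adj[of d] N_clin DN[OF that] by blast
    show "\<exists>f\<in>D. op_below d f \<and> op_below e f" if d: "d \<in> D" and e: "e \<in> D" for d e
    proof -
      have "\<exists>z\<in>D'. op_le (hilb M) (op_of j d) z \<and> op_le (hilb M) (op_of j e) z" using a d e D' by blast
      then obtain f where f: "f \<in> D" "op_le (hilb M) (op_of j d) (op_of j f)" "op_le (hilb M) (op_of j e) (op_of j f)"
        using D' by blast
      show ?thesis using f le DN d e by blast
    qed
    show "clin s" using s N_clin by blast
    show "op_below d s" if "d \<in> D" for d
    proof -
      have "op_le (hilb M) (op_of j d) (op_of j s)" using a D' that s by blast
      then show ?thesis using le DN that s by blast
    qed
    show "op_below s t" if t: "t \<in> ocomm ((\<lambda>x v. J (x (J v))) ` L)" "\<And>x y. t x \<bullet> y = x \<bullet> t y"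
      and up: "\<And>d. d \<in> D \<Longrightarrow> op_below d t" for t
    proof -
      have tN: "t \<in> N" "adj t = t" using t symmetric_iff_adj[of t] N_clin by (auto simp: N_ocomm[symmetric])
      have "op_of j t \<in> self_adjoint_elems M" using tN sa by blast
      moreover have "\<forall>x\<in>D'. op_le (hilb M) x (op_of j t)" using D' le DN tN up by blast
      ultimately have "op_le (hilb M) (op_of j s) (op_of j t)" using a s by blast
      then show ?thesis using le tN s by blast
    qed
  qed
  have "s Om \<bullet> im Om = 0"
  proof -
    have "s Om \<bullet> im Om = Om \<bullet> im (s Om)"
      using s symmetric_iff_adj[of s] by (metis N_clin clinD(2))
    also have "\<dots> = - (s Om \<bullet> im Om)" using inner_im_left[of Om "s Om"] by (simp add: inner_commute)
    finally show ?thesis by simp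
  qed
  then have "tr M s' = complex_of_real (s Om \<bullet> Om)" using s j by (simp add: cip_def complex_eq_iff)
  also have "\<dots> = complex_of_real (SUP x\<in>D'. Re (tr M x))"
    unfolding eq D' image_image using j DN by (intro arg_cong[of _ _ complex_of_real] SUP_cong) auto
  finally show "tr M s' = complex_of_real (SUP x\<in>D'. Re (tr M x))" .
qed

lemma II1_M:
  assumes "\<And>T. T \<in> N \<Longrightarrow> (\<And>S v. S \<in> N \<Longrightarrow> S (T v) = T (S v)) \<Longrightarrow> \<exists>c. T = scaleC c"
    and "\<not> findim N"
  shows "II1_factor M"
  unfolding II1_factor_def
  using factor_N[OF assms(1)] assms(2) tracial_state_M faithful_M normal_M finite_dim_op_of[of N] by simp

lemma star_subalgebra_op_of:
  assumes "B \<subseteq> N" shows "star_subalgebra (algebra_of M) (op_of j ` B) \<longleftrightarrow> star_subalg B"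
proof -
  have i: "op_of j T \<in> op_of j ` B \<longleftrightarrow> T \<in> B" for T using j by (auto simp: op_of_eq_iff)
  have "clin x" if "x \<in> B" for x using assms that N_clin by blast
  then show ?thesis
    unfolding star_subalgebra_def star_subalg_def using assms j by (auto simp: i)
qed

lemma hyperfinite_M:
  "hyperfinite M \<longleftrightarrow> (\<forall>F e. finite F \<and> F \<subseteq> N \<and> e > 0 \<longrightarrow>
     (\<exists>B\<subseteq>N. star_subalg B \<and> findim B \<and> (\<forall>x\<in>F. \<exists>y\<in>B. norm (x Om - y Om) < e)))"
proof -
  have d: "norm2 M (op_of j x \<ominus>\<^bsub>algebra_of M\<^esub> op_of j y) = norm (x Om - y Om)" if "x \<in> N" "y \<in> N" for x y
    using that by (simp add: algebra_minus norm2_op_of N_diff)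
  show ?thesis
  proof (intro iffI allI impI)
    fix F :: "('h \<Rightarrow> 'h) set" and e :: real
    assume h: "hyperfinite M" and F: "finite F \<and> F \<subseteq> N \<and> e > 0"
    have F': "finite (op_of j ` F) \<and> op_of j ` F \<subseteq> elems M \<and> e > 0" using F by auto
    obtain B' where B': "star_subalgebra (algebra_of M) B'" "finite_dim (algebra_of M) B'"
      "\<forall>x\<in>op_of j ` F. \<exists>y\<in>B'. norm2 M (x \<ominus>\<^bsub>algebra_of M\<^esub> y) < e"
      using h[unfolded hyperfinite_def, THEN spec, THEN spec, THEN mp, OF F'] by (elim exE conjE)
    have "B' \<subseteq> op_of j ` N" using B'(1) by (simp add: star_subalgebra_def)
    then obtain B where B: "B \<subseteq> N" "B' = op_of j ` B" by (auto simp: subset_image_iff)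
    show "\<exists>B\<subseteq>N. star_subalg B \<and> findim B \<and> (\<forall>x\<in>F. \<exists>y\<in>B. norm (x Om - y Om) < e)"
    proof (intro exI[of _ B] conjI ballI B)
      show "star_subalg B" using B' B star_subalgebra_op_of by blast
      show "findim B" using B' B finite_dim_op_of by blast
      fix x assume x: "x \<in> F"
      then obtain y where "y \<in> B" "norm2 M (op_of j x \<ominus>\<^bsub>algebra_of M\<^esub> op_of j y) < e" using B'(3) B by blast
      then show "\<exists>y\<in>B. norm (x Om - y Om) < e" using d x F B by (metis subsetD)
    qed
  next
    assume r: "\<forall>F e. finite F \<and> F \<subseteq> N \<and> e > 0 \<longrightarrow>
     (\<exists>B\<subseteq>N. star_subalg B \<and> findim B \<and> (\<forall>x\<in>F. \<exists>y\<in>B. norm (x Om - y Om) < e))"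
    show "hyperfinite M" unfolding hyperfinite_def
    proof (intro allI impI)
      fix F' :: "('v \<Rightarrow> 'v) set" and e :: real
      assume F': "finite F' \<and> F' \<subseteq> elems M \<and> e > 0"
      then obtain F where F: "finite F" "F \<subseteq> N" "F' = op_of j ` F" using finite_subset_image[of F' "op_of j" N] by auto
      obtain B where B: "B \<subseteq> N" "star_subalg B" "findim B" "\<forall>x\<in>F. \<exists>y\<in>B. norm (x Om - y Om) < e"
        using r[THEN spec[of _ F], THEN spec[of _ e]] F F' by auto
      show "\<exists>B'. star_subalgebra (algebra_of M) B' \<and> finite_dim (algebra_of M) B' \<and>
        (\<forall>x\<in>F'. \<exists>y\<in>B'. norm2 M (x \<ominus>\<^bsub>algebra_of M\<^esub> y) < e)"
      proof (intro exI[of _ "op_of j ` B"] conjI ballI)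
        show "star_subalgebra (algebra_of M) (op_of j ` B)" using B star_subalgebra_op_of by blast
        show "finite_dim (algebra_of M) (op_of j ` B)" using B finite_dim_op_of by blast
        fix x assume "x \<in> F'"
        then obtain T where T: "T \<in> F" "x = op_of j T" using F by blast
        then obtain y where "y \<in> B" "norm (T Om - y Om) < e" using B by blast
        then show "\<exists>y\<in>op_of j ` B. norm2 M (x \<ominus>\<^bsub>algebra_of M\<^esub> y) < e"
          using d[of T y] T F(2) subsetD[OF F(2), of T] subsetD[OF B(1), of y] by (intro bexI[of _ "op_of j y"]) auto
      qed
    qed
  qed
qed

end

end

section \<open>Square-summable functions\<close>

definition sq_summable :: "('g \<Rightarrow> complex) \<Rightarrow> bool" where
  "sq_summable f \<longleftrightarrow> (\<lambda>g. (cmod (f g))\<^sup>2) summable_on UNIV"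

lemma summable_on_bounded:
  fixes f g :: "'a \<Rightarrow> real"
  assumes "g summable_on A" "\<And>x. x \<in> A \<Longrightarrow> \<bar>f x\<bar> \<le> g x"
  shows "f summable_on A"
proof -
  have "(\<lambda>x. norm (f x)) summable_on A"
  proof (rule nonneg_bdd_above_summable_on)
    show "bdd_above (sum (\<lambda>x. norm (f x)) ` {F. F \<subseteq> A \<and> finite F})"
    proof (rule bdd_aboveI2)
      fix F assume F: "F \<in> {F. F \<subseteq> A \<and> finite F}"
      have "sum (\<lambda>x. norm (f x)) F \<le> sum g F" using F assms(2) by (intro sum_mono) auto
      also have "\<dots> \<le> infsum g A"
        by (rule finite_sum_le_infsum) (use F assms in \<open>auto intro: order_trans[OF abs_ge_zero]\<close>)
      finally show "sum (\<lambda>x. norm (f x)) F \<le> infsum g A" .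
    qed
  qed simp
  then show ?thesis by (rule abs_summable_summable)
qed

lemma sq_summable_add: assumes "sq_summable f" "sq_summable h" shows "sq_summable (\<lambda>g. f g + h g)"
  unfolding sq_summable_def
proof (rule summable_on_bounded)
  show "(\<lambda>g. 2 * (cmod (f g))\<^sup>2 + 2 * (cmod (h g))\<^sup>2) summable_on UNIV"
    using assms unfolding sq_summable_def by (intro summable_on_add summable_on_cmult_right)
  fix g
  have "(cmod (f g + h g))\<^sup>2 \<le> (cmod (f g) + cmod (h g))\<^sup>2"
    by (intro power_mono norm_triangle_ineq norm_ge_zero)
  also have "\<dots> \<le> 2 * (cmod (f g))\<^sup>2 + 2 * (cmod (h g))\<^sup>2"
    using zero_le_power2[of "cmod (f g) - cmod (h g)"] by (simp add: power2_sum power2_diff)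
  finally show "\<bar>(cmod (f g + h g))\<^sup>2\<bar> \<le> 2 * (cmod (f g))\<^sup>2 + 2 * (cmod (h g))\<^sup>2" by simp
qed

lemma sq_summable_mult: "sq_summable f \<Longrightarrow> sq_summable (\<lambda>g. c * f g)"
  unfolding sq_summable_def by (simp add: norm_mult power_mult_distrib summable_on_cmult_right)

lemma sq_summable_finite: "finite {g. f g \<noteq> 0} \<Longrightarrow> sq_summable f"
proof -
  assume "finite {g. f g \<noteq> 0}"
  then have "(\<lambda>g. (cmod (f g))\<^sup>2) summable_on {g. f g \<noteq> 0}" by (rule summable_on_finite)
  then show ?thesis unfolding sq_summable_def
    by (rule summable_on_cong_neutral[THEN iffD1, rotated 3]) auto
qed

lemma sq_summable_inner:
  assumes "sq_summable f" "sq_summable h" shows "(\<lambda>g. f g \<bullet> h g) summable_on UNIV"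
proof (rule summable_on_bounded)
  show "(\<lambda>g. (cmod (f g))\<^sup>2 + (cmod (h g))\<^sup>2) summable_on UNIV"
    using assms unfolding sq_summable_def by (intro summable_on_add)
  fix g
  have "\<bar>f g \<bullet> h g\<bar> \<le> cmod (f g) * cmod (h g)" by (rule Cauchy_Schwarz_ineq2)
  also have "\<dots> \<le> (cmod (f g))\<^sup>2 + (cmod (h g))\<^sup>2"
    using zero_le_power2[of "cmod (f g) - cmod (h g)"] zero_le_power2[of "cmod (f g)"] zero_le_power2[of "cmod (h g)"]
    unfolding power2_diff by linarith
  finally show "\<bar>f g \<bullet> h g\<bar> \<le> (cmod (f g))\<^sup>2 + (cmod (h g))\<^sup>2" .
qed

typedef 'g l2 = "{f :: 'g \<Rightarrow> complex. sq_summable f}" morphisms coef Abs_l2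
  by (rule exI[of _ "\<lambda>_. 0"]) (simp add: sq_summable_def)

setup_lifting type_definition_l2

lemma coef_sq_summable [simp]: "sq_summable (coef x)"
  using coef[of x] by simp

lemma l2_eqI: "(\<And>g. coef x g = coef y g) \<Longrightarrow> x = y"
  by (simp add: coef_inject[symmetric] fun_eq_iff)

instantiation l2 :: (type) real_vector
begin
lift_definition zero_l2 :: "'a l2" is "\<lambda>_. 0" by (simp add: sq_summable_def)
lift_definition plus_l2 :: "'a l2 \<Rightarrow> 'a l2 \<Rightarrow> 'a l2" is "\<lambda>f h g. f g + h g" by (rule sq_summable_add)
lift_definition uminus_l2 :: "'a l2 \<Rightarrow> 'a l2" is "\<lambda>f g. - f g"
  using sq_summable_mult[of _ "- 1"] by simp
lift_definition minus_l2 :: "'a l2 \<Rightarrow> 'a l2 \<Rightarrow> 'a l2" is "\<lambda>f h g. f g - h g"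
proof -
  fix f h :: "'a \<Rightarrow> complex" assume "sq_summable f" "sq_summable h"
  then show "sq_summable (\<lambda>g. f g - h g)"
    using sq_summable_add[of f "\<lambda>g. - 1 * h g"] sq_summable_mult[of h "- 1"] by simp
qed
lift_definition scaleR_l2 :: "real \<Rightarrow> 'a l2 \<Rightarrow> 'a l2" is "\<lambda>r f g. r *\<^sub>R f g"
  using sq_summable_mult[of _ "of_real r" for r] by (simp add: scaleR_conv_of_real)
instance by standard (transfer; simp add: algebra_simps scaleR_conv_of_real)+
end

instantiation l2 :: (type) real_inner
begin
definition inner_l2 :: "'a l2 \<Rightarrow> 'a l2 \<Rightarrow> real" where "inner x y = (\<Sum>\<^sub>\<infinity>g. coef x g \<bullet> coef y g)"
definition norm_l2_def: "norm (x :: 'a l2) = sqrt (inner x x)"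
definition dist_l2_def: "dist (x :: 'a l2) y = norm (x - y)"
definition sgn_l2_def: "sgn (x :: 'a l2) = inverse (norm x) *\<^sub>R x"
definition uniformity_l2_def: "uniformity = (INF e\<in>{0 <..}. principal {(x::'a l2, y). dist x y < e})"
definition open_l2_def: "open (U :: 'a l2 set) = (\<forall>x\<in>U. eventually (\<lambda>(x', y). x' = x \<longrightarrow> y \<in> U) uniformity)"
instance
proof
  fix x y z :: "'a l2" and r :: real
  show "inner x y = inner y x" by (simp add: inner_l2_def inner_commute)
  show "inner (x + y) z = inner x z + inner y z"
    by (simp add: inner_l2_def plus_l2.rep_eq inner_add_left infsum_add sq_summable_inner)
  show "inner (r *\<^sub>R x) y = r * inner x y"
    by (simp add: inner_l2_def scaleR_l2.rep_eq infsum_cmult_right sq_summable_inner)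
  show "0 \<le> inner x x" by (simp add: inner_l2_def infsum_nonneg)
  show "inner x x = 0 \<longleftrightarrow> x = 0"
  proof
    assume "inner x x = 0"
    then have "coef x g \<bullet> coef x g = 0" for g
      unfolding inner_l2_def by (intro nonneg_infsum_le_0D[of "\<lambda>g. coef x g \<bullet> coef x g" UNIV])
        (auto simp: sq_summable_inner)
    then show "x = 0" by (intro l2_eqI) (simp add: zero_l2.rep_eq)
  qed (simp add: inner_l2_def zero_l2.rep_eq)
qed (rule norm_l2_def dist_l2_def sgn_l2_def uniformity_l2_def open_l2_def)+
end

lemma inner_l2_finite:
  assumes "\<And>g. g \<notin> F \<Longrightarrow> coef x g = 0 \<or> coef y g = 0" "finite F"
  shows "x \<bullet> y = (\<Sum>g\<in>F. coef x g \<bullet> coef y g)"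
proof -
  have "x \<bullet> y = (\<Sum>\<^sub>\<infinity>g\<in>F. coef x g \<bullet> coef y g)"
    unfolding inner_l2_def by (rule infsum_cong_neutral) (use assms in force)+
  then show ?thesis using assms by simp
qed

lemma sum_coef_le_norm: "finite F \<Longrightarrow> (\<Sum>g\<in>F. (cmod (coef x g))\<^sup>2) \<le> (norm x)\<^sup>2"
  unfolding power2_norm_eq_inner inner_l2_def
  by (rule finite_sum_le_infsum) (auto simp: sq_summable_inner)

lemma cmod_coef_le: "cmod (coef x g) \<le> norm x"
  by (rule power2_le_imp_le) (use sum_coef_le_norm[of "{g}" x] in simp_all)

lemma sum_bound_norm_l2:
  assumes f: "\<And>F. finite F \<Longrightarrow> (\<Sum>g\<in>F. (cmod (f g))\<^sup>2) \<le> e\<^sup>2" and e: "e \<ge> 0"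
  shows "sq_summable f" "norm (Abs_l2 f) \<le> e"
proof -
  show s: "sq_summable f" unfolding sq_summable_def
    by (rule nonneg_bdd_above_summable_on) (use f in \<open>auto intro!: bdd_aboveI[of _ "e\<^sup>2"]\<close>)
  have "(norm (Abs_l2 f))\<^sup>2 \<le> e\<^sup>2"
    unfolding power2_norm_eq_inner inner_l2_def
    by (rule infsum_le_finite_sums) (use s f in \<open>auto simp: Abs_l2_inverse sq_summable_inner power2_norm_eq_inner\<close>)
  then show "norm (Abs_l2 f) \<le> e" using e by (rule power2_le_imp_le)
qed

instance l2 :: (type) complete_space
proof
  fix X :: "nat \<Rightarrow> 'a l2" assume X: "Cauchy X"
  have "Cauchy (\<lambda>n. coef (X n) g)" for g
  proof (rule CauchyI)
    fix e :: real assume "e > 0"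
    then obtain M where M: "\<forall>m\<ge>M. \<forall>n\<ge>M. norm (X m - X n) < e" using CauchyD[OF X] by blast
    have "norm (coef (X m) g - coef (X n) g) < e" if "m \<ge> M" "n \<ge> M" for m n
    proof -
      have "norm (coef (X m - X n) g) \<le> norm (X m - X n)" by (rule cmod_coef_le)
      then show ?thesis using M that by (auto simp: minus_l2.rep_eq intro: le_less_trans)
    qed
    then show "\<exists>M. \<forall>m\<ge>M. \<forall>n\<ge>M. norm (coef (X m) g - coef (X n) g) < e" by blast
  qed
  then have "\<exists>l. (\<lambda>n. coef (X n) g) \<longlonglongrightarrow> l" for g using Cauchy_convergent convergent_def by blast
  then have "\<exists>f. \<forall>g. (\<lambda>n. coef (X n) g) \<longlonglongrightarrow> f g" by (intro choice allI)
  then obtain f where f: "\<And>g. (\<lambda>n. coef (X n) g) \<longlonglongrightarrow> f g" by (elim exE) (rule that, blast)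
  have near: "sq_summable (\<lambda>g. coef (X n) g - f g) \<and> norm (Abs_l2 (\<lambda>g. coef (X n) g - f g)) \<le> e"
    if n: "n \<ge> M" and M: "\<forall>m\<ge>M. \<forall>n\<ge>M. norm (X m - X n) < e" for M n e
  proof -
    have e: "e \<ge> 0" using M[rule_format, of M M] by simp
    have "(\<Sum>g\<in>F. (cmod (coef (X n) g - f g))\<^sup>2) \<le> e\<^sup>2" if "finite F" for F
    proof (rule tendsto_upperbound)
      show "(\<lambda>m. \<Sum>g\<in>F. (cmod (coef (X n) g - coef (X m) g))\<^sup>2) \<longlonglongrightarrow> (\<Sum>g\<in>F. (cmod (coef (X n) g - f g))\<^sup>2)"
        by (intro tendsto_intros f)
      have "(\<Sum>g\<in>F. (cmod (coef (X n) g - coef (X m) g))\<^sup>2) \<le> e\<^sup>2" if m: "m \<ge> M" for m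
      proof -
        have "(\<Sum>g\<in>F. (cmod (coef (X n) g - coef (X m) g))\<^sup>2) \<le> (norm (X n - X m))\<^sup>2"
          using sum_coef_le_norm[OF \<open>finite F\<close>, of "X n - X m"] by (simp add: minus_l2.rep_eq)
        also have "\<dots> \<le> e\<^sup>2" using M n m by (intro power_mono) (auto intro: less_imp_le)
        finally show ?thesis .
      qed
      then show "\<forall>\<^sub>F m in sequentially. (\<Sum>g\<in>F. (cmod (coef (X n) g - coef (X m) g))\<^sup>2) \<le> e\<^sup>2"
        unfolding eventually_sequentially by blast
    qed simp
    then show ?thesis using sum_bound_norm_l2[of "\<lambda>g. coef (X n) g - f g" e] e by blast
  qed
  obtain M1 where M1: "\<forall>m\<ge>M1. \<forall>n\<ge>M1. norm (X m - X n) < 1" using CauchyD[OF X, of 1] by auto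
  have f2: "sq_summable f"
    using sq_summable_add[OF coef_sq_summable[of "X M1"] sq_summable_mult[OF near[OF order_refl M1, THEN conjunct1], of "- 1"]] by simp
  have eq: "X n - Abs_l2 f = Abs_l2 (\<lambda>g. coef (X n) g - f g)" if "sq_summable (\<lambda>g. coef (X n) g - f g)" for n
    by (rule l2_eqI) (use that f2 in \<open>simp add: minus_l2.rep_eq Abs_l2_inverse\<close>)
  have "X \<longlonglongrightarrow> Abs_l2 f"
  proof (rule LIMSEQ_I)
    fix r :: real assume r: "r > 0"
    then obtain M where M: "\<forall>m\<ge>M. \<forall>n\<ge>M. norm (X m - X n) < r / 2" using CauchyD[OF X, of "r/2"] by auto
    have "norm (X n - Abs_l2 f) < r" if n: "n \<ge> M" for n
      using near[OF n M] eq[of n] r by simp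
    then show "\<exists>no. \<forall>n\<ge>no. norm (X n - Abs_l2 f) < r" by blast
  qed
  then show "convergent X" by (rule convergentI)
qed

instantiation l2 :: (type) chilbert
begin
lift_definition im_l2 :: "'a l2 \<Rightarrow> 'a l2" is "\<lambda>f g. \<i> * f g" by (rule sq_summable_mult)
instance
proof
  fix x y :: "'a l2" and r :: real
  show "im (x + y) = im x + im y" by transfer (simp add: algebra_simps)
  show "im (r *\<^sub>R x) = r *\<^sub>R im x" by transfer (simp add: algebra_simps)
  show "im (im x) = - x" by transfer simp
  show "inner (im x) (im y) = inner x y"
    by (simp add: inner_l2_def im_l2.rep_eq inner_complex_def add.commute)
qed
end

lemma coef_simps [simp]:
  "coef 0 g = 0" "coef (x + y) g = coef x g + coef y g" "coef (x - y) g = coef x g - coef y g"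
  "coef (- x) g = - coef x g" "coef (r *\<^sub>R x) g = of_real r * coef x g" "coef (im x) g = \<i> * coef x g"
  by (simp_all add: zero_l2.rep_eq plus_l2.rep_eq minus_l2.rep_eq uminus_l2.rep_eq scaleR_l2.rep_eq im_l2.rep_eq
      scaleR_conv_of_real)

lemma coef_scaleC [simp]: "coef (scaleC c x) g = c * coef x g"
  by (simp add: scaleC_def complex_eq_iff)

lemma coef_sum: "coef (\<Sum>i\<in>A. f i) g = (\<Sum>i\<in>A. coef (f i) g)"
  by (induction A rule: infinite_finite_induct) auto

lift_definition point :: "'g \<Rightarrow> 'g l2" is "\<lambda>h g. if g = h then 1 else 0"
  by (rule sq_summable_finite) simp

lemma coef_point: "coef (point h) g = (if g = h then 1 else 0)"
  by (simp add: point.rep_eq)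

lemma cip_point: "cip x (point g) = coef x g"
proof -
  have "x \<bullet> point g = (\<Sum>h\<in>{g}. coef x h \<bullet> coef (point g) h)"
    by (rule inner_l2_finite) (auto simp: coef_point)
  moreover have "x \<bullet> im (point g) = (\<Sum>h\<in>{g}. coef x h \<bullet> coef (im (point g)) h)"
    by (rule inner_l2_finite) (auto simp: coef_point)
  ultimately show ?thesis by (simp add: cip_def coef_point inner_complex_def complex_eq_iff)
qed

lift_definition restr :: "'g set \<Rightarrow> 'g l2 \<Rightarrow> 'g l2" is "\<lambda>F f g. if g \<in> F then f g else 0"
  unfolding sq_summable_def by (rule summable_on_bounded) auto

lemma coef_restr [simp]: "coef (restr F x) g = (if g \<in> F then coef x g else 0)"
  by (simp add: restr.rep_eq)

lemma restr_finite: "finite F \<Longrightarrow> restr F x = (\<Sum>g\<in>F. scaleC (coef x g) (point g))"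
  by (rule l2_eqI) (simp add: coef_sum coef_point if_distrib cong: if_cong)

lemma restr_approx:
  assumes e: "e > 0" shows "\<exists>F. finite F \<and> norm (x - restr F x) < e"
proof -
  have s: "(\<lambda>g. coef x g \<bullet> coef x g) summable_on UNIV" by (simp add: sq_summable_inner)
  obtain F where F: "finite F" "dist (\<Sum>g\<in>F. coef x g \<bullet> coef x g) (x \<bullet> x) \<le> (e/2)\<^sup>2"
    using infsum_finite_approximation[OF s, of "(e/2)\<^sup>2"] e unfolding inner_l2_def by auto
  have 1: "restr F x \<bullet> restr F x = (\<Sum>g\<in>F. coef x g \<bullet> coef x g)"
    using inner_l2_finite[of F "restr F x" "restr F x"] F by simp
  have 2: "x \<bullet> restr F x = (\<Sum>g\<in>F. coef x g \<bullet> coef x g)"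
    using inner_l2_finite[of F x "restr F x"] F by simp
  have "(norm (x - restr F x))\<^sup>2 = x \<bullet> x - (\<Sum>g\<in>F. coef x g \<bullet> coef x g)"
    unfolding power2_norm_eq_inner by (simp add: inner_diff_left inner_diff_right 1 2 inner_commute[of "restr F x" x])
  also have "\<dots> \<le> (e/2)\<^sup>2" using F(2) by (simp add: dist_real_def)
  also have "\<dots> < e\<^sup>2" using e by (simp add: power_divide)
  finally have "norm (x - restr F x) < e" by (rule power2_less_imp_less) (use e in simp)
  then show ?thesis using F by blast
qed

definition reindex :: "('g \<Rightarrow> 'g) \<Rightarrow> 'g l2 \<Rightarrow> 'g l2" where
  "reindex p x = Abs_l2 (\<lambda>g. coef x (p g))"

lemma coef_reindex: assumes "bij p" shows "coef (reindex p x) g = coef x (p g)"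
proof -
  have "sq_summable (\<lambda>g. coef x (p g))"
    using coef_sq_summable[of x] summable_on_reindex_bij_betw[OF assms, of "\<lambda>g. (cmod (coef x g))\<^sup>2"]
    unfolding sq_summable_def by blast
  then show ?thesis by (simp add: reindex_def Abs_l2_inverse)
qed

lemma inner_reindex: assumes "bij p" shows "reindex p x \<bullet> reindex p y = x \<bullet> y"
  unfolding inner_l2_def coef_reindex[OF assms]
  by (rule infsum_reindex_bij_betw[OF assms])

lift_definition conj_l2 :: "'g l2 \<Rightarrow> 'g l2" is "\<lambda>f g. cnj (f g)"
  by (simp add: sq_summable_def)

lemma coef_conj [simp]: "coef (conj_l2 x) g = cnj (coef x g)"
  by (simp add: conj_l2.rep_eq)

lemma inner_conj: "conj_l2 x \<bullet> conj_l2 y = x \<bullet> y"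
  by (simp add: inner_l2_def inner_complex_def)

lemma isometry_bounded_linear:
  assumes "\<And>x y. f (x + y) = f x + f y" "\<And>r x. f (r *\<^sub>R x) = r *\<^sub>R f x" "\<And>x y. f x \<bullet> f y = x \<bullet> y"
  shows "bounded_linear (f :: 'a::real_inner \<Rightarrow> 'b::real_inner)"
  by (rule bounded_linear_intro[of _ 1]) (auto simp: assms norm_eq_sqrt_inner)

lemma clin_reindex: "bij p \<Longrightarrow> clin (reindex p)"
  unfolding clin_def
  by (intro conjI isometry_bounded_linear inner_reindex allI l2_eqI) (simp_all add: coef_reindex)

context tracial_rep
begin

lemma not_findim_N:
  assumes inf: "infinite S" and S: "S \<subseteq> (\<lambda>T. T Om) ` N" and orth: "pairwise orthogonal S" "0 \<notin> S"
  shows "\<not> findim N"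
proof
  assume "findim N"
  from findim_span[OF this, of Om] obtain G where G: "finite G" "(\<lambda>T. T Om) ` N \<subseteq> span G" by blast
  have "independent S" by (rule pairwise_orthogonal_independent[OF orth])
  from independent_span_bound[OF G(1) this subset_trans[OF S G(2)]] show False using inf by blast
qed

end

section \<open>The hyperfinite factor of the finitary symmetric group\<close>

type_synonym fsym = "nat perm"

lemma ex_perm_involution:
  assumes "\<And>x. f (f x) = x" "\<And>x. x \<ge> n \<Longrightarrow> f x = x"
  shows "\<exists>g::fsym. apply g = f"
proof -
  have "bij f" using assms(1) by (rule involuntory_imp_bij)
  moreover have "{a. f a \<noteq> a} \<subseteq> {..<n}" using assms(2) by (auto simp: not_less[symmetric])
  then have "finite {a. f a \<noteq> a}" by (rule finite_subset) simp
  ultimately show ?thesis by (intro exI[of _ "Perm f"]) (simp add: Perm_inverse)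
qed

lemma finite_perms_affected: "finite A \<Longrightarrow> finite {g::'a perm. affected g \<subseteq> A}"
proof -
  assume A: "finite A"
  have "apply ` {g::'a perm. affected g \<subseteq> A} \<subseteq> {p. p permutes A}"
  proof safe
    fix g :: "'a perm" assume g: "affected g \<subseteq> A"
    show "apply g permutes A"
      unfolding permutes_def
    proof (intro conjI allI impI)
      show "apply g x = x" if "x \<notin> A" for x using g that by (auto simp: in_affected)
      show "\<exists>!x. apply g x = y" for y using bij_apply[of g] by (simp add: bij_iff)
    qed
  qed
  then have "finite (apply ` {g::'a perm. affected g \<subseteq> A})"
    by (rule finite_subset) (rule finite_permutations[OF A])
  then show ?thesis by (rule finite_imageD) (simp add: inj_on_def apply_inject)
qed

text \<open>Left translation by \<open>g\<close>: the canonical unitary of the group von Neumann algebra.\<close>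

definition lam :: "fsym \<Rightarrow> fsym l2 \<Rightarrow> fsym l2" where
  "lam g = reindex (\<lambda>h. inverse g * h)"

definition J0 :: "fsym l2 \<Rightarrow> fsym l2" where
  "J0 x = conj_l2 (reindex inverse x)"

abbreviation e0 :: "fsym l2" where "e0 \<equiv> point 1"

definition L0 :: "(fsym l2 \<Rightarrow> fsym l2) set" where
  "L0 = {(\<lambda>v. scaleC c (lam g v)) | c g. True}"

lemma perm_cancel [simp]: "inverse g * (g * h) = (h::'a perm)" "g * (inverse g * h) = h"
  "(h * g) * inverse g = h" "(h * inverse g) * g = h" "inverse (1::'a perm) = 1"
  "inverse (inverse g) = g"
  by (simp_all add: mult.assoc[symmetric] perm.left_inverse perm.right_inverse) (simp_all add: mult.assoc perm.left_inverse perm.right_inverse)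

lemma bij_perm_left: "bij (\<lambda>h. g * (h::'a perm))"
  by (rule bij_betw_byWitness[where f' = "\<lambda>h. inverse g * h"]) auto

lemma bij_perm_inverse: "bij (inverse :: 'a perm \<Rightarrow> 'a perm)"
  by (rule involuntory_imp_bij) simp

lemma coef_lam [simp]: "coef (lam g x) h = coef x (inverse g * h)"
  by (simp add: lam_def coef_reindex bij_perm_left)

lemma coef_J0 [simp]: "coef (J0 x) h = cnj (coef x (inverse h))"
  by (simp add: J0_def coef_reindex bij_perm_inverse)

lemma clin_lam: "clin (lam g)"
  unfolding lam_def by (rule clin_reindex[OF bij_perm_left])

lemma lam_lam: "lam g (lam h x) = lam (g * h) x"
  by (rule l2_eqI) (simp add: mult.assoc)

lemma lam_one [simp]: "lam 1 x = x"
  by (rule l2_eqI) simp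

lemma inner_lam: "lam g x \<bullet> lam g y = x \<bullet> y"
  unfolding lam_def by (rule inner_reindex[OF bij_perm_left])

lemma norm_lam [simp]: "norm (lam g x) = norm x"
  by (simp add: norm_eq_sqrt_inner inner_lam)

lemma adj_lam: "adj (lam g) = lam (inverse g)"
proof (rule adj_unique)
  fix x y
  show "lam g x \<bullet> y = x \<bullet> lam (inverse g) y"
    using inner_lam[of g x "lam (inverse g) y"] by (simp add: lam_lam perm.right_inverse)
qed

lemma lam_point [simp]: "lam g (point h) = point (g * h)"
  by (rule l2_eqI) (auto simp: coef_point)

lemma J0_point [simp]: "J0 (point g) = point (inverse g)"
  by (rule l2_eqI) (auto simp: coef_point)

lemma J0_scaleC: "J0 (scaleC c x) = scaleC (cnj c) (J0 x)"
  by (rule l2_eqI) simp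

lemma point_inner: "point g \<bullet> point h = (if g = h then 1 else 0)"
  using arg_cong[OF cip_point[of "point g" h], of Re] by (auto simp: coef_point)

global_interpretation R: tracial_rep L0 J0 e0
proof (rule tracial_rep.intro)
  show "bounded_linear J0"
  proof (rule isometry_bounded_linear)
    show "J0 (x + y) = J0 x + J0 y" for x y by (rule l2_eqI) simp
    show "J0 (r *\<^sub>R x) = r *\<^sub>R J0 x" for r x by (rule l2_eqI) simp
    show "J0 x \<bullet> J0 y = x \<bullet> y" for x y
      by (simp add: J0_def inner_conj inner_reindex bij_perm_inverse)
  qed
  show "J0 (im x) = - im (J0 x)" for x by (rule l2_eqI) simp
  show "J0 (J0 x) = x" for x by (rule l2_eqI) simp
  show "J0 x \<bullet> J0 y = x \<bullet> y" for x y
    by (simp add: J0_def inner_conj inner_reindex bij_perm_inverse)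
  show "J0 e0 = e0" by simp
  show "e0 \<bullet> e0 = 1" by (simp add: point_inner)
next
  fix x assume "x \<in> L0"
  then obtain c g where x: "x = (\<lambda>v. scaleC c (lam g v))" by (auto simp: L0_def)
  show "clin x" unfolding x by (intro clin_scaleC_op clin_lam)
  have a: "adj x = (\<lambda>v. scaleC (cnj c) (lam (inverse g) v))"
    unfolding x by (simp add: adj_scaleC clin_lam adj_lam)
  then show "adj x \<in> L0" by (auto simp: L0_def)
  show "J0 (x e0) = adj x e0" unfolding a by (simp add: x J0_scaleC)
next
  fix v :: "fsym l2" assume v: "\<And>x. x \<in> L0 \<Longrightarrow> v \<bullet> x e0 = 0"
  have "coef v g = 0" for g
  proof -
    have "v \<bullet> scaleC c (point g) = 0" for c
      using v[of "\<lambda>v. scaleC c (lam g v)"] by (auto simp: L0_def)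
    from this[of 1] this[of \<i>] have "cip v (point g) = 0" by (simp add: cip_def complex_eq_iff)
    then show ?thesis by (simp add: cip_point)
  qed
  then show "v = 0" by (intro l2_eqI) simp
next
  fix x y v assume "x \<in> L0" "y \<in> L0"
  then obtain c g d h where "x = (\<lambda>v. scaleC c (lam g v))" "y = (\<lambda>v. scaleC d (lam h v))" by (auto simp: L0_def)
  then show "x (J0 (y (J0 v))) = J0 (y (J0 (x v)))"
    by (intro l2_eqI) (simp add: mult.assoc)
qed

lemma lam_in_N: "lam g \<in> R.N"
  using R.L_subset_N by (force simp: L0_def intro: exI[of _ 1] exI[of _ g])

lemma norm_restr_le: "norm (restr A x) \<le> norm x"
proof -
  have "restr A x \<bullet> restr A x = x \<bullet> restr A x"
    unfolding inner_l2_def by (rule infsum_cong) simp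
  then have "norm (restr A x) * norm (restr A x) \<le> norm x * norm (restr A x)"
    using norm_cauchy_schwarz[of x "restr A x"] by (simp add: norm_mult_self)
  then show ?thesis by (cases "restr A x = 0") (auto dest: mult_right_le_imp_le)
qed

lemma restr_mono: "F \<subseteq> K \<Longrightarrow> norm (x - restr K x) \<le> norm (x - restr F x)"
proof -
  assume "F \<subseteq> K"
  then have "x - restr K x = restr (- K) (x - restr F x)" by (intro l2_eqI) auto
  then show ?thesis using norm_restr_le by metis
qed

text \<open>Up to a small error, and after removing the coefficient at the identity, \<open>x\<close> is carried by
  finitely many permutations other than the identity that move only points below some \<open>n\<close>.  Swapping
  the blocks \<open>[0, n)\<close> and \<open>[n, 2n)\<close> conjugates them into permutations of the second block, so the
  conjugate is orthogonal to the original, and the two differ by about \<open>sqrt 2\<close> times the norm.\<close>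

lemma ex_conjugation_moves:
  "\<exists>g. norm (x - scaleC (coef x 1) e0) \<le> norm (lam g (J0 (lam g (J0 x))) - x)"
proof -
  define C where "C g x = lam g (J0 (lam g (J0 x)))" for g x
  have coefC: "coef (C g x) s = coef x (inverse g * s * g)" for g x s
    by (simp add: C_def mult.assoc)
  have normC: "norm (C g x) = norm x" for g x by (simp add: C_def)
  define y where "y = x - scaleC (coef x 1) e0"
  have y1: "coef y 1 = 0" by (simp add: y_def coef_point)
  have Cy: "C g x - x = C g y - y" for g
    by (rule l2_eqI) (auto simp: coefC y_def coef_point mult.assoc perm.left_inverse,
       metis perm_cancel(1) perm_cancel(3) mult_1_left mult.assoc)
  define a where "a = norm y"
  show ?thesis
  proof (cases "a = 0")
    case True
    then show ?thesis by (simp add: a_def y_def)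
  next
    case False
    then have a: "a > 0" by (simp add: a_def)
    obtain F where F: "finite F" "norm (y - restr F y) < a / 10" using restr_approx[of "a/10" y] a by auto
    define f where "f = restr F y"
    have "finite (\<Union>s\<in>F. affected s)" using F by simp
    then obtain n where n: "(\<Union>s\<in>F. affected s) \<subseteq> {..<n}" by (meson finite_nat_iff_bounded)
    define sw where "sw i = (if i < n then i + n else if i < 2 * n then i - n else i)" for i :: nat
    have "\<exists>g::fsym. apply g = sw"
      by (rule ex_perm_involution[of sw "2 * n"]) (auto simp: sw_def)
    then obtain g :: fsym where g: "apply g = sw" by blast
    have disj: "coef f s = 0 \<or> coef (C g f) s = 0" for s
    proof (rule ccontr)
      assume "\<not> ?thesis"
      then have s: "s \<in> F" "s \<noteq> 1" and t: "inverse g * s * g \<in> F"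
        using y1 by (auto simp: f_def coefC split: if_splits)
      have "apply s i = i" for i
      proof (cases "i < n")
        case True
        have "i + n \<notin> affected (inverse g * s * g)" using t n by auto
        then have "apply (g * (inverse g * s * g)) (i + n) = apply g (i + n)"
          by (simp add: in_affected apply_times)
        moreover have "g * (inverse g * s * g) = s * g" by (simp add: mult.assoc)
        ultimately have "apply s (apply g (i + n)) = apply g (i + n)" by (simp add: apply_times)
        then show ?thesis using True by (simp add: g sw_def)
      next
        case False
        then have "i \<notin> affected s" using s n by auto
        then show ?thesis by (simp add: in_affected)
      qed
      then have "s = 1" by (intro perm_eqI) simp
      then show False using s by simp
    qed
    have orth: "C g f \<bullet> f = 0"
      unfolding inner_l2_def by (rule infsum_0) (metis disj inner_zero_left inner_zero_right)
    have linC: "C g (y - f) = C g y - C g f" by (rule l2_eqI) (simp add: coefC)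
    have "(norm (C g f - f))\<^sup>2 = 2 * (norm f)\<^sup>2"
      using orth normC[of g f] unfolding power2_norm_eq_inner norm_eq_sqrt_inner
      by (simp add: inner_diff_left inner_diff_right inner_commute[of f "C g f"])
    moreover have nf: "norm f \<ge> 9 / 10 * a"
      using norm_triangle_ineq2[of y f] F(2) norm_minus_commute[of y f] by (simp add: a_def f_def)
    have "(12 / 10 * a)\<^sup>2 \<le> 2 * (9 / 10 * a)\<^sup>2" by (simp add: power_mult_distrib power_divide)
    moreover have "(9 / 10 * a)\<^sup>2 \<le> (norm f)\<^sup>2" using nf a by (intro power_mono) auto
    ultimately have "(12 / 10 * a)\<^sup>2 \<le> (norm (C g f - f))\<^sup>2" by linarith
    then have 1: "12 / 10 * a \<le> norm (C g f - f)" by (rule power2_le_imp_le) simp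
    have "C g f - f = (C g y - y) - C g (y - f) + (y - f)" by (simp add: linC)
    then have "norm (C g f - f) \<le> norm ((C g y - y) - C g (y - f)) + norm (y - f)"
      using norm_triangle_ineq by metis
    also have "\<dots> \<le> norm (C g y - y) + norm (C g (y - f)) + norm (y - f)"
      using norm_triangle_ineq4[of "C g y - y" "C g (y - f)"] by simp
    finally have "norm (C g f - f) \<le> norm (C g y - y) + 2 * norm (y - f)" by (simp add: normC)
    then have "a \<le> norm (C g y - y)" using 1 F(2) by (simp add: f_def)
    then show ?thesis unfolding Cy[symmetric] by (intro exI[of _ g]) (simp add: C_def a_def y_def)
  qed
qed

text \<open>The distance of \<open>T\<close> from the scalars is controlled by one commutator with a unitary of the group.
  This shows that \<open>R\<close> is a factor, and, being uniform in \<open>T\<close>, also that its ultrapower is one.\<close>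

lemma ex_noncommuting_lam:
  assumes T: "T \<in> R.N"
  shows "\<exists>g. norm (T e0 - scaleC (cip (T e0) e0) e0) \<le> norm (lam g (T e0) - T (lam g e0))"
proof -
  obtain g where g: "norm (T e0 - scaleC (coef (T e0) 1) e0) \<le> norm (lam g (J0 (lam g (J0 (T e0)))) - T e0)"
    using ex_conjugation_moves by blast
  have "J0 (lam g (J0 (T e0))) = T (lam (inverse g) e0)"
    using R.J_N_J_Om[OF T lam_in_N, of g] by (simp add: adj_lam)
  then have "lam g (J0 (lam g (J0 (T e0)))) - T e0 = lam g (T (lam (inverse g) e0) - lam (inverse g) (T e0))"
    by (simp add: linear_diff[OF clin_linear[OF clin_lam]] lam_lam perm.right_inverse)
  then have "norm (T e0 - scaleC (coef (T e0) 1) e0) \<le> norm (lam (inverse g) (T e0) - T (lam (inverse g) e0))"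
    using g by (simp add: norm_minus_commute)
  then show ?thesis by (auto simp: cip_point)
qed

lemma R_centre:
  assumes T: "T \<in> R.N" and c: "\<And>S v. S \<in> R.N \<Longrightarrow> S (T v) = T (S v)"
  shows "\<exists>c. T = scaleC c"
proof -
  have "T e0 = scaleC (cip (T e0) e0) e0"
    using ex_noncommuting_lam[OF T] c[OF lam_in_N] by auto
  then have "T = scaleC (cip (T e0) e0)"
    by (intro R.N_eqI T) (use R.N_scaleC[OF R.N_id] in auto)
  then show ?thesis by blast
qed

lemma infinite_fsym: "infinite (UNIV :: fsym set)"
proof
  assume "finite (UNIV :: fsym set)"
  then have "finite (\<Union>s\<in>(UNIV::fsym set). affected s)" by simp
  then obtain n where n: "(\<Union>s\<in>(UNIV::fsym set). affected s) \<subseteq> {..<n}" by (meson finite_nat_iff_bounded)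
  define sw where "sw i = (if i = n then n + 1 else if i = n + 1 then n else i)" for i
  have "\<exists>g::fsym. apply g = sw"
    by (rule ex_perm_involution[of sw "n + 2"]) (auto simp: sw_def)
  then obtain g :: fsym where g: "apply g = sw" by blast
  then have "n \<in> affected g" by (simp add: in_affected sw_def)
  then show False using n by auto
qed

lemma R_not_findim: "\<not> findim R.N"
proof (rule R.not_findim_N)
  have "inj (point :: fsym \<Rightarrow> fsym l2)"
    by (rule injI) (metis point_inner zero_neq_one)
  then show "infinite (range (point :: fsym \<Rightarrow> fsym l2))"
    using infinite_fsym by (simp add: finite_image_iff)
  show "range point \<subseteq> (\<lambda>T. T e0) ` R.N"
  proof safe
    fix g :: fsym
    show "point g \<in> (\<lambda>T. T e0) ` R.N" by (rule image_eqI[OF _ lam_in_N[of g]]) simp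
  qed
  show "pairwise orthogonal (range (point :: fsym \<Rightarrow> fsym l2))"
    by (auto simp: pairwise_def orthogonal_def point_inner)
  show "0 \<notin> range (point :: fsym \<Rightarrow> fsym l2)"
    by (metis imageE inner_zero_left point_inner zero_neq_one)
qed

text \<open>Symbols are approximated by their restrictions to finite sets of permutations; these generate a
  finite subgroup \<open>K\<close>, and the elements with symbol carried by \<open>K\<close> form a *-subalgebra spanned by \<open>K\<close>.\<close>

lemma R_hyperfinite:
  fixes F :: "(fsym l2 \<Rightarrow> fsym l2) set"
  assumes F: "finite F" "F \<subseteq> R.N" and e: "e > 0"
  shows "\<exists>B\<subseteq>R.N. star_subalg B \<and> findim B \<and> (\<forall>x\<in>F. \<exists>y\<in>B. norm (x e0 - y e0) < e)"
proof -
  have "\<forall>x. \<exists>G. finite G \<and> norm (x e0 - restr G (x e0)) < e" for x :: "fsym l2 \<Rightarrow> fsym l2"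
    using restr_approx[OF e] by blast
  then have "\<exists>G. \<forall>x::fsym l2 \<Rightarrow> fsym l2. finite (G x) \<and> norm (x e0 - restr (G x) (x e0)) < e"
    by (intro choice) blast
  then obtain G where G: "\<And>x::fsym l2 \<Rightarrow> fsym l2. finite (G x)" "\<And>x::fsym l2 \<Rightarrow> fsym l2. norm (x e0 - restr (G x) (x e0)) < e"
    by blast
  define A where "A = (\<Union>x\<in>F. \<Union>g\<in>G x. affected g)"
  define K where "K = {g::fsym. affected g \<subseteq> A}"
  have "finite A" using F G by (simp add: A_def)
  then have K: "finite K" unfolding K_def by (rule finite_perms_affected)
  have K1: "1 \<in> K" by (simp add: K_def)
  have Kinv: "inverse g \<in> K \<longleftrightarrow> g \<in> K" for g by (simp add: K_def)
  have Kmult: "g \<in> K \<Longrightarrow> h \<in> K \<Longrightarrow> g * h \<in> K" for g h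
    using affected_times[of g h] unfolding K_def by blast
  define B where "B = {T \<in> R.N. \<forall>g. g \<notin> K \<longrightarrow> coef (T e0) g = 0}"
  have expand: "T = (\<lambda>v. \<Sum>g\<in>K. scaleC (coef (T e0) g) (lam g v))" if T: "T \<in> B" for T
  proof (rule R.N_eqI)
    show "T \<in> R.N" using T by (simp add: B_def)
    show "(\<lambda>v. \<Sum>g\<in>K. scaleC (coef (T e0) g) (lam g v)) \<in> R.N"
      by (intro R.N_sum R.N_scaleC lam_in_N)
    have "T e0 = restr K (T e0)" using T by (intro l2_eqI) (auto simp: B_def)
    then show "T e0 = (\<Sum>g\<in>K. scaleC (coef (T e0) g) (lam g e0))"
      unfolding restr_finite[OF K] by simp
  qed
  have comb: "(\<lambda>v. \<Sum>g\<in>K. scaleC (c g) (lam g v)) \<in> B" for c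
    unfolding B_def
    by (auto intro!: R.N_sum R.N_scaleC lam_in_N simp: coef_sum coef_point sum.neutral)
  have "star_subalg B"
    unfolding star_subalg_def
  proof (intro conjI ballI allI)
    show "(\<lambda>v. 0) \<in> B" by (simp add: B_def R.N_zero)
    show "(\<lambda>v. v) \<in> B" using K1 by (auto simp: B_def R.N_id coef_point)
    fix x assume x: "x \<in> B"
    show "(\<lambda>v. scaleC c (x v)) \<in> B" for c using x by (auto simp: B_def R.N_scaleC)
    show "adj x \<in> B" using x Kinv by (auto simp: B_def R.N_adj R.N_adj_Om)
    fix y assume y: "y \<in> B"
    show "(\<lambda>v. x v + y v) \<in> B" using x y by (auto simp: B_def R.N_add)
    have "coef (x (y e0)) g = 0" if g: "g \<notin> K" for g
    proof -
      have "x (y e0) = x (\<Sum>h\<in>K. scaleC (coef (y e0) h) (point h))"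
        using fun_cong[OF expand[OF y], of e0] by simp
      also have "\<dots> = (\<Sum>h\<in>K. scaleC (coef (y e0) h) (x (point h)))"
        using x by (simp add: B_def linear_sum clin_linear R.N_clin clin_scaleC)
      finally have "coef (x (y e0)) g = (\<Sum>h\<in>K. coef (y e0) h * coef (x (point h)) g)"
        by (simp add: coef_sum)
      also have "\<dots> = 0"
      proof (rule sum.neutral, rule ballI)
        fix h assume h: "h \<in> K"
        have "x (point h) = J0 (lam (inverse h) (J0 (x e0)))"
          using R.J_N_J_Om[of x "lam (inverse h)"] x lam_in_N by (simp add: B_def adj_lam)
        then have "coef (x (point h)) g = coef (x e0) (g * inverse h)" by simp
        moreover have "g * inverse h \<notin> K"
          using g Kmult[of "g * inverse h" h] h by auto
        ultimately show "coef (y e0) h * coef (x (point h)) g = 0" using x by (simp add: B_def)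
      qed
      finally show ?thesis .
    qed
    then show "(\<lambda>v. x (y v)) \<in> B" using x y by (auto simp: B_def R.N_comp)
  qed
  moreover have "findim B"
    unfolding findim_def
  proof (intro exI[of _ "lam ` K"] conjI ballI)
    show "finite (lam ` K)" using K by simp
    show "lam ` K \<subseteq> B" using K1 by (auto simp: B_def lam_in_N coef_point)
    have inj: "inj_on lam K"
    proof (rule inj_onI)
      fix g h assume "lam g = lam h"
      then have "point g = point h" by (metis lam_point mult.right_neutral)
      then show "g = h" by (metis point_inner zero_neq_one)
    qed
    fix x assume x: "x \<in> B"
    have "x = (\<lambda>v. \<Sum>f\<in>lam ` K. scaleC (coef (x e0) (inv_into K lam f)) (f v))"
      unfolding sum.reindex[OF inj] using expand[OF x]
      by (simp add: inv_into_f_f[OF inj] cong: sum.cong)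
    then show "\<exists>c. x = (\<lambda>v. \<Sum>f\<in>lam ` K. scaleC (c f) (f v))"
      by (rule exI[of _ "\<lambda>f. coef (x e0) (inv_into K lam f)"])
  qed
  moreover have "\<exists>y\<in>B. norm (x e0 - y e0) < e" if x: "x \<in> F" for x
  proof (rule bexI[OF _ comb])
    have "G x \<subseteq> K" using x by (auto simp: K_def A_def)
    then have "norm (x e0 - restr K (x e0)) < e" by (rule order.strict_trans1[OF restr_mono G(2)])
    then show "norm (x e0 - (\<Sum>g\<in>K. scaleC (coef (x e0) g) (lam g e0))) < e"
      by (simp add: restr_finite[OF K])
  qed
  ultimately show ?thesis by (intro exI[of _ B]) (auto simp: B_def)
qed

section \<open>A free ultrafilter on the natural numbers\<close>

lemma ex_free_ultrafilter:
  "\<exists>U::nat filter. U \<noteq> bot \<and> U \<le> sequentially \<and> (\<forall>P. eventually P U \<or> eventually (\<lambda>i. \<not> P i) U)"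
proof -
  define A where "A = {F::nat filter. F \<noteq> bot \<and> F \<le> sequentially}"
  define le where "le F G \<longleftrightarrow> G \<le> F" for F G :: "nat filter"
  have po: "partial_order_on A (relation_of le A)"
    by (rule partial_order_on_relation_ofI) (auto simp: le_def)
  have "\<exists>m\<in>A. \<forall>F\<in>A. le m F \<longrightarrow> F = m"
  proof (rule predicate_Zorn[OF po])
    fix C assume C: "C \<in> Chains (relation_of le A)"
    have CA: "C \<subseteq> A" using Chains_relation_of[OF C] .
    have ch: "F \<le> G \<or> G \<le> F" if "F \<in> C" "G \<in> C" for F G
      using C that by (auto simp: Chains_def relation_of_def le_def)
    show "\<exists>u\<in>A. \<forall>F\<in>C. le F u"
    proof (cases "C = {}")
      case True
      then show ?thesis by (intro bexI[of _ sequentially]) (auto simp: A_def)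
    next
      case False
      have ev: "eventually P (Inf C) \<longleftrightarrow> (\<exists>F\<in>C. eventually P F)" for P
        by (rule eventually_Inf_base[OF False]) (metis ch inf.absorb1 inf.absorb2 order_refl)
      have "Inf C \<noteq> bot" using CA ev[of "\<lambda>_. False"] by (auto simp: trivial_limit_def A_def)
      moreover have "Inf C \<le> sequentially" using False CA by (auto simp: A_def intro: Inf_lower2)
      ultimately show ?thesis by (intro bexI[of _ "Inf C"]) (auto simp: A_def le_def intro: Inf_lower)
    qed
  qed
  then obtain m where m: "m \<in> A" and max: "\<And>F. F \<in> A \<Longrightarrow> F \<le> m \<Longrightarrow> F = m" by (auto simp: le_def)
  have "eventually P m \<or> eventually (\<lambda>i. \<not> P i) m" for P
  proof (cases "inf m (principal {i. P i}) = bot")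
    case True
    then have "eventually (\<lambda>_. False) (inf m (principal {i. P i}))" by simp
    then show ?thesis by (simp add: eventually_inf_principal)
  next
    case False
    then have "inf m (principal {i. P i}) = m" using m by (intro max) (auto simp: A_def intro: le_infI1)
    then have "m \<le> principal {i. P i}" by (metis inf.orderI)
    then show ?thesis by (simp add: le_principal)
  qed
  then show ?thesis using m by (auto simp: A_def)
qed

definition UF :: "nat filter" where
  "UF = (SOME U. U \<noteq> bot \<and> U \<le> sequentially \<and> (\<forall>P. eventually P U \<or> eventually (\<lambda>i. \<not> P i) U))"

lemma UF: "UF \<noteq> bot" "UF \<le> sequentially" "eventually P UF \<or> eventually (\<lambda>i. \<not> P i) UF"
  using someI_ex[OF ex_free_ultrafilter] unfolding UF_def[symmetric] by auto

lemma eventually_UF_ge: "eventually (\<lambda>i. i \<ge> n) UF"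
  using UF(2) eventually_ge_at_top[of n] by (rule filter_leD)

text \<open>Compactness: the image filter has a cluster point in a compact interval, and an ultrafilter
  converges to its cluster points.\<close>

lemma UF_convergent:
  fixes f :: "nat \<Rightarrow> real"
  assumes b: "\<forall>\<^sub>F i in UF. \<bar>f i\<bar> \<le> K"
  shows "\<exists>l. (f \<longlongrightarrow> l) UF"
proof -
  have "filtermap f UF \<noteq> bot" using UF(1) by (simp add: filtermap_bot_iff)
  moreover have "eventually (\<lambda>x. x \<in> {-K..K}) (filtermap f UF)"
    unfolding eventually_filtermap using b by (rule eventually_mono) auto
  ultimately obtain x where x: "inf (nhds x) (filtermap f UF) \<noteq> bot"
    using compact_Icc[of "-K" K] unfolding compact_filter by blast
  have "(f \<longlongrightarrow> x) UF"
  proof (rule topological_tendstoI)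
    fix S assume S: "open S" "x \<in> S"
    show "eventually (\<lambda>i. f i \<in> S) UF"
    proof (rule ccontr)
      assume "\<not> ?thesis"
      then have "eventually (\<lambda>y. y \<notin> S) (filtermap f UF)"
        using UF(3)[of "\<lambda>i. f i \<in> S"] by (simp add: eventually_filtermap)
      moreover have "eventually (\<lambda>y. y \<in> S) (nhds x)" using S by (simp add: eventually_nhds) blast
      ultimately have "eventually (\<lambda>_. False) (inf (nhds x) (filtermap f UF))"
        unfolding eventually_inf by blast
      then show False using x by (simp add: trivial_limit_def)
    qed
  qed
  then show ?thesis by blast
qed

lemma UF_Lim: "(f \<longlongrightarrow> l) UF \<Longrightarrow> Lim UF f = l"
  by (rule tendsto_Lim[OF UF(1)])

lemma UF_tendsto_Lim:
  fixes f :: "nat \<Rightarrow> real"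
  assumes "\<forall>\<^sub>F i in UF. \<bar>f i\<bar> \<le> K"
  shows "(f \<longlongrightarrow> Lim UF f) UF"
  using UF_convergent[OF assms] UF_Lim by auto

text \<open>Countable saturation.  The index \<open>m i\<close> is the largest \<open>p \<le> i\<close> such that the first \<open>p\<close> estimates hold
  at \<open>i\<close>; as the ultrafilter is free, it exceeds every given \<open>p\<close> almost everywhere.\<close>

lemma UF_diagonal:
  fixes x :: "nat \<Rightarrow> nat \<Rightarrow> 'a::real_normed_vector"
  assumes fast: "\<And>p. \<forall>\<^sub>F i in UF. norm (x p i - x (Suc p) i) < (1/2)^p"
  shows "\<exists>m::nat \<Rightarrow> nat. \<forall>p. \<forall>\<^sub>F i in UF. norm (x p i - x (m i) i) \<le> 2 * (1/2)^p"
proof -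
  define G where "G i = {p. p \<le> i \<and> (\<forall>q<p. norm (x q i - x (Suc q) i) < (1/2)^q)}" for i
  define m where "m i = Max (G i)" for i
  have fin: "finite (G i)" for i by (rule finite_subset[of _ "{..i}"]) (auto simp: G_def)
  have ne: "0 \<in> G i" for i by (simp add: G_def)
  have mG: "m i \<in> G i" for i unfolding m_def using fin ne by (intro Max_in) auto
  have tele: "norm (x p i - x k i) \<le> 2 * (1/2)^p - 2 * (1/2)^k" if "p \<le> k" "k \<in> G i" for p k i
    using that
  proof (induction k rule: dec_induct)
    case base then show ?case by simp
  next
    case (step k)
    then have kG: "k \<in> G i" "norm (x k i - x (Suc k) i) < (1/2)^k" by (auto simp: G_def)
    have "norm (x p i - x (Suc k) i) \<le> norm (x p i - x k i) + norm (x k i - x (Suc k) i)"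
      using norm_triangle_ineq[of "x p i - x k i" "x k i - x (Suc k) i"] by simp
    also have "\<dots> \<le> (2 * (1/2)^p - 2 * (1/2)^k) + (1/2)^k" using step.IH[OF kG(1)] kG(2) by simp
    finally show ?case by simp
  qed
  have "\<forall>\<^sub>F i in UF. norm (x p i - x (m i) i) \<le> 2 * (1/2)^p" for p
  proof -
    have "\<forall>\<^sub>F i in UF. \<forall>q\<in>{..<p}. norm (x q i - x (Suc q) i) < (1/2)^q"
      using fast by (intro eventually_ball_finite) auto
    then have "\<forall>\<^sub>F i in UF. p \<in> G i"
      using eventually_UF_ge[of p] by eventually_elim (auto simp: G_def)
    then show ?thesis
    proof (rule eventually_mono)
      fix i assume "p \<in> G i"
      then have "p \<le> m i" unfolding m_def using fin by (intro Max_ge)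
      from tele[OF this mG] have "norm (x p i - x (m i) i) \<le> 2 * (1/2)^p - 2 * (1/2)^(m i)" .
      also have "\<dots> \<le> 2 * (1/2)^p" by simp
      finally show "norm (x p i - x (m i) i) \<le> 2 * (1/2)^p" .
    qed
  qed
  then show ?thesis by blast
qed

section \<open>The Hilbert space of the ultrapower\<close>

definition linf :: "(nat \<Rightarrow> fsym l2 \<Rightarrow> fsym l2) set" where
  "linf = {y. (\<forall>i. y i \<in> R.N) \<and> (\<exists>K. \<forall>i v. norm (y i v) \<le> K * norm v)}"

lemma linf_N: "y \<in> linf \<Longrightarrow> y i \<in> R.N"
  by (simp add: linf_def)

lemma linf_clin: "y \<in> linf \<Longrightarrow> clin (y i)"
  by (simp add: linf_N R.N_clin)

lemma linf_bound: "y \<in> linf \<Longrightarrow> \<exists>K\<ge>0. \<forall>i v. norm (y i v) \<le> K * norm v"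
proof -
  assume "y \<in> linf"
  then obtain K where K: "\<And>i v. norm (y i v) \<le> K * norm v" by (auto simp: linf_def)
  have "norm (y i v) \<le> \<bar>K\<bar> * norm v" for i v
    by (rule order_trans[OF K]) (simp add: mult_right_mono)
  then show ?thesis by (intro exI[of _ "\<bar>K\<bar>"]) simp
qed

lemma linfI: "(\<And>i. y i \<in> R.N) \<Longrightarrow> (\<And>i v. norm (y i v) \<le> K * norm v) \<Longrightarrow> y \<in> linf"
  by (auto simp: linf_def)

lemma linf_add: assumes "y \<in> linf" "z \<in> linf" shows "(\<lambda>i v. y i v + z i v) \<in> linf"
proof -
  obtain K where "\<forall>i v. norm (y i v) \<le> K * norm v" using linf_bound[OF assms(1)] by blast
  moreover obtain K' where "\<forall>i v. norm (z i v) \<le> K' * norm v" using linf_bound[OF assms(2)] by blast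
  ultimately have "norm (y i v + z i v) \<le> (K + K') * norm v" for i v
    unfolding distrib_right by (intro order_trans[OF norm_triangle_ineq] add_mono) auto
  then show ?thesis by (rule linfI[OF R.N_add[OF linf_N[OF assms(1)] linf_N[OF assms(2)]]])
qed

lemma linf_comp: assumes "y \<in> linf" "z \<in> linf" shows "(\<lambda>i v. y i (z i v)) \<in> linf"
proof -
  obtain K where K: "K \<ge> 0" "\<forall>i v. norm (y i v) \<le> K * norm v" using linf_bound[OF assms(1)] by blast
  obtain K' where K': "\<forall>i v. norm (z i v) \<le> K' * norm v" using linf_bound[OF assms(2)] by blast
  have "norm (y i (z i v)) \<le> (K * K') * norm v" for i v
    unfolding mult.assoc by (rule order_trans[OF K(2)[rule_format] mult_left_mono[OF K'[rule_format] K(1)]])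
  then show ?thesis by (rule linfI[OF R.N_comp[OF linf_N[OF assms(1)] linf_N[OF assms(2)]]])
qed

lemma linf_scaleC: assumes "y \<in> linf" shows "(\<lambda>i v. scaleC c (y i v)) \<in> linf"
proof -
  obtain K where K: "\<forall>i v. norm (y i v) \<le> K * norm v" using linf_bound[OF assms] by blast
  then have "norm (scaleC c (y i v)) \<le> (cmod c * K) * norm v" for i v
    unfolding mult.assoc norm_scaleC by (simp add: mult_left_mono)
  then show ?thesis by (rule linfI[OF R.N_scaleC[OF linf_N[OF assms]]])
qed

lemma linf_adj: assumes "y \<in> linf" shows "(\<lambda>i. adj (y i)) \<in> linf"
proof -
  obtain K where K: "\<forall>i v. norm (y i v) \<le> K * norm v" using linf_bound[OF assms] by blast
  then have "norm (adj (y i) v) \<le> K * norm v" for i v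
    using adj_bound[OF clinD(1)[OF linf_clin[OF assms]]] by blast
  then show ?thesis by (rule linfI[OF R.N_adj[OF linf_N[OF assms]]])
qed

lemma linf_const: "T \<in> R.N \<Longrightarrow> (\<lambda>i. T) \<in> linf"
proof -
  assume T: "T \<in> R.N"
  obtain K where "\<And>x. norm (T x) \<le> norm x * K" using bounded_linear.bounded[OF clinD(1)[OF R.N_clin[OF T]]] by blast
  then show ?thesis using T by (intro linfI[of _ K]) (simp_all add: mult.commute)
qed

lemma linf_diff: "y \<in> linf \<Longrightarrow> z \<in> linf \<Longrightarrow> (\<lambda>i v. y i v - z i v) \<in> linf"
  using linf_add[OF _ linf_scaleC[of z "- 1"]] by (simp add: scaleC_minus_left)

text \<open>The closure of the symbols of bounded sequences in the Hilbert space ultraproduct of \<open>l2\<close>.  It is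
  a proper subspace: normalised projections of vanishing trace form a vector orthogonal to it.\<close>

definition X0 :: "(nat \<Rightarrow> fsym l2) set" where
  "X0 = {\<xi>. \<forall>e>0. \<exists>y\<in>linf. \<forall>\<^sub>F i in UF. norm (\<xi> i - y i e0) < e}"

lemma X0D: "\<xi> \<in> X0 \<Longrightarrow> e > 0 \<Longrightarrow> \<exists>y\<in>linf. \<forall>\<^sub>F i in UF. norm (\<xi> i - y i e0) < e"
  by (simp add: X0_def)

lemma X0_linf: "y \<in> linf \<Longrightarrow> (\<lambda>i. y i e0) \<in> X0"
  unfolding X0_def by (intro CollectI allI impI bexI[of _ y]) auto

lemma X0_bounded: assumes "\<xi> \<in> X0" shows "\<exists>K. \<forall>\<^sub>F i in UF. norm (\<xi> i) \<le> K"
proof -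
  obtain y where y: "y \<in> linf" "\<forall>\<^sub>F i in UF. norm (\<xi> i - y i e0) < 1" using X0D[OF assms, of 1] by auto
  obtain K where K: "\<forall>i v. norm (y i v) \<le> K * norm v" using linf_bound[OF y(1)] by blast
  have "norm (\<xi> i) \<le> 1 + K" if "norm (\<xi> i - y i e0) < 1" for i
    using norm_triangle_ineq[of "\<xi> i - y i e0" "y i e0"] that K[rule_format, of i e0] by simp
  then show ?thesis using y(2) by (intro exI[of _ "1 + K"]) (rule eventually_mono)
qed

lemma X0_add: assumes "\<xi> \<in> X0" "\<eta> \<in> X0" shows "(\<lambda>i. \<xi> i + \<eta> i) \<in> X0"
  unfolding X0_def
proof (intro CollectI allI impI)
  fix e :: real assume e: "e > 0"
  obtain y where y: "y \<in> linf" "\<forall>\<^sub>F i in UF. norm (\<xi> i - y i e0) < e/2" using X0D[OF assms(1), of "e/2"] e by auto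
  obtain z where z: "z \<in> linf" "\<forall>\<^sub>F i in UF. norm (\<eta> i - z i e0) < e/2" using X0D[OF assms(2), of "e/2"] e by auto
  have "\<forall>\<^sub>F i in UF. norm ((\<xi> i + \<eta> i) - (y i e0 + z i e0)) < e"
    using y(2) z(2)
  proof eventually_elim
    case (elim i)
    then show ?case using norm_triangle_ineq[of "\<xi> i - y i e0" "\<eta> i - z i e0"] by (simp add: algebra_simps)
  qed
  then show "\<exists>y\<in>linf. \<forall>\<^sub>F i in UF. norm ((\<xi> i + \<eta> i) - y i e0) < e"
    using linf_add[OF y(1) z(1)] by (rule_tac bexI) auto
qed

lemma X0_map:
  assumes \<xi>: "\<xi> \<in> X0" and K: "\<And>i v w. norm (f i v - f i w) \<le> K * norm (v - w)"
    and g: "\<And>y. y \<in> linf \<Longrightarrow> g y \<in> linf" "\<And>y i. y \<in> linf \<Longrightarrow> f i (y i e0) = g y i e0"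
  shows "(\<lambda>i. f i (\<xi> i)) \<in> X0"
  unfolding X0_def
proof (intro CollectI allI impI)
  fix e :: real assume e: "e > 0"
  have K': "\<bar>K\<bar> + 1 > 0" by simp
  obtain y where y: "y \<in> linf" "\<forall>\<^sub>F i in UF. norm (\<xi> i - y i e0) < e / (\<bar>K\<bar> + 1)"
    using X0D[OF \<xi>, of "e / (\<bar>K\<bar> + 1)"] e by auto
  have "\<forall>\<^sub>F i in UF. norm (f i (\<xi> i) - g y i e0) < e"
    using y(2)
  proof eventually_elim
    case (elim i)
    have "norm (f i (\<xi> i) - g y i e0) \<le> K * norm (\<xi> i - y i e0)" using K g(2)[OF y(1)] by metis
    also have "\<dots> \<le> (\<bar>K\<bar> + 1) * norm (\<xi> i - y i e0)" by (intro mult_right_mono) auto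
    also have "\<dots> < e" using elim K' by (simp add: field_simps)
    finally show ?case .
  qed
  then show "\<exists>y\<in>linf. \<forall>\<^sub>F i in UF. norm (f i (\<xi> i) - y i e0) < e"
    using g(1)[OF y(1)] by blast
qed

lemma X0_op: assumes "\<xi> \<in> X0" "y \<in> linf" shows "(\<lambda>i. y i (\<xi> i)) \<in> X0"
proof -
  obtain K where K: "\<forall>i v. norm (y i v) \<le> K * norm v" using linf_bound[OF assms(2)] by blast
  show ?thesis
  proof (rule X0_map[OF assms(1), where f = y and K = K and g = "\<lambda>z i v. y i (z i v)"])
    show "norm (y i v - y i w) \<le> K * norm (v - w)" for i v w
      using K linear_diff[OF clin_linear[OF linf_clin[OF assms(2)]]] by metis
  qed (use linf_comp[OF assms(2)] in auto)
qed

lemma X0_scaleC: assumes "\<xi> \<in> X0" shows "(\<lambda>i. scaleC c (\<xi> i)) \<in> X0"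
  using X0_op[OF assms linf_scaleC[OF linf_const[OF R.N_id]]] by simp

lemma X0_scaleR: "\<xi> \<in> X0 \<Longrightarrow> (\<lambda>i. r *\<^sub>R \<xi> i) \<in> X0"
  using X0_scaleC[of \<xi> "of_real r"] by simp

lemma X0_im: "\<xi> \<in> X0 \<Longrightarrow> (\<lambda>i. im (\<xi> i)) \<in> X0"
  using X0_scaleC[of \<xi> \<i>] by simp

lemma X0_minus: "\<xi> \<in> X0 \<Longrightarrow> (\<lambda>i. - \<xi> i) \<in> X0"
  using X0_scaleR[of \<xi> "- 1"] by simp

lemma X0_diff: "\<xi> \<in> X0 \<Longrightarrow> \<eta> \<in> X0 \<Longrightarrow> (\<lambda>i. \<xi> i - \<eta> i) \<in> X0"
  using X0_add[OF _ X0_minus] by simp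

lemma X0_zero: "(\<lambda>i. 0) \<in> X0"
  using X0_linf[OF linf_const[OF R.N_zero]] by simp

lemma X0_J: "\<xi> \<in> X0 \<Longrightarrow> (\<lambda>i. J0 (\<xi> i)) \<in> X0"
proof (rule X0_map[where f = "\<lambda>i. J0" and K = 1 and g = "\<lambda>z i. adj (z i)"])
  show "norm (J0 v - J0 w) \<le> 1 * norm (v - w)" for v w and i :: nat
    using linear_diff[OF R.J_lin, of v w] R.norm_J[of "v - w"] by simp
qed (auto simp: linf_adj linf_N R.N_adj_Om)

definition null_seq :: "(nat \<Rightarrow> fsym l2) \<Rightarrow> bool" where
  "null_seq \<xi> \<longleftrightarrow> ((\<lambda>i. norm (\<xi> i)) \<longlongrightarrow> 0) UF"

lemma null_seq_add: "null_seq \<xi> \<Longrightarrow> null_seq \<eta> \<Longrightarrow> null_seq (\<lambda>i. \<xi> i + \<eta> i)"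
  unfolding null_seq_def tendsto_norm_zero_iff by (rule tendsto_add_zero)

lemma null_seq_bound:
  assumes "null_seq \<xi>" "\<And>i. norm (\<eta> i) \<le> K * norm (\<xi> i)" shows "null_seq \<eta>"
  unfolding null_seq_def
proof (rule tendsto_sandwich[of "\<lambda>_. 0"])
  show "((\<lambda>i. K * norm (\<xi> i)) \<longlongrightarrow> 0) UF"
    using tendsto_mult_right_zero[of "\<lambda>i. norm (\<xi> i)" UF K] assms(1) by (simp add: null_seq_def)
qed (use assms(2) in \<open>auto simp: always_eventually\<close>)

definition relN :: "(nat \<Rightarrow> fsym l2) \<Rightarrow> (nat \<Rightarrow> fsym l2) \<Rightarrow> bool" where
  "relN \<xi> \<eta> \<longleftrightarrow> \<xi> \<in> X0 \<and> \<eta> \<in> X0 \<and> null_seq (\<lambda>i. \<xi> i - \<eta> i)"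

text \<open>The Hilbert space \<open>L\<^sup>2\<close> of the ultrapower, on which the ultrapower acts by left multiplication.\<close>

quotient_type hN = "nat \<Rightarrow> fsym l2" / partial: relN morphisms rep_hN cls
proof (rule part_equivpI)
  show "\<exists>\<xi>. relN \<xi> \<xi>" by (rule exI[of _ "\<lambda>i. 0"]) (simp add: relN_def X0_zero null_seq_def)
  show "symp relN"
    by (rule sympI) (auto simp: relN_def null_seq_def norm_minus_commute)
  show "transp relN"
  proof (rule transpI)
    fix x y z assume "relN x y" "relN y z"
    then show "relN x z" using null_seq_add[of "\<lambda>i. x i - y i" "\<lambda>i. y i - z i"] by (simp add: relN_def)
  qed
qed

lemma cls_eq_iff: "\<xi> \<in> X0 \<Longrightarrow> \<eta> \<in> X0 \<Longrightarrow> cls \<xi> = cls \<eta> \<longleftrightarrow> null_seq (\<lambda>i. \<xi> i - \<eta> i)"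
  using Quotient3_rel[OF Quotient3_hN, of \<xi> \<eta>] by (auto simp: relN_def null_seq_def)

lemma rep_hN_X0: "rep_hN h \<in> X0"
  using Quotient3_rep_reflp[OF Quotient3_hN, of h] by (simp add: relN_def)

lemma cls_rep_hN [simp]: "cls (rep_hN h) = h"
  by (rule Quotient3_abs_rep[OF Quotient3_hN])

lemma cls_cases: obtains \<xi> where "\<xi> \<in> X0" "h = cls \<xi>"
  using rep_hN_X0[of h] cls_rep_hN[of h] by metis

lemma rep_cls: "\<xi> \<in> X0 \<Longrightarrow> null_seq (\<lambda>i. rep_hN (cls \<xi>) i - \<xi> i)"
  using cls_eq_iff[OF rep_hN_X0, of \<xi> "cls \<xi>"] by simp

lemma cls_map:
  assumes X: "\<And>\<xi>. \<xi> \<in> X0 \<Longrightarrow> (\<lambda>i. f i (\<xi> i)) \<in> X0" and K: "\<And>i v w. norm (f i v - f i w) \<le> K * norm (v - w)"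
    and \<xi>: "\<xi> \<in> X0"
  shows "cls (\<lambda>i. f i (rep_hN (cls \<xi>) i)) = cls (\<lambda>i. f i (\<xi> i))"
  using null_seq_bound[OF rep_cls[OF \<xi>] K] by (simp add: cls_eq_iff[OF X[OF rep_hN_X0] X[OF \<xi>]])

lemma null_seq_diff: "null_seq \<xi> \<Longrightarrow> null_seq \<eta> \<Longrightarrow> null_seq (\<lambda>i. \<xi> i - \<eta> i)"
  unfolding null_seq_def tendsto_norm_zero_iff using tendsto_diff[of \<xi> 0 UF \<eta> 0] by simp

instantiation hN :: real_vector
begin
definition "0 = cls (\<lambda>i. 0)"
definition "a + b = cls (\<lambda>i. rep_hN a i + rep_hN b i)"
definition "- a = cls (\<lambda>i. - rep_hN a i)"
definition "a - b = cls (\<lambda>i. rep_hN a i - rep_hN b i)"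
definition "r *\<^sub>R a = cls (\<lambda>i. r *\<^sub>R rep_hN a i)"

lemma cls_zero: "cls (\<lambda>i. 0) = 0"
  by (simp add: zero_hN_def)

lemma cls_add:
  assumes "\<xi> \<in> X0" "\<eta> \<in> X0" shows "cls \<xi> + cls \<eta> = cls (\<lambda>i. \<xi> i + \<eta> i)"
  using null_seq_add[OF rep_cls[OF assms(1)] rep_cls[OF assms(2)]] assms
  unfolding plus_hN_def by (simp add: cls_eq_iff X0_add rep_hN_X0 algebra_simps)

lemma cls_scaleR: "\<xi> \<in> X0 \<Longrightarrow> r *\<^sub>R cls \<xi> = cls (\<lambda>i. r *\<^sub>R \<xi> i)"
  unfolding scaleR_hN_def
  by (rule cls_map[where f = "\<lambda>i v. r *\<^sub>R v" and K = "\<bar>r\<bar>"]) (auto simp: X0_scaleR simp flip: scaleR_diff_right)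

lemma cls_minus: "\<xi> \<in> X0 \<Longrightarrow> - cls \<xi> = cls (\<lambda>i. - \<xi> i)"
  unfolding uminus_hN_def
  by (rule cls_map[where f = "\<lambda>i v. - v" and K = 1]) (auto simp: X0_minus norm_minus_commute)

lemma cls_diff:
  assumes "\<xi> \<in> X0" "\<eta> \<in> X0" shows "cls \<xi> - cls \<eta> = cls (\<lambda>i. \<xi> i - \<eta> i)"
  using null_seq_diff[OF rep_cls[OF assms(1)] rep_cls[OF assms(2)]] assms
  unfolding minus_hN_def by (simp add: cls_eq_iff X0_diff rep_hN_X0 algebra_simps)

instance
proof
  fix a b c :: hN and r s :: real
  obtain \<xi> where a: "\<xi> \<in> X0" "a = cls \<xi>" by (rule cls_cases)
  obtain \<eta> where b: "\<eta> \<in> X0" "b = cls \<eta>" by (rule cls_cases)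
  obtain \<zeta> where c: "\<zeta> \<in> X0" "c = cls \<zeta>" by (rule cls_cases)
  note [simp] = cls_add cls_scaleR cls_minus cls_diff X0_add X0_scaleR X0_minus X0_diff X0_zero
    cls_zero[symmetric]
  show "a + b + c = a + (b + c)" using a b c by (simp add: add.assoc)
  show "a + b = b + a" using a b by (simp add: add.commute)
  show "0 + a = a" using a by simp
  show "- a + a = 0" using a by simp
  show "a - b = a + - b" using a b by simp
  show "r *\<^sub>R (a + b) = r *\<^sub>R a + r *\<^sub>R b" using a b by (simp add: scaleR_add_right)
  show "(r + s) *\<^sub>R a = r *\<^sub>R a + s *\<^sub>R a" using a by (simp add: scaleR_add_left)
  show "r *\<^sub>R s *\<^sub>R a = (r * s) *\<^sub>R a" using a by simp
  show "1 *\<^sub>R a = a" using a by simp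
qed
end

lemma X0_inner_tendsto:
  assumes "\<xi> \<in> X0" "\<eta> \<in> X0"
  shows "((\<lambda>i. \<xi> i \<bullet> \<eta> i) \<longlongrightarrow> Lim UF (\<lambda>i. \<xi> i \<bullet> \<eta> i)) UF"
proof -
  obtain K where K: "\<forall>\<^sub>F i in UF. norm (\<xi> i) \<le> K" using X0_bounded[OF assms(1)] by blast
  obtain K' where K': "\<forall>\<^sub>F i in UF. norm (\<eta> i) \<le> K'" using X0_bounded[OF assms(2)] by blast
  have "\<forall>\<^sub>F i in UF. \<bar>\<xi> i \<bullet> \<eta> i\<bar> \<le> K * K'"
    using K K'
  proof eventually_elim
    case (elim i)
    then have "norm (\<xi> i) * norm (\<eta> i) \<le> K * K'" by (intro mult_mono) (auto intro: order_trans[OF norm_ge_zero])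
    then show ?case using Cauchy_Schwarz_ineq2[of "\<xi> i" "\<eta> i"] by simp
  qed
  then show ?thesis by (rule UF_tendsto_Lim)
qed

lemma null_seq_inner:
  assumes "null_seq \<xi>" "\<eta> \<in> X0" shows "((\<lambda>i. \<xi> i \<bullet> \<eta> i) \<longlongrightarrow> 0) UF"
proof -
  obtain K where K: "\<forall>\<^sub>F i in UF. norm (\<eta> i) \<le> K" using X0_bounded[OF assms(2)] by blast
  have "((\<lambda>i. norm (\<xi> i) * K) \<longlongrightarrow> 0) UF"
    using assms(1) unfolding null_seq_def by (rule tendsto_mult_left_zero)
  then show ?thesis
  proof (rule Lim_null_comparison[rotated])
    show "\<forall>\<^sub>F i in UF. norm (\<xi> i \<bullet> \<eta> i) \<le> norm (\<xi> i) * K"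
      using K
    proof eventually_elim
      case (elim i)
      have "norm (\<xi> i \<bullet> \<eta> i) \<le> norm (\<xi> i) * norm (\<eta> i)" using Cauchy_Schwarz_ineq2[of "\<xi> i" "\<eta> i"] by simp
      also have "\<dots> \<le> norm (\<xi> i) * K" using elim by (rule mult_left_mono) simp
      finally show ?case .
    qed
  qed
qed

instantiation hN :: real_inner
begin
definition inner_hN_def: "inner (a :: hN) b = Lim UF (\<lambda>i. rep_hN a i \<bullet> rep_hN b i)"
definition norm_hN_def: "norm (x :: hN) = sqrt (inner x x)"
definition dist_hN_def: "dist (x :: hN) y = norm (x - y)"
definition sgn_hN_def: "sgn (x :: hN) = inverse (norm x) *\<^sub>R x"
definition uniformity_hN_def: "uniformity = (INF e\<in>{0 <..}. principal {(x::hN, y). dist x y < e})"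
definition open_hN_def: "open (U :: hN set) = (\<forall>x\<in>U. eventually (\<lambda>(x', y). x' = x \<longrightarrow> y \<in> U) uniformity)"

lemma inner_cls_tendsto:
  assumes "\<xi> \<in> X0" "\<eta> \<in> X0"
  shows "((\<lambda>i. \<xi> i \<bullet> \<eta> i) \<longlongrightarrow> inner (cls \<xi>) (cls \<eta>)) UF"
proof -
  let ?r = "rep_hN (cls \<xi>)" and ?s = "rep_hN (cls \<eta>)"
  have "((\<lambda>i. ?r i \<bullet> ?s i - (?r i - \<xi> i) \<bullet> ?s i - (?s i - \<eta> i) \<bullet> \<xi> i) \<longlongrightarrow> inner (cls \<xi>) (cls \<eta>) - 0 - 0) UF"
    unfolding inner_hN_def
    by (intro tendsto_diff X0_inner_tendsto rep_hN_X0 null_seq_inner rep_cls assms)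
  then show ?thesis by (simp add: inner_diff_left inner_diff_right inner_commute[of "?s _"] inner_commute[of "\<eta> _"])
qed

instance
proof
  fix x y z :: hN and r :: real
  obtain \<xi> where x: "\<xi> \<in> X0" "x = cls \<xi>" by (rule cls_cases)
  obtain \<eta> where y: "\<eta> \<in> X0" "y = cls \<eta>" by (rule cls_cases)
  obtain \<zeta> where z: "\<zeta> \<in> X0" "z = cls \<zeta>" by (rule cls_cases)
  note uniq = tendsto_unique[OF UF(1)]
  show "inner x y = inner y x" by (simp add: inner_hN_def inner_commute)
  show "inner (x + y) z = inner x z + inner y z"
    using uniq[OF inner_cls_tendsto[OF X0_add[OF x(1) y(1)] z(1)]
      tendsto_add[OF inner_cls_tendsto[OF x(1) z(1)] inner_cls_tendsto[OF y(1) z(1)], folded inner_add_left]]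
    by (simp add: x y z cls_add)
  show "inner (r *\<^sub>R x) y = r * inner x y"
    using uniq[OF inner_cls_tendsto[OF X0_scaleR[OF x(1)] y(1)]
      tendsto_mult[OF tendsto_const inner_cls_tendsto[OF x(1) y(1)], of r, folded inner_scaleR_left]]
    by (simp add: x y cls_scaleR)
  show "0 \<le> inner x x"
    unfolding x(2) by (rule tendsto_lowerbound[OF inner_cls_tendsto[OF x(1) x(1)] _ UF(1)]) simp
  show "inner x x = 0 \<longleftrightarrow> x = 0"
  proof
    assume "inner x x = 0"
    then have "((\<lambda>i. \<xi> i \<bullet> \<xi> i) \<longlongrightarrow> 0) UF" using inner_cls_tendsto[OF x(1) x(1)] x(2) by simp
    then have "((\<lambda>i. sqrt (\<xi> i \<bullet> \<xi> i)) \<longlongrightarrow> sqrt 0) UF" by (rule tendsto_real_sqrt)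
    then have "null_seq (\<lambda>i. \<xi> i - 0)" by (simp add: null_seq_def norm_eq_sqrt_inner)
    then have "cls \<xi> = cls (\<lambda>i. 0)" using cls_eq_iff[OF x(1) X0_zero] by simp
    then show "x = 0" by (simp add: x cls_zero)
  next
    assume "x = 0"
    then have x0: "x = cls (\<lambda>i. 0)" by (simp add: cls_zero)
    show "inner x x = 0" unfolding x0
      by (rule uniq[OF inner_cls_tendsto[OF X0_zero X0_zero]]) simp
  qed
qed (rule norm_hN_def dist_hN_def sgn_hN_def uniformity_hN_def open_hN_def)+
end

lemma norm_cls_tendsto: "\<xi> \<in> X0 \<Longrightarrow> ((\<lambda>i. norm (\<xi> i)) \<longlongrightarrow> norm (cls \<xi>)) UF"
  unfolding norm_eq_sqrt_inner by (intro tendsto_real_sqrt inner_cls_tendsto)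

lemma norm_cls_le: "\<xi> \<in> X0 \<Longrightarrow> \<forall>\<^sub>F i in UF. norm (\<xi> i) \<le> K \<Longrightarrow> norm (cls \<xi>) \<le> K"
  by (rule tendsto_upperbound[OF norm_cls_tendsto _ UF(1)])

lemma norm_cls_less: "\<xi> \<in> X0 \<Longrightarrow> norm (cls \<xi>) < K \<Longrightarrow> \<forall>\<^sub>F i in UF. norm (\<xi> i) < K"
  using order_tendstoD(2)[OF norm_cls_tendsto] by blast

text \<open>That the representative of the limit is made of entries of the given representatives matters:
  besides completeness it yields that bounds on the entries are inherited by the limit.\<close>

lemma fast_limit:
  assumes x: "\<And>p. x p \<in> X0" and fast: "\<And>p. norm (cls (x p) - cls (x (Suc p))) < (1/2)^p"
  shows "\<exists>m::nat \<Rightarrow> nat. (\<lambda>i. x (m i) i) \<in> X0 \<and> (\<lambda>p. cls (x p)) \<longlonglongrightarrow> cls (\<lambda>i. x (m i) i)"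
proof -
  have "\<forall>\<^sub>F i in UF. norm (x p i - x (Suc p) i) < (1/2)^p" for p
    using norm_cls_less[OF X0_diff[OF x x]] fast[of p] by (simp add: cls_diff x)
  then obtain m :: "nat \<Rightarrow> nat" where m: "\<And>p. \<forall>\<^sub>F i in UF. norm (x p i - x (m i) i) \<le> 2 * (1/2)^p"
    using UF_diagonal[of x] by blast
  have pow: "(\<lambda>p. 2 * (1/2::real)^p) \<longlonglongrightarrow> 0"
    using tendsto_mult_right_zero[OF LIMSEQ_realpow_zero[of "1/2::real"], of 2] by simp
  have X: "(\<lambda>i. x (m i) i) \<in> X0"
    unfolding X0_def
  proof (intro CollectI allI impI)
    fix e :: real assume e: "e > 0"
    have "\<forall>\<^sub>F p in sequentially. 2 * (1/2::real)^p < e / 2"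
      using order_tendstoD(2)[OF pow, of "e/2"] e by simp
    then obtain p where p: "2 * (1/2::real)^p < e / 2" using eventually_happens' sequentially_bot by blast
    obtain y where y: "y \<in> linf" "\<forall>\<^sub>F i in UF. norm (x p i - y i e0) < e / 2" using X0D[OF x, of "e/2" p] e by auto
    have "\<forall>\<^sub>F i in UF. norm (x (m i) i - y i e0) < e"
      using m[of p] y(2)
    proof eventually_elim
      case (elim i)
      have "norm (x (m i) i - y i e0) \<le> norm (x p i - x (m i) i) + norm (x p i - y i e0)"
        using norm_triangle_ineq4[of "x p i - y i e0" "x p i - x (m i) i"] by simp
      then show ?case using elim p by simp
    qed
    then show "\<exists>y\<in>linf. \<forall>\<^sub>F i in UF. norm (x (m i) i - y i e0) < e" using y(1) by blast
  qed
  have "norm (cls (x p) - cls (\<lambda>i. x (m i) i)) \<le> 2 * (1/2)^p" for p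
    unfolding cls_diff[OF x X] by (rule norm_cls_le[OF X0_diff[OF x X] m])
  then have "(\<lambda>p. cls (x p) - cls (\<lambda>i. x (m i) i)) \<longlonglongrightarrow> 0"
    by (intro Lim_null_comparison[OF _ pow]) (simp add: always_eventually)
  then have "(\<lambda>p. cls (x p)) \<longlonglongrightarrow> cls (\<lambda>i. x (m i) i)" by (simp add: LIM_zero_iff)
  then show ?thesis using X by blast
qed

lemma ex_fast_subseq:
  fixes X :: "nat \<Rightarrow> 'a::real_normed_vector"
  assumes X: "Cauchy X"
  shows "\<exists>r. strict_mono r \<and> (\<forall>p. norm (X (r p) - X (r (Suc p))) < (1/2)^p)"
proof -
  have "\<exists>M. \<forall>m\<ge>M. \<forall>n\<ge>M. norm (X m - X n) < (1/2)^p" for p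
    using CauchyD[OF X, of "(1/2)^p"] by simp
  then have "\<exists>M. \<forall>p. \<forall>m\<ge>M p. \<forall>n\<ge>M p. norm (X m - X n) < (1/2)^p" by (intro choice allI)
  then obtain M where M: "\<And>p m n. m \<ge> M p \<Longrightarrow> n \<ge> M p \<Longrightarrow> norm (X m - X n) < (1/2)^p" by blast
  define r where "r p = (\<Sum>k\<le>p. M k) + p" for p :: nat
  have mono: "strict_mono r" unfolding strict_mono_Suc_iff by (simp add: r_def)
  have "M p \<le> r p" for p
    using member_le_sum[of p "{..p}" M] by (simp add: r_def)
  then have "norm (X (r p) - X (r (Suc p))) < (1/2)^p" for p
    by (meson M order_trans less_imp_le lessI mono strict_mono_less)
  with mono show ?thesis by blast
qed

instance hN :: complete_space
proof
  fix X :: "nat \<Rightarrow> hN" assume X: "Cauchy X"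
  obtain r where r: "strict_mono r" "\<And>p. norm (X (r p) - X (r (Suc p))) < (1/2)^p"
    using ex_fast_subseq[OF X] by blast
  obtain m :: "nat \<Rightarrow> nat" where "(\<lambda>p. cls (rep_hN (X (r p)))) \<longlonglongrightarrow> cls (\<lambda>i. rep_hN (X (r (m i))) i)"
    using fast_limit[of "\<lambda>p. rep_hN (X (r p))"] r(2) by (auto simp: rep_hN_X0)
  then have "(X \<circ> r) \<longlonglongrightarrow> cls (\<lambda>i. rep_hN (X (r (m i))) i)" by (simp add: o_def)
  from Cauchy_converges_subseq[OF X r(1) this] show "convergent X" by (rule convergentI)
qed

instantiation hN :: chilbert
begin
definition "im a = cls (\<lambda>i. im (rep_hN a i))"

lemma cls_im: "\<xi> \<in> X0 \<Longrightarrow> im (cls \<xi>) = cls (\<lambda>i. im (\<xi> i))"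
  unfolding im_hN_def
  by (rule cls_map[where f = "\<lambda>i v. im v" and K = 1]) (auto simp: X0_im simp flip: im_diff)

instance
proof
  fix x y :: hN and r :: real
  obtain \<xi> where x: "\<xi> \<in> X0" "x = cls \<xi>" by (rule cls_cases)
  obtain \<eta> where y: "\<eta> \<in> X0" "y = cls \<eta>" by (rule cls_cases)
  show "im (x + y) = im x + im y" using x y by (simp add: cls_add cls_im X0_add X0_im im_add)
  show "im (r *\<^sub>R x) = r *\<^sub>R im x" using x by (simp add: cls_scaleR cls_im X0_scaleR X0_im im_scaleR)
  show "im (im x) = - x" using x by (simp add: cls_im X0_im cls_minus)
  show "inner (im x) (im y) = inner x y"
    using tendsto_unique[OF UF(1) inner_cls_tendsto[OF X0_im[OF x(1)] X0_im[OF y(1)], simplified] inner_cls_tendsto[OF x(1) y(1)]]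
    by (simp add: x y cls_im)
qed
end

lemma cls_scaleC: "\<xi> \<in> X0 \<Longrightarrow> scaleC c (cls \<xi>) = cls (\<lambda>i. scaleC c (\<xi> i))"
  by (simp add: scaleC_def cls_im cls_scaleR cls_add X0_im X0_scaleR)

section \<open>The ultrapower acting on its Hilbert space\<close>

definition Lam :: "(nat \<Rightarrow> fsym l2 \<Rightarrow> fsym l2) \<Rightarrow> hN \<Rightarrow> hN" where
  "Lam y h = cls (\<lambda>i. y i (rep_hN h i))"

definition JN :: "hN \<Rightarrow> hN" where "JN h = cls (\<lambda>i. J0 (rep_hN h i))"

definition OmN :: hN where "OmN = cls (\<lambda>i. e0)"

lemma e0_X0: "(\<lambda>i. e0) \<in> X0"
  using X0_linf[OF linf_const[OF R.N_id]] .

lemma Lam_cls: assumes y: "y \<in> linf" and \<xi>: "\<xi> \<in> X0" shows "Lam y (cls \<xi>) = cls (\<lambda>i. y i (\<xi> i))"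
proof -
  obtain K where K: "\<forall>i v. norm (y i v) \<le> K * norm v" using linf_bound[OF y] by blast
  show ?thesis unfolding Lam_def
  proof (rule cls_map[where f = y and K = K, OF _ _ \<xi>])
    show "norm (y i v - y i w) \<le> K * norm (v - w)" for i v w
      using K[rule_format, of i "v - w"] linear_diff[OF clin_linear[OF linf_clin[OF y, of i]], of v w] by simp
  qed (rule X0_op[OF _ y])
qed

lemma JN_cls: assumes \<xi>: "\<xi> \<in> X0" shows "JN (cls \<xi>) = cls (\<lambda>i. J0 (\<xi> i))"
  unfolding JN_def
proof (rule cls_map[where f = "\<lambda>i. J0" and K = 1, OF _ _ \<xi>])
  show "norm (J0 v - J0 w) \<le> 1 * norm (v - w)" for v w and i :: nat
    using linear_diff[OF R.J_lin, of v w] R.norm_J[of "v - w"] by simp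
qed (rule X0_J)

lemma Lam_OmN: "y \<in> linf \<Longrightarrow> Lam y OmN = cls (\<lambda>i. y i e0)"
  unfolding OmN_def by (rule Lam_cls[OF _ e0_X0])

lemma Lam_bound:
  assumes y: "y \<in> linf" and K: "\<And>i v. norm (y i v) \<le> K * norm v"
  shows "norm (Lam y h) \<le> K * norm h"
proof -
  obtain \<xi> where h: "\<xi> \<in> X0" "h = cls \<xi>" by (rule cls_cases)
  have "((\<lambda>i. norm (y i (\<xi> i))) \<longlongrightarrow> norm (Lam y h)) UF"
    using norm_cls_tendsto[OF X0_op[OF h(1) y]] by (simp add: h Lam_cls y)
  moreover have "((\<lambda>i. K * norm (\<xi> i)) \<longlongrightarrow> K * norm h) UF"
    using norm_cls_tendsto[OF h(1)] unfolding h(2) by (rule tendsto_mult_left)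
  ultimately show ?thesis
    using tendsto_le[OF UF(1), of "\<lambda>i. K * norm (\<xi> i)" "K * norm h" "\<lambda>i. norm (y i (\<xi> i))"]
    by (simp add: K always_eventually)
qed

lemma Lam_clin: assumes y: "y \<in> linf" shows "clin (Lam y)"
proof -
  obtain K where K: "\<forall>i v. norm (y i v) \<le> K * norm v" using linf_bound[OF y] by blast
  note yl = clin_linear[OF linf_clin[OF y]]
  have "bounded_linear (Lam y)"
  proof (rule bounded_linear_intro[of _ K])
    fix a b r
    obtain \<xi> where a: "\<xi> \<in> X0" "a = cls \<xi>" by (rule cls_cases)
    obtain \<eta> where b: "\<eta> \<in> X0" "b = cls \<eta>" by (rule cls_cases)
    show "Lam y (a + b) = Lam y a + Lam y b"
      using a b y by (simp add: cls_add Lam_cls X0_add X0_op linear_add[OF yl])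
    show "Lam y (r *\<^sub>R a) = r *\<^sub>R Lam y a"
      using a y by (simp add: cls_scaleR Lam_cls X0_scaleR X0_op linear_scale[OF yl])
    show "norm (Lam y a) \<le> norm a * K"
      using Lam_bound[OF y, of K a] K by (simp add: mult.commute)
  qed
  moreover have "Lam y (im a) = im (Lam y a)" for a
  proof -
    obtain \<xi> where a: "\<xi> \<in> X0" "a = cls \<xi>" by (rule cls_cases)
    then show ?thesis using y by (simp add: cls_im Lam_cls X0_im X0_op clinD(2)[OF linf_clin[OF y]])
  qed
  ultimately show ?thesis by (simp add: clin_def)
qed

lemma Lam_comp: assumes "y \<in> linf" "z \<in> linf" shows "Lam (\<lambda>i v. y i (z i v)) h = Lam y (Lam z h)"
proof -
  obtain \<xi> where "\<xi> \<in> X0" "h = cls \<xi>" by (rule cls_cases)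
  then show ?thesis using assms by (simp add: Lam_cls linf_comp X0_op)
qed

lemma Lam_add: assumes "y \<in> linf" "z \<in> linf" shows "Lam (\<lambda>i v. y i v + z i v) h = Lam y h + Lam z h"
proof -
  obtain \<xi> where "\<xi> \<in> X0" "h = cls \<xi>" by (rule cls_cases)
  then show ?thesis using assms by (simp add: Lam_cls linf_add X0_op cls_add)
qed

lemma Lam_scaleC: assumes "y \<in> linf" shows "Lam (\<lambda>i v. scaleC c (y i v)) h = scaleC c (Lam y h)"
proof -
  obtain \<xi> where "\<xi> \<in> X0" "h = cls \<xi>" by (rule cls_cases)
  then show ?thesis using assms by (simp add: Lam_cls linf_scaleC X0_op cls_scaleC)
qed

lemma Lam_id: "Lam (\<lambda>i v. v) h = h"
  by (simp add: Lam_def)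

lemma Lam_adj: assumes y: "y \<in> linf" shows "adj (Lam y) = Lam (\<lambda>i. adj (y i))"
proof (rule adj_unique)
  fix a b
  obtain \<xi> where a: "\<xi> \<in> X0" "a = cls \<xi>" by (rule cls_cases)
  obtain \<eta> where b: "\<eta> \<in> X0" "b = cls \<eta>" by (rule cls_cases)
  have "((\<lambda>i. y i (\<xi> i) \<bullet> \<eta> i) \<longlongrightarrow> Lam y a \<bullet> b) UF"
    using inner_cls_tendsto[OF X0_op[OF a(1) y] b(1)] by (simp add: a b y Lam_cls)
  moreover have "((\<lambda>i. \<xi> i \<bullet> adj (y i) (\<eta> i)) \<longlongrightarrow> a \<bullet> Lam (\<lambda>i. adj (y i)) b) UF"
    using inner_cls_tendsto[OF a(1) X0_op[OF b(1) linf_adj[OF y]]] by (simp add: a b linf_adj[OF y] Lam_cls)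
  moreover have "(\<lambda>i. y i (\<xi> i) \<bullet> \<eta> i) = (\<lambda>i. \<xi> i \<bullet> adj (y i) (\<eta> i))"
    by (simp add: adj_inner clinD linf_clin[OF y])
  ultimately show "Lam y a \<bullet> b = a \<bullet> Lam (\<lambda>i. adj (y i)) b"
    using tendsto_unique[OF UF(1)] by metis
qed

lemma Lam_dense: assumes "e > 0" shows "\<exists>y\<in>linf. norm (h - Lam y OmN) < e"
proof -
  obtain \<xi> where h: "\<xi> \<in> X0" "h = cls \<xi>" by (rule cls_cases)
  obtain y where y: "y \<in> linf" "\<forall>\<^sub>F i in UF. norm (\<xi> i - y i e0) < e/2" using X0D[OF h(1), of "e/2"] assms by auto
  have "norm (h - Lam y OmN) = norm (cls (\<lambda>i. \<xi> i - y i e0))"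
    using y by (simp add: h Lam_OmN cls_diff X0_linf)
  also have "\<dots> \<le> e/2"
    by (rule norm_cls_le[OF X0_diff[OF h(1) X0_linf[OF y(1)]]]) (rule eventually_mono[OF y(2)], simp)
  finally show ?thesis using assms y(1) by (intro bexI[of _ y]) auto
qed

global_interpretation NN: tracial_rep "Lam ` linf" JN OmN
proof (rule tracial_rep.intro)
  show inner: "JN a \<bullet> JN b = a \<bullet> b" for a b
  proof -
    obtain \<xi> where a: "\<xi> \<in> X0" "a = cls \<xi>" by (rule cls_cases)
    obtain \<eta> where b: "\<eta> \<in> X0" "b = cls \<eta>" by (rule cls_cases)
    show ?thesis
      using tendsto_unique[OF UF(1) inner_cls_tendsto[OF X0_J[OF a(1)] X0_J[OF b(1)], unfolded R.J_inner] inner_cls_tendsto[OF a(1) b(1)]]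
      by (simp add: a b JN_cls)
  qed
  show "bounded_linear JN"
  proof (rule isometry_bounded_linear[OF _ _ inner])
    fix a b r
    obtain \<xi> where a: "\<xi> \<in> X0" "a = cls \<xi>" by (rule cls_cases)
    obtain \<eta> where b: "\<eta> \<in> X0" "b = cls \<eta>" by (rule cls_cases)
    show "JN (a + b) = JN a + JN b"
      using a b by (simp add: cls_add JN_cls X0_add X0_J linear_add[OF R.J_lin])
    show "JN (r *\<^sub>R a) = r *\<^sub>R JN a"
      using a by (simp add: cls_scaleR JN_cls X0_scaleR X0_J linear_scale[OF R.J_lin])
  qed
  fix a
  obtain \<xi> where a: "\<xi> \<in> X0" "a = cls \<xi>" by (rule cls_cases)
  show "JN (im a) = - im (JN a)"
    using a by (simp add: cls_im JN_cls X0_im X0_J R.J_im cls_minus)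
  show "JN (JN a) = a" using a by (simp add: JN_cls X0_J)
next
  show "JN OmN = OmN" unfolding OmN_def by (simp add: JN_cls e0_X0)
  show "OmN \<bullet> OmN = 1" unfolding OmN_def
    using tendsto_unique[OF UF(1) inner_cls_tendsto[OF e0_X0 e0_X0]] by (simp add: point_inner)
next
  fix T assume "T \<in> Lam ` linf"
  then obtain y where T: "T = Lam y" "y \<in> linf" by blast
  show "clin T" unfolding T(1) by (rule Lam_clin[OF T(2)])
  show "adj T \<in> Lam ` linf" unfolding T(1) Lam_adj[OF T(2)] using linf_adj[OF T(2)] by blast
  show "JN (T OmN) = adj T OmN"
    unfolding T(1) Lam_adj[OF T(2)] using T(2) linf_adj[OF T(2)]
    by (simp add: Lam_OmN JN_cls X0_linf linf_N R.N_adj_Om)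
next
  fix v :: hN assume v: "\<And>x. x \<in> Lam ` linf \<Longrightarrow> v \<bullet> x OmN = 0"
  have "norm v \<le> e" if e: "e > 0" for e
  proof -
    obtain y where y: "y \<in> linf" "norm (v - Lam y OmN) < e" using Lam_dense[OF e] by blast
    have "norm v * norm v = v \<bullet> (v - Lam y OmN)" using v y(1) by (simp add: norm_mult_self inner_diff_right)
    also have "\<dots> \<le> norm v * norm (v - Lam y OmN)" by (rule norm_cauchy_schwarz)
    also have "\<dots> \<le> norm v * e" using y(2) by (intro mult_left_mono) auto
    finally show ?thesis using e by (cases "v = 0") (auto dest: mult_left_le_imp_le)
  qed
  then have "norm v \<le> 0 + e" if "e > 0" for e using that by simp
  then have "norm v \<le> 0" by (rule field_le_epsilon)
  then show "v = 0" by simp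
next
  fix S T v assume "S \<in> Lam ` linf" "T \<in> Lam ` linf"
  then obtain y z where S: "S = Lam y" "y \<in> linf" and T: "T = Lam z" "z \<in> linf" by blast
  obtain \<xi> where v: "\<xi> \<in> X0" "v = cls \<xi>" by (rule cls_cases)
  show "S (JN (T (JN v))) = JN (T (JN (S v)))"
    unfolding S(1) T(1) v(2)
    using S(2) T(2) v(1) X0_J[OF v(1)] X0_op[OF X0_J[OF v(1)] T(2)] X0_J[OF X0_op[OF X0_J[OF v(1)] T(2)]]
      X0_op[OF v(1) S(2)] X0_J[OF X0_op[OF v(1) S(2)]] X0_op[OF X0_J[OF X0_op[OF v(1) S(2)]] T(2)]
    by (simp add: Lam_cls JN_cls R.N_comm_J_N_J linf_N)
qed

section \<open>The ultrapower is a von Neumann algebra\<close>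

text \<open>The operator \<open>(1 + a\<^sup>2)\<^sup>-\<^sup>1\<close>, and \<open>2 a (1 + a\<^sup>2)\<^sup>-\<^sup>1\<close>, the imaginary part of the Cayley transform
  \<open>(1 + i a) (1 - i a)\<^sup>-\<^sup>1\<close>.  The latter is a contraction however large \<open>a\<close> is.\<close>

definition inv_one_plus_sq :: "('a::chilbert \<Rightarrow> 'a) \<Rightarrow> 'a \<Rightarrow> 'a" where
  "inv_one_plus_sq a = inv_into UNIV (\<lambda>w. w + a (a w))"

definition cayley_im :: "('a::chilbert \<Rightarrow> 'a) \<Rightarrow> 'a \<Rightarrow> 'a" where
  "cayley_im a v = 2 *\<^sub>R a (inv_one_plus_sq a v)"

context
  fixes a :: "'a::chilbert \<Rightarrow> 'a"
  assumes a: "clin a" and sym: "\<And>x y. a x \<bullet> y = x \<bullet> a y"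
begin

lemma inv_one_plus_sq_coercive: "x \<bullet> x \<le> (x + a (a x)) \<bullet> x"
  using inner_ge_zero[of "a x"] by (simp add: inner_add_left sym)

lemma inv_one_plus_sq_bl: "bounded_linear (\<lambda>w. w + a (a w))"
  using clinD(1)[OF clin_add[OF clin_id clin_comp[OF a a]]] .

lemma inv_one_plus_sq_bij: "bij (\<lambda>w. w + a (a w))" and inv_one_plus_sq_bounded_linear: "bounded_linear (inv_one_plus_sq a)"
  and inv_one_plus_sq_norm: "norm (inv_one_plus_sq a x) \<le> norm x"
  unfolding inv_one_plus_sq_def by (rule coercive_bij[OF inv_one_plus_sq_bl inv_one_plus_sq_coercive])+

lemma inv_one_plus_sq_right: "inv_one_plus_sq a v + a (a (inv_one_plus_sq a v)) = v"
  using surj_f_inv_f[OF bij_is_surj[OF inv_one_plus_sq_bij], of v] by (simp add: inv_one_plus_sq_def)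

lemma inv_one_plus_sq_left: "inv_one_plus_sq a (v + a (a v)) = v"
  using inv_f_f[OF bij_is_inj[OF inv_one_plus_sq_bij], of v] by (simp add: inv_one_plus_sq_def)

lemma inv_one_plus_sq_commute:
  assumes "linear b" "\<And>v. b (a v) = a (b v)" shows "b (inv_one_plus_sq a v) = inv_one_plus_sq a (b v)"
proof -
  have "inv_one_plus_sq a (b (inv_one_plus_sq a v + a (a (inv_one_plus_sq a v)))) = b (inv_one_plus_sq a v)"
    using assms inv_one_plus_sq_left[of "b (inv_one_plus_sq a v)"] by (simp add: linear_add)
  then show ?thesis by (simp add: inv_one_plus_sq_right)
qed

lemma inv_one_plus_sq_clin: "clin (inv_one_plus_sq a)"
  using inv_one_plus_sq_bounded_linear inv_one_plus_sq_commute[OF linear_im] a by (simp add: clin_def)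

lemma norm_a_inv_one_plus_sq: "norm (a (inv_one_plus_sq a v)) \<le> 1/2 * norm v"
proof -
  define w where "w = inv_one_plus_sq a v"
  have v: "v = w + a (a w)" by (simp add: w_def inv_one_plus_sq_right)
  define r where "r = a (a w)"
  have e: "r \<bullet> w = a w \<bullet> a w" "w \<bullet> r = a w \<bullet> a w"
    unfolding r_def by (rule sym) (rule sym[symmetric])
  have "(norm v)\<^sup>2 - (2 * norm (a w))\<^sup>2 = (norm (w - r))\<^sup>2"
    unfolding v r_def[symmetric] power_mult_distrib power2_norm_eq_inner
    by (simp add: inner_add_left inner_add_right inner_diff_left inner_diff_right e)
  then have "(2 * norm (a w))\<^sup>2 \<le> (norm v)\<^sup>2" using zero_le_power2[of "norm (w - r)"] by linarith
  then have "2 * norm (a w) \<le> norm v" by (rule power2_le_imp_le) simp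
  then show ?thesis by (simp add: w_def)
qed

lemma norm_cayley_im: "norm (cayley_im a v) \<le> norm v"
  using norm_a_inv_one_plus_sq[of v] by (simp add: cayley_im_def)

lemma cayley_im_inverse: "a v = (1/2) *\<^sub>R cayley_im a (v + a (a v))"
  by (simp add: cayley_im_def inv_one_plus_sq_left)

lemma cayley_im_commute:
  assumes "linear b" "\<And>v. b (a v) = a (b v)" shows "b (cayley_im a v) = cayley_im a (b v)"
  using assms inv_one_plus_sq_commute[OF assms] by (simp add: cayley_im_def linear_scale)

lemma cayley_im_clin: "clin (cayley_im a)"
  using clin_scaleC_op[OF clin_comp[OF a inv_one_plus_sq_clin], of 2]
  unfolding cayley_im_def[abs_def] by (metis (no_types, lifting) ext of_real_numeral scaleC_of_real)

end

context tracial_rep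
begin

lemma N_inv_one_plus_sq: assumes a: "a \<in> N" "\<And>x y. a x \<bullet> y = x \<bullet> a y" shows "inv_one_plus_sq a \<in> N"
  unfolding N_def
proof (intro CollectI conjI ballI allI)
  show "clin (inv_one_plus_sq a)" by (rule inv_one_plus_sq_clin[OF N_clin[OF a(1)] a(2)])
  fix x v assume "x \<in> L"
  then show "J (x (J (inv_one_plus_sq a v))) = inv_one_plus_sq a (J (x (J v)))"
    using inv_one_plus_sq_commute[OF N_clin[OF a(1)] a(2) R_linear[of x], of v] a(1) by (simp add: N_def)
qed

lemma N_cayley_im: assumes a: "a \<in> N" "\<And>x y. a x \<bullet> y = x \<bullet> a y" shows "cayley_im a \<in> N"
  using N_scaleR[OF N_comp[OF a(1) N_inv_one_plus_sq[OF a]], of 2] by (simp add: cayley_im_def[abs_def])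

text \<open>As in Kaplansky's density theorem: the difference equals
  \<open>2 (1 + Z\<^sup>2)\<^sup>-\<^sup>1 ((Z - T) - Z (Z - T) T) (1 + T\<^sup>2)\<^sup>-\<^sup>1\<close>, in which \<open>Z\<close> occurs only in operators of norm at most 1, so
  the constant does not depend on \<open>Z\<close>.\<close>

lemma cayley_im_lipschitz:
  assumes Z: "Z \<in> N" "\<And>x y. Z x \<bullet> y = x \<bullet> Z y" and T: "T \<in> N" "\<And>x y. T x \<bullet> y = x \<bullet> T y"
    and T1: "\<And>v. norm (T v) \<le> norm v"
  shows "norm (cayley_im Z Om - cayley_im T Om) \<le> 3 * norm (Z Om - T Om)"
proof -
  note lZ = clin_linear[OF N_clin[OF Z(1)]] and lT = clin_linear[OF N_clin[OF T(1)]]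
  note qZ = inv_one_plus_sq_right[OF N_clin[OF Z(1)] Z(2)] inv_one_plus_sq_left[OF N_clin[OF Z(1)] Z(2)]
    and qT = inv_one_plus_sq_right[OF N_clin[OF T(1)] T(2)]
  note lq = clin_linear[OF inv_one_plus_sq_clin[OF N_clin[OF Z(1)] Z(2)]]
  have cZ: "inv_one_plus_sq Z (Z v) = Z (inv_one_plus_sq Z v)" for v
    using inv_one_plus_sq_commute[OF N_clin[OF Z(1)] Z(2) lZ] by simp
  define u where "u = inv_one_plus_sq T Om"
  have Om: "Om = u + T (T u)" by (simp add: u_def qT)
  have 1: "cayley_im Z Om = 2 *\<^sub>R inv_one_plus_sq Z (Z (u + T (T u)))" using Om by (simp add: cayley_im_def cZ)
  have 2: "cayley_im T Om = 2 *\<^sub>R inv_one_plus_sq Z (T u + Z (Z (T u)))" by (simp add: cayley_im_def u_def qZ)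
  have "cayley_im Z Om - cayley_im T Om = 2 *\<^sub>R inv_one_plus_sq Z ((Z u - T u) - Z (Z (T u) - T (T u)))"
    unfolding 1 2 scaleR_diff_right[symmetric] linear_diff[OF lq, symmetric]
    by (simp add: linear_add[OF lZ] linear_diff[OF lZ] algebra_simps)
  also have "\<dots> = 2 *\<^sub>R inv_one_plus_sq Z (Z u - T u) - 2 *\<^sub>R Z (inv_one_plus_sq Z (Z (T u) - T (T u)))"
    by (simp add: linear_diff[OF lq] cZ scaleR_diff_right)
  finally have "norm (cayley_im Z Om - cayley_im T Om) \<le> norm (2 *\<^sub>R inv_one_plus_sq Z (Z u - T u)) + norm (2 *\<^sub>R Z (inv_one_plus_sq Z (Z (T u) - T (T u))))"
    using norm_triangle_ineq4 by metis
  also have "\<dots> \<le> 2 * norm (Z u - T u) + norm (Z (T u) - T (T u))"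
    using inv_one_plus_sq_norm[OF N_clin[OF Z(1)] Z(2), of "Z u - T u"]
      norm_a_inv_one_plus_sq[OF N_clin[OF Z(1)] Z(2), of "Z (T u) - T (T u)"] by simp
  also have "norm (Z u - T u) \<le> 1 * norm (Z Om - T Om)"
    unfolding u_def using norm2_mult_right[OF N_diff[OF Z(1) T(1)] N_inv_one_plus_sq[OF T], of 1]
      inv_one_plus_sq_norm[OF N_clin[OF T(1)] T(2)] by simp
  also have "norm (Z (T u) - T (T u)) \<le> 1 * norm (Z Om - T Om)"
  proof -
    have "norm (T (inv_one_plus_sq T v)) \<le> 1 * norm v" for v
      using order_trans[OF T1 inv_one_plus_sq_norm[OF N_clin[OF T(1)] T(2)]] by simp
    from norm2_mult_right[OF N_diff[OF Z(1) T(1)] N_comp[OF T(1) N_inv_one_plus_sq[OF T]] this]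
    show ?thesis by (simp add: u_def)
  qed
  finally show ?thesis by simp
qed

end

lemma Lam_in_N: "y \<in> linf \<Longrightarrow> Lam y \<in> NN.N"
  using NN.L_subset_N by blast

lemma Lam_symmetric:
  assumes "z \<in> linf" "\<And>i. adj (z i) = z i" shows "Lam z x \<bullet> y = x \<bullet> Lam z y"
  using symmetric_iff_adj[OF Lam_clin[OF assms(1)]] Lam_adj[OF assms(1)] assms(2) by auto

lemma Lam_cayley_im:
  assumes z: "z \<in> linf" "\<And>i. adj (z i) = z i"
  shows "(\<lambda>i. cayley_im (z i)) \<in> linf" "cayley_im (Lam z) = Lam (\<lambda>i. cayley_im (z i))"
proof -
  have s: "z i x \<bullet> y = x \<bullet> z i y" for i x y
    using symmetric_iff_adj[OF linf_clin[OF z(1)]] z(2) by blast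
  note c = linf_clin[OF z(1)]
  have q: "(\<lambda>i. inv_one_plus_sq (z i)) \<in> linf"
    by (rule linfI[where K = 1, OF R.N_inv_one_plus_sq[OF linf_N[OF z(1)] s]]) (simp add: inv_one_plus_sq_norm[OF c s])
  show "(\<lambda>i. cayley_im (z i)) \<in> linf"
    by (rule linfI[where K = 1, OF R.N_cayley_im[OF linf_N[OF z(1)] s]]) (simp add: norm_cayley_im[OF c s])
  have S: "Lam z x \<bullet> y = x \<bullet> Lam z y" for x y by (rule Lam_symmetric[OF z])
  note C = Lam_clin[OF z(1)]
  have "inv_one_plus_sq (Lam z) h = Lam (\<lambda>i. inv_one_plus_sq (z i)) h" for h
  proof -
    have zz: "(\<lambda>i v. z i (z i v)) \<in> linf" by (rule linf_comp[OF z(1) z(1)])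
    have id: "(\<lambda>i v. v) \<in> linf" using linf_const[OF R.N_id] .
    let ?k = "inv_one_plus_sq (Lam z) h"
    have "Lam (\<lambda>i. inv_one_plus_sq (z i)) (?k + Lam z (Lam z ?k)) = Lam (\<lambda>i. inv_one_plus_sq (z i)) (Lam (\<lambda>i v. v + z i (z i v)) ?k)"
      by (simp add: Lam_add[OF id zz] Lam_id Lam_comp z)
    also have "\<dots> = Lam (\<lambda>i v. inv_one_plus_sq (z i) (v + z i (z i v))) ?k"
      using Lam_comp[OF q linf_add[OF id zz]] by simp
    also have "\<dots> = ?k" by (simp add: inv_one_plus_sq_left[OF c s] Lam_id)
    finally show ?thesis by (simp add: inv_one_plus_sq_right[OF C S])
  qed
  moreover have "Lam (\<lambda>i. cayley_im (z i)) h = 2 *\<^sub>R Lam z (Lam (\<lambda>i. inv_one_plus_sq (z i)) h)" for h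
    using Lam_scaleC[OF linf_comp[OF z(1) q], of "of_real 2" h, unfolded scaleC_of_real] Lam_comp[OF z(1) q, of h]
    by (simp only: cayley_im_def[abs_def])
  ultimately show "cayley_im (Lam z) = Lam (\<lambda>i. cayley_im (z i))"
    by (intro ext) (simp add: cayley_im_def[of "Lam z"])
qed

text \<open>The unit ball of the ultrapower is complete in the 2-norm, because the diagonal sequence is made
  of entries of contractive sequences.\<close>

lemma linf_ball_closed:
  assumes y: "\<And>p. y p \<in> linf" "\<And>p i v. norm (y p i v) \<le> norm v"
    and lim: "(\<lambda>p. Lam (y p) OmN) \<longlonglongrightarrow> h"
  shows "\<exists>z\<in>linf. (\<forall>i v. norm (z i v) \<le> norm v) \<and> h = Lam z OmN"
proof -
  obtain r where r: "strict_mono r" "\<And>p. norm (Lam (y (r p)) OmN - Lam (y (r (Suc p))) OmN) < (1/2)^p"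
    using ex_fast_subseq[OF LIMSEQ_imp_Cauchy[OF lim]] by blast
  define x where "x p = (\<lambda>i. y (r p) i e0)" for p
  have x: "x p \<in> X0" "cls (x p) = Lam (y (r p)) OmN" for p
    using y(1) by (auto simp: x_def X0_linf Lam_OmN)
  obtain m :: "nat \<Rightarrow> nat" where m: "(\<lambda>i. x (m i) i) \<in> X0" "(\<lambda>p. cls (x p)) \<longlonglongrightarrow> cls (\<lambda>i. x (m i) i)"
    using fast_limit[of x, OF x(1)] r(2) by (auto simp: x(2))
  have z: "(\<lambda>i. y (r (m i)) i) \<in> linf"
    by (rule linfI[of _ 1]) (use y linf_N in auto)
  have "(\<lambda>p. cls (x p)) \<longlonglongrightarrow> h"
    using LIMSEQ_subseq_LIMSEQ[OF lim r(1)] by (simp add: x o_def)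
  then have "h = cls (\<lambda>i. x (m i) i)" using m(2) LIMSEQ_unique by blast
  then show ?thesis using z y(2) by (intro bexI[OF _ z]) (simp add: Lam_OmN x_def)
qed

text \<open>The iteration \<open>S \<mapsto> (1/2) a (1 + S\<^sup>2)\<close> recovers a small \<open>T\<close> from \<open>a = 2 T (1 + T\<^sup>2)\<^sup>-\<^sup>1\<close>.  It maps the unit ball to
  itself for every contraction \<open>a\<close>, so that it also preserves contractivity of the representing sequences.\<close>

fun cayley_im_iter :: "('a \<Rightarrow> 'a) \<Rightarrow> nat \<Rightarrow> 'a::real_vector \<Rightarrow> 'a" where
  "cayley_im_iter a 0 v = 0"
| "cayley_im_iter a (Suc n) v = (1/2) *\<^sub>R a (v + cayley_im_iter a n (cayley_im_iter a n v))"

text \<open>Approximate the symbol of \<open>T\<close> by symbols of self-adjoint bounded sequences \<open>z n\<close>, of which nothing is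
  known about the norms.  Their transforms \<open>cayley_im (z n)\<close> are contractions and converge to \<open>cayley_im T\<close>
  in the 2-norm, hence \<open>cayley_im T\<close> comes from a contractive sequence; the iteration then produces
  contractive sequences whose symbols converge to that of \<open>T\<close>.\<close>

lemma N_small_selfadjoint:
  assumes T: "T \<in> NN.N" "\<And>x y. T x \<bullet> y = x \<bullet> T y" and small: "\<And>v. norm (T v) \<le> 1/4 * norm v"
  shows "T \<in> Lam ` linf"
proof -
  have adjT: "adj T = T" using symmetric_iff_adj[OF NN.N_clin[OF T(1)]] T(2) by blast
  note cT = NN.N_clin[OF T(1)]
  have T1: "norm (T v) \<le> norm v" for v using small[of v] norm_ge_zero[of v] by linarith
  have "\<exists>z\<in>linf. (\<forall>i. adj (z i) = z i) \<and> norm (Lam z OmN - T OmN) < e" if e: "e > 0" for e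
  proof -
    obtain w where w: "w \<in> linf" "norm (T OmN - Lam w OmN) < e" using Lam_dense[OF e] by blast
    define z where "z = (\<lambda>i v. scaleC (1/2) (w i v + adj (w i) v))"
    have z: "z \<in> linf" unfolding z_def by (intro linf_scaleC linf_add w linf_adj)
    have az: "adj (z i) = z i" for i
      using clin_adj[OF linf_clin[OF w(1)]] linf_clin[OF w(1)]
      by (simp add: z_def adj_scaleC clin_add adj_add clinD adj_adj add.commute)
    have "Lam z OmN = scaleC (1/2) (Lam w OmN + JN (Lam w OmN))"
      unfolding z_def using w(1) NN.N_adj_Om[OF Lam_in_N[OF w(1)]]
      by (simp add: Lam_scaleC linf_add linf_adj Lam_add Lam_adj)
    moreover have "T OmN = scaleC (1/2) (T OmN + JN (T OmN))"
      using NN.N_adj_Om[OF T(1)] adjT scaleC_add_left[of "1/2" "1/2" "T OmN"] by (simp add: scaleC_add_right)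
    ultimately have "Lam z OmN - T OmN = scaleC (1/2) ((Lam w OmN - T OmN) + JN (Lam w OmN - T OmN))"
      by (simp add: linear_diff[OF NN.J_lin] scaleC_add_right scaleC_diff_right algebra_simps)
    then have "norm (Lam z OmN - T OmN) = 1/2 * norm ((Lam w OmN - T OmN) + JN (Lam w OmN - T OmN))"
      by (simp add: norm_scaleC)
    also have "\<dots> \<le> norm (Lam w OmN - T OmN)"
      using norm_triangle_ineq[of "Lam w OmN - T OmN" "JN (Lam w OmN - T OmN)"] by simp
    finally have "norm (Lam z OmN - T OmN) < e" using w(2) by (simp add: norm_minus_commute)
    with z az show ?thesis by blast
  qed
  then have "\<exists>z. \<forall>n. z n \<in> linf \<and> (\<forall>i. adj (z n i) = z n i) \<and> norm (Lam (z n) OmN - T OmN) < inverse (real (Suc n))"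
    by (intro choice allI) (meson bexE inverse_positive_iff_positive of_nat_0_less_iff zero_less_Suc)
  then obtain z where z: "\<And>n. z n \<in> linf" "\<And>n i. adj (z n i) = z n i"
    "\<And>n. norm (Lam (z n) OmN - T OmN) < inverse (real (Suc n))" by blast
  have bound: "norm (Lam (\<lambda>i. cayley_im (z n i)) OmN - cayley_im T OmN) \<le> 3 * inverse (real (Suc n))" for n
  proof -
    have "norm (cayley_im (Lam (z n)) OmN - cayley_im T OmN) \<le> 3 * norm (Lam (z n) OmN - T OmN)"
      by (rule NN.cayley_im_lipschitz[OF Lam_in_N[OF z(1)] Lam_symmetric[OF z(1,2)] T T1])
    then show ?thesis using z(3)[of n] by (simp add: Lam_cayley_im(2)[OF z(1,2)])
  qed
  have "(\<lambda>n. Lam (\<lambda>i. cayley_im (z n i)) OmN - cayley_im T OmN) \<longlonglongrightarrow> 0"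
    by (rule Lim_null_comparison[OF _ tendsto_mult_right_zero[OF LIMSEQ_inverse_real_of_nat, of 3]])
      (rule always_eventually, rule allI, rule bound)
  then have lim: "(\<lambda>n. Lam (\<lambda>i. cayley_im (z n i)) OmN) \<longlonglongrightarrow> cayley_im T OmN" by (simp add: LIM_zero_iff)
  have "\<exists>a\<in>linf. (\<forall>i v. norm (a i v) \<le> norm v) \<and> cayley_im T OmN = Lam a OmN"
  proof (rule linf_ball_closed[OF _ _ lim])
    show "(\<lambda>i. cayley_im (z p i)) \<in> linf" for p by (rule Lam_cayley_im(1)[OF z(1,2)])
    show "norm (cayley_im (z p i) v) \<le> norm v" for p i v
      by (rule norm_cayley_im[OF linf_clin[OF z(1)]]) (use symmetric_iff_adj[OF linf_clin[OF z(1)]] z(2) in blast)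
  qed
  then obtain a where a: "a \<in> linf" "\<And>i v. norm (a i v) \<le> norm v" "cayley_im T OmN = Lam a OmN" by blast
  have A: "cayley_im T = Lam a" by (rule NN.N_eqI[OF NN.N_cayley_im[OF T] Lam_in_N[OF a(1)] a(3)])
  have half: "norm (cayley_im T v) \<le> 1/2 * norm v" for v
    using small[of "inv_one_plus_sq T v"] inv_one_plus_sq_norm[OF cT T(2), of v] by (simp add: cayley_im_def)
  define S where "S n = Lam (\<lambda>i. cayley_im_iter (a i) n)" for n
  have Q: "(\<lambda>i. cayley_im_iter (a i) n) \<in> linf \<and> (\<forall>i v. norm (cayley_im_iter (a i) n v) \<le> norm v)" for n
  proof (induction n)
    case 0
    have "(\<lambda>i. cayley_im_iter (a i) 0) = (\<lambda>i v. 0)" by (simp add: fun_eq_iff)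
    then show ?case using linf_const[OF R.N_zero] by simp
  next
    case (Suc n)
    have "norm (cayley_im_iter (a i) (Suc n) v) \<le> norm v" for i v
    proof -
      have "norm (a i (v + cayley_im_iter (a i) n (cayley_im_iter (a i) n v))) \<le> norm v + norm (cayley_im_iter (a i) n (cayley_im_iter (a i) n v))"
        by (rule order_trans[OF a(2) norm_triangle_ineq])
      also have "\<dots> \<le> norm v + norm v" using Suc by (meson add_left_mono order_trans)
      finally show ?thesis by simp
    qed
    moreover have "(\<lambda>i v. scaleC (of_real (1/2)) (a i (v + cayley_im_iter (a i) n (cayley_im_iter (a i) n v)))) \<in> linf"
      using linf_scaleC[OF linf_comp[OF a(1) linf_add[OF linf_const[OF R.N_id] linf_comp[OF Suc[THEN conjunct1] Suc[THEN conjunct1]]]]] .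
    ultimately show ?case unfolding scaleC_of_real by (simp add: cayley_im_iter.simps(2)[abs_def])
  qed
  have S0: "S 0 v = 0" for v
    unfolding S_def by (simp add: Lam_def cls_zero)
  have SS: "S (Suc n) v = (1/2) *\<^sub>R cayley_im T (v + S n (S n v))" for n v
  proof -
    note q = Q[of n, THEN conjunct1] and id = linf_const[OF R.N_id]
    have "S (Suc n) v = Lam (\<lambda>i v. scaleC (of_real (1/2)) (a i (v + cayley_im_iter (a i) n (cayley_im_iter (a i) n v)))) v"
      unfolding S_def scaleC_of_real by (simp add: cayley_im_iter.simps(2)[abs_def])
    also have "\<dots> = scaleC (of_real (1/2)) (Lam a (Lam (\<lambda>i v. v) v + Lam (\<lambda>i v. cayley_im_iter (a i) n (cayley_im_iter (a i) n v)) v))"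
      using Lam_scaleC[OF linf_comp[OF a(1) linf_add[OF id linf_comp[OF q q]]]]
        Lam_comp[OF a(1) linf_add[OF id linf_comp[OF q q]]] Lam_add[OF id linf_comp[OF q q]] by simp
    finally show ?thesis unfolding scaleC_of_real Lam_id Lam_comp[OF q q] A S_def .
  qed
  note lT = clin_linear[OF cT]
  have SN: "S n \<in> NN.N" for n unfolding S_def using Q Lam_in_N by blast
  have comm: "T (S n v) = S n (T v)" for n v
  proof (induction n arbitrary: v)
    case 0 then show ?case by (simp add: S0 linear_0[OF lT])
  next
    case (Suc n)
    have "T (cayley_im T w) = cayley_im T (T w)" for w using cayley_im_commute[OF cT T(2) lT, of w] by simp
    then show ?case by (simp add: SS linear_scale[OF lT] linear_add[OF lT] Suc)
  qed
  have Shalf: "norm (S n v) \<le> 1/2 * norm v" for n v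
  proof (induction n arbitrary: v)
    case 0 then show ?case by (simp add: S0)
  next
    case (Suc n)
    have "norm (S n (S n v)) \<le> norm v" using Suc[of "S n v"] Suc[of v] norm_ge_zero[of v] by linarith
    then have "norm (v + S n (S n v)) \<le> 2 * norm v" using norm_triangle_ineq[of v "S n (S n v)"] by simp
    then show ?case using half[of "v + S n (S n v)"] by (simp add: SS)
  qed
  note lS = clin_linear[OF NN.N_clin[OF SN]]
  note lA = clin_linear[OF cayley_im_clin[OF cT T(2)]]
  have conv: "norm (S n v - T v) \<le> (1/2)^n * norm v" for n v
  proof (induction n arbitrary: v)
    case 0 then show ?case using T1 by (simp add: S0)
  next
    case (Suc n)
    have le: "norm (S n v + T v) \<le> norm v"
      using norm_triangle_ineq[of "S n v" "T v"] Shalf[of n v] small[of v] norm_ge_zero[of v] by linarith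
    have "S (Suc n) v - T v = (1/2) *\<^sub>R cayley_im T ((v + S n (S n v)) - (v + T (T v)))"
      using cayley_im_inverse[OF cT T(2), of v] unfolding SS linear_diff[OF lA] scaleR_diff_right by simp
    also have "(v + S n (S n v)) - (v + T (T v)) = S n (S n v + T v) - T (S n v + T v)"
      by (simp add: linear_add[OF lS] linear_add[OF lT] comm)
    finally have "norm (S (Suc n) v - T v) \<le> 1/2 * (1/2 * norm (S n (S n v + T v) - T (S n v + T v)))"
      using half[of "S n (S n v + T v) - T (S n v + T v)"] by simp
    also have "\<dots> \<le> 1/2 * (1/2 * ((1/2)^n * norm (S n v + T v)))"
      by (intro mult_left_mono Suc) auto
    also have "\<dots> \<le> 1/2 * (1/2 * ((1/2)^n * norm v))" using le by (intro mult_left_mono) auto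
    finally have "2 * norm (S (Suc n) v - T v) \<le> (1/2)^n * norm v"
      using norm_ge_zero[of "S (Suc n) v - T v"] by linarith
    then show ?case by simp
  qed
  have "(\<lambda>n. S n OmN - T OmN) \<longlonglongrightarrow> 0"
    by (rule Lim_null_comparison[OF _ LIMSEQ_realpow_zero[of "1/2"]])
      (rule always_eventually, rule allI, use conv[of _ OmN] in simp, simp_all)
  then have lim2: "(\<lambda>n. Lam (\<lambda>i. cayley_im_iter (a i) n) OmN) \<longlonglongrightarrow> T OmN" by (simp add: LIM_zero_iff S_def)
  have "\<exists>b\<in>linf. (\<forall>i v. norm (b i v) \<le> norm v) \<and> T OmN = Lam b OmN"
    by (rule linf_ball_closed[OF _ _ lim2]) (use Q in auto)
  then obtain b where b: "b \<in> linf" "T OmN = Lam b OmN" by blast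
  have "T = Lam b" by (rule NN.N_eqI[OF T(1) Lam_in_N[OF b(1)] b(2)])
  then show ?thesis using b(1) by blast
qed

lemma Lam_image_scaleC: "T \<in> Lam ` linf \<Longrightarrow> (\<lambda>v. scaleC c (T v)) \<in> Lam ` linf"
proof -
  assume "T \<in> Lam ` linf"
  then obtain y where y: "y \<in> linf" "T = Lam y" by blast
  then have "(\<lambda>v. scaleC c (T v)) = Lam (\<lambda>i v. scaleC c (y i v))" by (simp add: Lam_scaleC fun_eq_iff)
  then show ?thesis using linf_scaleC[OF y(1)] by blast
qed

lemma Lam_image_add: assumes "S \<in> Lam ` linf" "T \<in> Lam ` linf" shows "(\<lambda>v. S v + T v) \<in> Lam ` linf"
proof -
  obtain y z where y: "y \<in> linf" "S = Lam y" and z: "z \<in> linf" "T = Lam z" using assms by blast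
  then have "(\<lambda>v. S v + T v) = Lam (\<lambda>i v. y i v + z i v)" by (simp add: Lam_add fun_eq_iff)
  then show ?thesis using linf_add[OF y(1) z(1)] by blast
qed

lemma N_selfadjoint:
  assumes T: "T \<in> NN.N" "adj T = T" shows "T \<in> Lam ` linf"
proof -
  obtain K where K: "K > 0" "\<And>v. norm (T v) \<le> norm v * K"
    using bounded_linear.pos_bounded[OF clinD(1)[OF NN.N_clin[OF T(1)]]] by blast
  have sym: "T x \<bullet> y = x \<bullet> T y" for x y using symmetric_iff_adj[OF NN.N_clin[OF T(1)]] T(2) by blast
  define S where "S v = (1 / (4 * K)) *\<^sub>R T v" for v
  have "S \<in> Lam ` linf"
  proof (rule N_small_selfadjoint)
    show "S \<in> NN.N" unfolding S_def[abs_def] by (rule NN.N_scaleR[OF T(1)])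
    show "S x \<bullet> y = x \<bullet> S y" for x y by (simp add: S_def sym)
    show "norm (S v) \<le> 1/4 * norm v" for v using K by (simp add: S_def field_simps)
  qed
  from Lam_image_scaleC[OF this, of "of_real (4 * K)"]
  show ?thesis using K(1) unfolding scaleC_of_real by (simp add: S_def)
qed

text \<open>Every operator commuting with the right multiplications comes from a bounded sequence: the
  ultrapower is a von Neumann algebra on \<^typ>\<open>hN\<close>.\<close>

theorem NN_eq: "NN.N = Lam ` linf"
proof (intro equalityI subsetI)
  fix T assume T: "T \<in> NN.N"
  note c = NN.N_clin[OF T]
  define A where "A v = T v + adj T v" for v
  define B where "B v = scaleC \<i> (T v - adj T v)" for v
  have AN: "A \<in> NN.N" unfolding A_def[abs_def] by (rule NN.N_add[OF T NN.N_adj[OF T]])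
  have BN: "B \<in> NN.N" unfolding B_def[abs_def] by (rule NN.N_scaleC[OF NN.N_diff[OF T NN.N_adj[OF T]]])
  have "A \<in> Lam ` linf"
  proof (rule N_selfadjoint[OF AN])
    show "adj A = A"
      unfolding A_def[abs_def] by (simp add: adj_add clinD c clin_adj adj_adj add.commute)
  qed
  moreover have "B \<in> Lam ` linf"
  proof (rule N_selfadjoint[OF BN])
    show "adj B = B"
      by (rule adj_unique)
        (simp add: B_def scaleC_inner scaleC_diff_right scaleC_minus_left inner_diff_left inner_diff_right
          adj_inner clinD c inner_im_left im_diff clin_adj adj_adj)
  qed
  ultimately have "(\<lambda>v. scaleC (1/2) (A v) + scaleC (- \<i> / 2) (B v)) \<in> Lam ` linf"
    by (intro Lam_image_add Lam_image_scaleC)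
  moreover have "scaleC (1/2) (A v) + scaleC (- \<i> / 2) (B v) = T v" for v
  proof -
    have "scaleC (- \<i> / 2) (B v) = scaleC (1/2) (T v - adj T v)" by (simp add: B_def scaleC_scaleC del: scaleC_ii)
    then have "scaleC (1/2) (A v) + scaleC (- \<i> / 2) (B v) = scaleC (1/2) (T v) + scaleC (1/2) (T v)"
      by (simp add: A_def scaleC_add_right scaleC_diff_right)
    then show ?thesis by (simp flip: scaleC_add_left)
  qed
  ultimately show "T \<in> Lam ` linf" by simp
qed (use Lam_in_N in blast)

text \<open>A central sequence almost commutes with the unitaries of the group chosen index by index to
  witness its distance from the scalars.\<close>

lemma NN_centre:
  assumes T: "T \<in> NN.N" and comm: "\<And>S v. S \<in> NN.N \<Longrightarrow> S (T v) = T (S v)"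
  shows "\<exists>c. T = scaleC c"
proof -
  obtain x where x: "x \<in> linf" "T = Lam x" using T NN_eq by blast
  define c where "c i = cip (x i e0) e0" for i
  obtain K where K: "\<forall>i v. norm (x i v) \<le> K * norm v" using linf_bound[OF x(1)] by blast
  have cK: "cmod (c i) \<le> K" for i
    using cmod_coef_le[of "x i e0" 1] K[rule_format, of i e0] by (simp add: c_def cip_point)
  have "\<forall>i. \<exists>g. norm (x i e0 - scaleC (c i) e0) \<le> norm (lam g (x i e0) - x i (lam g e0))"
    unfolding c_def using ex_noncommuting_lam linf_N[OF x(1)] by blast
  then have "\<exists>g. \<forall>i. norm (x i e0 - scaleC (c i) e0) \<le> norm (lam (g i) (x i e0) - x i (lam (g i) e0))"
    by (rule choice)
  then obtain g where g: "\<And>i. norm (x i e0 - scaleC (c i) e0) \<le> norm (lam (g i) (x i e0) - x i (lam (g i) e0))"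
    by blast
  define u where "u = (\<lambda>i. lam (g i))"
  have u: "u \<in> linf" unfolding u_def by (rule linfI[of _ 1]) (simp_all add: lam_in_N)
  have "Lam (\<lambda>i v. u i (x i v)) OmN = Lam (\<lambda>i v. x i (u i v)) OmN"
    using comm[OF Lam_in_N[OF u], of OmN] by (simp add: Lam_comp u x)
  then have "null_seq (\<lambda>i. u i (x i e0) - x i (u i e0))"
    using cls_eq_iff[OF X0_linf[OF linf_comp[OF u x(1)]] X0_linf[OF linf_comp[OF x(1) u]]]
    by (simp add: Lam_OmN linf_comp u x(1))
  then have n1: "null_seq (\<lambda>i. x i e0 - scaleC (c i) e0)"
    by (rule null_seq_bound[where K = 1]) (use g in \<open>simp add: u_def\<close>)
  have "\<bar>Re (c i)\<bar> \<le> K" "\<bar>Im (c i)\<bar> \<le> K" for i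
    using abs_Re_le_cmod[of "c i"] abs_Im_le_cmod[of "c i"] cK[of i] by linarith+
  then obtain a b where "((\<lambda>i. Re (c i)) \<longlongrightarrow> a) UF" "((\<lambda>i. Im (c i)) \<longlongrightarrow> b) UF"
    using UF_convergent[of "\<lambda>i. Re (c i)" K] UF_convergent[of "\<lambda>i. Im (c i)" K] by (auto simp: always_eventually)
  from tendsto_Complex[OF this] have "(c \<longlongrightarrow> Complex a b) UF" by simp
  then have "((\<lambda>i. cmod (c i - Complex a b)) \<longlongrightarrow> 0) UF"
    by (simp add: tendsto_norm_zero_iff LIM_zero_iff)
  then have n2: "null_seq (\<lambda>i. scaleC (c i) e0 - scaleC (Complex a b) e0)"
  proof -
    have "scaleC (c i) e0 - scaleC (Complex a b) e0 = scaleC (c i - Complex a b) e0" for i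
      using scaleC_add_left[of "c i - Complex a b" "Complex a b" e0] by simp
    then show ?thesis
      using \<open>((\<lambda>i. cmod (c i - Complex a b)) \<longlongrightarrow> 0) UF\<close> by (simp add: null_seq_def norm_scaleC)
  qed
  have "null_seq (\<lambda>i. x i e0 - scaleC (Complex a b) e0)"
    using null_seq_add[OF n1 n2] by simp
  then have "T OmN = cls (\<lambda>i. scaleC (Complex a b) e0)"
    using x by (simp add: Lam_OmN cls_eq_iff X0_linf X0_scaleC e0_X0)
  then have eq: "T OmN = scaleC (Complex a b) OmN" by (simp add: OmN_def cls_scaleC e0_X0)
  have "T = scaleC (Complex a b)"
    by (rule NN.N_eqI[OF T NN.N_scaleC[OF NN.N_id] eq])
  then show ?thesis by blast
qed

lemma linf_lam: "(\<lambda>i. lam (g i)) \<in> linf"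
  by (rule linfI[of _ 1]) (simp_all add: lam_in_N)

lemma Lam_lam_inner:
  assumes "\<And>i. i \<ge> n \<Longrightarrow> g i = h i \<longleftrightarrow> P"
  shows "Lam (\<lambda>i. lam (g i)) OmN \<bullet> Lam (\<lambda>i. lam (h i)) OmN = (if P then 1 else 0)"
proof -
  have "((\<lambda>i. point (g i) \<bullet> point (h i)) \<longlongrightarrow> Lam (\<lambda>i. lam (g i)) OmN \<bullet> Lam (\<lambda>i. lam (h i)) OmN) UF"
    using inner_cls_tendsto[OF X0_linf[OF linf_lam[of g]] X0_linf[OF linf_lam[of h]]]
    by (simp add: Lam_OmN linf_lam)
  moreover have "((\<lambda>i. point (g i) \<bullet> point (h i)) \<longlongrightarrow> (if P then 1 else 0)) UF"
  proof (rule tendsto_eventually)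
    show "\<forall>\<^sub>F i in UF. point (g i) \<bullet> point (h i) = (if P then 1 else 0)"
      by (rule eventually_mono[OF eventually_UF_ge[of n]]) (simp add: point_inner assms)
  qed
  ultimately show ?thesis by (rule tendsto_unique[OF UF(1)])
qed

lemma NN_not_findim: "\<not> findim NN.N"
proof (rule NN.not_findim_N)
  define f where "f g = Lam (\<lambda>i. lam g) OmN" for g
  have ff: "f g \<bullet> f h = (if g = h then 1 else 0)" for g h
    unfolding f_def by (rule Lam_lam_inner[of 0]) simp
  have "inj f" by (rule injI) (metis ff zero_neq_one)
  then show "infinite (range f)" using infinite_fsym by (simp add: finite_image_iff)
  show "range f \<subseteq> (\<lambda>T. T OmN) ` NN.N"
  proof safe
    fix g :: fsym
    show "f g \<in> (\<lambda>T. T OmN) ` NN.N"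
      by (rule image_eqI[where x = "Lam (\<lambda>i. lam g)"]) (simp_all add: f_def Lam_in_N linf_lam)
  qed
  show "pairwise orthogonal (range f)"
    by (auto simp: pairwise_def orthogonal_def ff)
  show "0 \<notin> range f"
    by (metis ff imageE inner_zero_left zero_neq_one)
qed

section \<open>Finite-dimensional subalgebras\<close>

definition orthonormal :: "'a::real_inner set \<Rightarrow> bool" where
  "orthonormal E \<longleftrightarrow> finite E \<and> (\<forall>x\<in>E. \<forall>y\<in>E. x \<bullet> y = (if x = y then 1 else 0))"

lemma orthonormalD: "orthonormal E \<Longrightarrow> finite E" "orthonormal E \<Longrightarrow> x \<in> E \<Longrightarrow> y \<in> E \<Longrightarrow> x \<bullet> y = (if x = y then 1 else 0)"
  by (auto simp: orthonormal_def)

lemma orthonormal_independent: "orthonormal E \<Longrightarrow> independent E"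
  by (rule pairwise_orthogonal_independent) (fastforce simp: orthonormal_def pairwise_def orthogonal_def)+

lemma orthonormal_sum_inner: "orthonormal E \<Longrightarrow> y \<in> E \<Longrightarrow> (\<Sum>x\<in>E. c x *\<^sub>R x) \<bullet> y = c y"
proof -
  assume E: "orthonormal E" and y: "y \<in> E"
  have "(\<Sum>x\<in>E. c x *\<^sub>R x) \<bullet> y = (\<Sum>x\<in>E. if x = y then c y else 0)"
    unfolding inner_sum_left by (rule sum.cong) (use orthonormalD(2)[OF E _ y] in auto)
  then show ?thesis using y orthonormalD(1)[OF E] by simp
qed

definition proj :: "'a::real_inner set \<Rightarrow> 'a \<Rightarrow> 'a" where
  "proj E v = (\<Sum>x\<in>E. (v \<bullet> x) *\<^sub>R x)"

lemma proj_in_span: "proj E v \<in> span E"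
  unfolding proj_def by (intro span_sum span_scale span_base)

lemma proj_orth: assumes E: "orthonormal E" and u: "u \<in> span E" shows "(v - proj E v) \<bullet> u = 0"
proof -
  have "(v - proj E v) \<bullet> x = 0" if "x \<in> E" for x
    using orthonormal_sum_inner[OF E that] by (simp add: proj_def inner_diff_left)
  then have "orthogonal (v - proj E v) u"
    using u by (intro orthogonal_to_span[of u E]) (auto simp: orthogonal_def)
  then show ?thesis by (simp add: orthogonal_def)
qed

lemma proj_id: assumes E: "orthonormal E" and u: "u \<in> span E" shows "proj E u = u"
proof -
  have "(u - proj E u) \<bullet> (u - proj E u) = 0"
    by (rule proj_orth[OF E]) (intro span_diff u proj_in_span)
  then show ?thesis by simp
qed

lemma norm_proj: assumes E: "orthonormal E" shows "(norm (proj E v))\<^sup>2 = (\<Sum>x\<in>E. (v \<bullet> x)\<^sup>2)"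
proof -
  have "proj E v \<bullet> proj E v = (\<Sum>x\<in>E. (v \<bullet> x) * (proj E v \<bullet> x))"
    by (subst (2) proj_def) (simp add: inner_sum_right)
  also have "\<dots> = (\<Sum>x\<in>E. (v \<bullet> x)\<^sup>2)"
    unfolding proj_def by (rule sum.cong) (simp_all add: orthonormal_sum_inner[OF E] power2_eq_square)
  finally show ?thesis by (simp add: power2_norm_eq_inner)
qed

lemma norm_proj_pythagoras: assumes E: "orthonormal E"
  shows "(norm v)\<^sup>2 = (norm (proj E v))\<^sup>2 + (norm (v - proj E v))\<^sup>2"
  using proj_orth[OF E proj_in_span, of v v]
  by (simp add: power2_norm_eq_inner inner_diff_left inner_diff_right inner_commute)

lemma bessel: "orthonormal E \<Longrightarrow> (\<Sum>x\<in>E. (v \<bullet> x)\<^sup>2) \<le> (norm v)\<^sup>2"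
  using norm_proj_pythagoras[of E v] norm_proj[of E v] by simp

lemma norm_proj_ge: assumes E: "orthonormal E" and u: "u \<in> span E"
  shows "(norm v)\<^sup>2 - (norm (v - u))\<^sup>2 \<le> (\<Sum>x\<in>E. (v \<bullet> x)\<^sup>2)"
proof -
  have "(v - proj E v) \<bullet> (proj E v - u) = 0"
    by (rule proj_orth[OF E]) (intro span_diff u proj_in_span)
  then have "(norm (v - u))\<^sup>2 = (norm (v - proj E v))\<^sup>2 + (norm (proj E v - u))\<^sup>2"
    using norm_add_Pythagorean[of "v - proj E v" "proj E v - u"] by (simp add: orthogonal_def)
  then have "(norm (v - proj E v))\<^sup>2 \<le> (norm (v - u))\<^sup>2" by simp
  then show ?thesis using norm_proj_pythagoras[OF E, of v] norm_proj[OF E, of v] by simp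
qed

lemma ex_orthonormal_basis:
  assumes V: "subspace V" "V \<subseteq> span F" "finite F"
  shows "\<exists>E. orthonormal E \<and> span E = (V::'a::real_inner set)"
proof -
  obtain B where B: "B \<subseteq> V" "independent B" "V \<subseteq> span B"
    by (rule maximal_independent_subset)
  have fB: "finite B"
    using independent_span_bound[OF V(3) B(2) subset_trans[OF B(1) V(2)]] by (rule conjunct1)
  have sB: "span B = V" by (rule subset_antisym[OF span_minimal[OF B(1) V(1)] B(3)])
  obtain C where C: "finite C" "span C = span B" "pairwise orthogonal C" using basis_orthogonal[OF fB] by blast
  define E where "E = (\<lambda>x. (1 / norm x) *\<^sub>R x) ` (C - {0})"
  have "orthonormal E"
    unfolding orthonormal_def
  proof (intro conjI ballI)
    show "finite E" using C by (simp add: E_def)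
    fix x y assume "x \<in> E" "y \<in> E"
    then obtain a b where a: "a \<in> C" "a \<noteq> 0" "x = (1 / norm a) *\<^sub>R a" and b: "b \<in> C" "b \<noteq> 0" "y = (1 / norm b) *\<^sub>R b"
      by (auto simp: E_def)
    show "x \<bullet> y = (if x = y then 1 else 0)"
    proof (cases "a = b")
      case True
      then show ?thesis using a b by (simp add: norm_mult_self[symmetric])
    next
      case False
      then have ab: "a \<bullet> b = 0" using C(3) a b by (auto simp: pairwise_def orthogonal_def)
      then have xy: "x \<bullet> y = 0" using a b by simp
      have "x \<bullet> x \<noteq> 0" using a by simp
      then show ?thesis using xy by auto
    qed
  qed
  moreover have "span E = span C"
  proof (rule antisym)
    show "span E \<subseteq> span C"
      by (rule span_minimal) (auto simp: E_def intro: span_scale span_base)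
    have "x \<in> span E" if x: "x \<in> C" for x
    proof (cases "x = 0")
      case False
      then have "(1 / norm x) *\<^sub>R x \<in> E" using x by (simp add: E_def)
      from span_scale[OF span_base[OF this], of "norm x"] show ?thesis using False by simp
    qed (simp add: span_zero)
    then show "span C \<subseteq> span E" by (intro span_minimal) auto
  qed
  ultimately show ?thesis using sB C by blast
qed

text \<open>The vector \<open>p(T) v\<close>, by Horner's scheme.\<close>

definition poly_orbit :: "('a::chilbert \<Rightarrow> 'a) \<Rightarrow> 'a \<Rightarrow> complex poly \<Rightarrow> 'a" where
  "poly_orbit T v p = fold_coeffs (\<lambda>c w. scaleC c v + T w) p 0"

text \<open>A nonzero polynomial \<open>p\<close> of least degree with \<open>p(T) v = 0\<close> has a root \<open>z\<close>, and \<open>(p / (X - z))(T) v\<close> is an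
  eigenvector.\<close>

lemma eigenvector_exists:
  fixes T :: "'a::chilbert \<Rightarrow> 'a"
  assumes T: "clin T" and F: "finite F" "V \<subseteq> span F" and V: "subspace V" "\<And>v. v \<in> V \<Longrightarrow> im v \<in> V"
    and TV: "\<And>v. v \<in> V \<Longrightarrow> T v \<in> V" and v: "v \<in> V" "v \<noteq> 0"
  shows "\<exists>z w. w \<in> V \<and> w \<noteq> 0 \<and> T w = scaleC z w"
proof -
  define pa where "pa = poly_orbit T v"
  note lT = clin_linear[OF T]
  have pa0 [simp]: "pa 0 = 0" by (simp add: pa_def poly_orbit_def)
  have pC: "pa (pCons c p) = scaleC c v + T (pa p)" for c p
    by (cases "p = 0"; cases "c = 0") (simp_all add: pa_def poly_orbit_def linear_0[OF lT])
  have add: "pa (p + q) = pa p + pa q" for p q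
    by (induction p q rule: poly_induct2) (simp_all add: pC scaleC_add_left linear_add[OF lT])
  have sm: "pa (smult c p) = scaleC c (pa p)" for c p
    by (induction p) (simp_all add: pC scaleC_scaleC clin_scaleC[OF T] scaleC_add_right)
  have mon: "pa (monom c i) = scaleC c ((T ^^ i) v)" for c i
    by (induction i) (simp_all add: monom_0 monom_Suc pC linear_0[OF lT] clin_scaleC[OF T])
  have sumpa: "pa (\<Sum>i\<in>A. f i) = (\<Sum>i\<in>A. pa (f i))" for A and f :: "nat \<Rightarrow> complex poly"
    by (induction A rule: infinite_finite_induct) (simp_all add: add)
  have scV: "scaleC c w \<in> V" if "w \<in> V" for c w
    unfolding scaleC_def using that V by (intro subspace_add subspace_scale) auto
  have paV: "pa p \<in> V" for p
    by (induction p) (auto simp: pC subspace_0 V intro!: subspace_add scV v TV)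
  have orb: "(T ^^ i) v \<in> V" for i by (induction i) (auto simp: v TV)
  have "\<exists>p. p \<noteq> 0 \<and> pa p = 0"
  proof (cases "inj_on (\<lambda>i. (T ^^ i) v) {..card F}")
    case False
    then obtain i j where ij: "i \<noteq> j" "(T ^^ i) v = (T ^^ j) v" by (auto simp: inj_on_def)
    have "coeff (monom 1 i + monom (- 1) j) i = (1::complex)" using ij by simp
    then have "monom 1 i + monom (- 1) j \<noteq> (0 :: complex poly)" by (metis coeff_0 zero_neq_one)
    moreover have "pa (monom 1 i + monom (- 1) j) = 0" using ij by (simp add: add mon scaleC_minus_left)
    ultimately show ?thesis by blast
  next
    case True
    define S where "S = (\<lambda>i. (T ^^ i) v) ` {..card F}"
    have S: "finite S" "card S = Suc (card F)" using True by (simp_all add: S_def card_image)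
    have "S \<subseteq> span F" using orb F by (auto simp: S_def)
    then have "dependent S" using independent_span_bound[OF F(1), of S] S by auto
    then obtain u where u: "\<exists>x\<in>S. u x \<noteq> 0" "(\<Sum>x\<in>S. u x *\<^sub>R x) = 0" using dependent_finite[OF S(1)] by blast
    define p where "p = (\<Sum>i\<le>card F. monom (complex_of_real (u ((T ^^ i) v))) i)"
    have cp: "coeff p i = complex_of_real (u ((T ^^ i) v))" if "i \<le> card F" for i
      unfolding p_def coeff_sum using that by simp
    obtain i where "i \<le> card F" "u ((T ^^ i) v) \<noteq> 0" using u(1) by (auto simp: S_def)
    then have "p \<noteq> 0" using cp[of i] by auto
    moreover have "pa p = (\<Sum>x\<in>S. u x *\<^sub>R x)"
      unfolding p_def sumpa mon S_def sum.reindex[OF True] by simp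
    ultimately show ?thesis using u(2) by auto
  qed
  then obtain p where p: "p \<noteq> 0" "pa p = 0" and min: "\<And>q. q \<noteq> 0 \<Longrightarrow> pa q = 0 \<Longrightarrow> degree p \<le> degree q"
    using ex_has_least_nat[of "\<lambda>p. p \<noteq> 0 \<and> pa p = 0" _ degree] by blast
  have "\<not> constant (poly p)"
  proof
    assume "constant (poly p)"
    then have "degree p = 0" by (simp add: constant_degree)
    then obtain c where "p = [:c:]" by (rule degree_eq_zeroE)
    then show False using p v(2) norm_scaleC[of c v] by (auto simp: pC linear_0[OF lT])
  qed
  then obtain z where "poly p z = 0" using fundamental_theorem_of_algebra by blast
  then obtain q where q: "p = [:- z, 1:] * q" by (auto simp: poly_eq_0_iff_dvd elim: dvdE)
  have q0: "q \<noteq> 0" using q p by auto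
  have "degree p = Suc (degree q)" unfolding q using q0 by (subst degree_mult_eq) auto
  then have w: "pa q \<noteq> 0" using min[OF q0] by force
  have "p = smult (- z) q + pCons 0 q" unfolding q by simp
  then have "pa p = T (pa q) - scaleC z (pa q)"
    by (simp only: add pC sm scaleC_minus_left scaleC_zero_left) simp
  then have "T (pa q) = scaleC z (pa q)" using p by simp
  then show ?thesis using w paV by blast
qed

context tracial_rep
begin

context
  fixes B :: "('h \<Rightarrow> 'h) set"
  assumes BN: "B \<subseteq> N" and B: "star_subalg B" and fB: "findim B"
begin

text \<open>For a finite-dimensional *-subalgebra \<open>B\<close> of \<open>N\<close>, everything happens in the space \<open>W\<close> of its symbols;
  \<open>sym_of v\<close> is the element of \<open>B\<close> with symbol \<open>v\<close>, and a \<open>biideal\<close> is the space of symbols of a two-sided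
  ideal.  \<open>Phi E\<close> is the operator \<open>\<Sum> e e\<^sup>*\<close> over an orthonormal basis \<open>E\<close> of such an ideal.\<close>

definition W where "W = (\<lambda>b. b Om) ` B"

definition sym_of where "sym_of v = (SOME b. b \<in> B \<and> b Om = v)"

definition biideal where
  "biideal V \<longleftrightarrow> subspace V \<and> V \<subseteq> W \<and> (\<forall>b\<in>B. \<forall>v\<in>V. b v \<in> V \<and> J (b (J v)) \<in> V)"

definition Phi where "Phi E z = (\<Sum>e\<in>E. sym_of e (adj (sym_of e) z))"

lemma B_closed:
  "(\<lambda>v. v) \<in> B" "x \<in> B \<Longrightarrow> y \<in> B \<Longrightarrow> (\<lambda>v. x v + y v) \<in> B" "x \<in> B \<Longrightarrow> y \<in> B \<Longrightarrow> (\<lambda>v. x (y v)) \<in> B"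
  "x \<in> B \<Longrightarrow> (\<lambda>v. scaleC c (x v)) \<in> B" "x \<in> B \<Longrightarrow> adj x \<in> B" "(\<lambda>v. 0) \<in> B"
  using B by (auto simp: star_subalg_def)

lemma B_N: "b \<in> B \<Longrightarrow> b \<in> N" using BN by blast

lemma B_clin: "b \<in> B \<Longrightarrow> clin b" using B_N N_clin by blast

lemma B_sum: "(\<And>i. i \<in> A \<Longrightarrow> f i \<in> B) \<Longrightarrow> (\<lambda>x. \<Sum>i\<in>A. f i x) \<in> B"
  by (induction A rule: infinite_finite_induct) (auto simp: B_closed)

lemma W_span: "\<exists>F. finite F \<and> W \<subseteq> span F"
  unfolding W_def by (rule findim_span[OF fB])

lemma Om_W: "Om \<in> W"
  unfolding W_def using B_closed(1) by (rule rev_image_eqI) simp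

lemma sym_of: assumes "v \<in> W" shows "sym_of v \<in> B" "sym_of v Om = v"
proof -
  have "\<exists>b. b \<in> B \<and> b Om = v" using assms by (auto simp: W_def)
  from someI_ex[OF this] show "sym_of v \<in> B" "sym_of v Om = v" by (simp_all add: sym_of_def)
qed

lemma J_B_J_Om: "b \<in> B \<Longrightarrow> c \<in> B \<Longrightarrow> J (b (J (c Om))) = c (adj b Om)"
  by (rule J_N_J_Om[OF B_N B_N])

lemma biideal_W: "biideal W"
  unfolding biideal_def
proof (intro conjI ballI)
  show "subspace W"
  proof (rule subspaceI)
    show "0 \<in> W" unfolding W_def using B_closed(6) by (rule rev_image_eqI) simp
    fix x y assume "x \<in> W" "y \<in> W"
    then obtain b c where b: "b \<in> B" "x = b Om" and c: "c \<in> B" "y = c Om" by (auto simp: W_def)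
    show "x + y \<in> W" unfolding W_def using B_closed(2)[OF b(1) c(1)] by (rule rev_image_eqI) (simp add: b c)
    show "r *\<^sub>R x \<in> W" for r
      unfolding W_def using B_closed(4)[OF b(1), of "of_real r"] by (rule rev_image_eqI) (simp add: b)
  qed
  fix b v assume b: "b \<in> B" and "v \<in> W"
  then obtain c where c: "c \<in> B" "v = c Om" by (auto simp: W_def)
  show "b v \<in> W" unfolding W_def using B_closed(3)[OF b c(1)] by (rule rev_image_eqI) (simp add: c)
  show "J (b (J v)) \<in> W" unfolding W_def using B_closed(3)[OF c(1) B_closed(5)[OF b]]
    by (rule rev_image_eqI) (simp add: c J_B_J_Om b)
qed simp

lemma biidealD:
  assumes "biideal V"
  shows "subspace V" "V \<subseteq> W" "b \<in> B \<Longrightarrow> v \<in> V \<Longrightarrow> b v \<in> V" "b \<in> B \<Longrightarrow> v \<in> V \<Longrightarrow> J (b (J v)) \<in> V"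
  using assms by (auto simp: biideal_def)

lemma biideal_im: assumes "biideal V" "v \<in> V" shows "im v \<in> V"
  using biidealD(3)[OF assms(1) B_closed(4)[OF B_closed(1), of \<i>] assms(2)] by simp

lemma biideal_basis: assumes "biideal V" shows "\<exists>E. orthonormal E \<and> span E = V"
proof -
  obtain F where "finite F" "W \<subseteq> span F" using W_span by blast
  then show ?thesis using ex_orthonormal_basis[of V F] biidealD(1,2)[OF assms] by blast
qed

context
  fixes V E
  assumes V: "biideal V" and E: "orthonormal E" "span E = V"
begin

lemma E_W: "e \<in> E \<Longrightarrow> e \<in> W"
  using span_base[of e E] E(2) biidealD(2)[OF V] by blast

lemma symE: "e \<in> E \<Longrightarrow> sym_of e \<in> B" "e \<in> E \<Longrightarrow> sym_of e Om = e"
  using sym_of E_W by blast+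

lemma Phi_B: "Phi E \<in> B"
  unfolding Phi_def[abs_def]
proof (rule B_sum)
  fix e assume e: "e \<in> E"
  show "(\<lambda>z. sym_of e (adj (sym_of e) z)) \<in> B"
    by (rule B_closed(3)[OF symE(1)[OF e] B_closed(5)[OF symE(1)[OF e]]])
qed

lemma Phi_sym: "Phi E x \<bullet> y = x \<bullet> Phi E y"
  unfolding Phi_def inner_sum_left inner_sum_right
proof (rule sum.cong)
  fix e assume "e \<in> E"
  then have b: "bounded_linear (sym_of e)" by (simp add: symE B_clin clinD)
  show "sym_of e (adj (sym_of e) x) \<bullet> y = x \<bullet> sym_of e (adj (sym_of e) y)"
    using adj_inner[OF b, of "adj (sym_of e) x" y] adj_inner'[OF b, of x "adj (sym_of e) y"] by simp
qed simp

lemma expand_E: "v \<in> V \<Longrightarrow> v = (\<Sum>e\<in>E. (v \<bullet> e) *\<^sub>R e)"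
  using proj_id[OF E(1), of v] E(2) by (simp add: proj_def)

lemma Phi_Om: "Phi E Om = (\<Sum>e\<in>E. J (sym_of e (J e)))"
  unfolding Phi_def
proof (rule sum.cong)
  fix e assume e: "e \<in> E"
  show "sym_of e (adj (sym_of e) Om) = J (sym_of e (J e))"
    using J_B_J_Om[OF symE(1)[OF e] symE(1)[OF e]] symE(2)[OF e] by simp
qed simp

lemma Phi_Om_V: "Phi E Om \<in> V"
  unfolding Phi_Om
proof (rule subspace_sum[OF biidealD(1)[OF V]])
  fix e assume e: "e \<in> E"
  show "J (sym_of e (J e)) \<in> V"
    by (rule biidealD(4)[OF V symE(1)[OF e]]) (use span_base[OF e] E(2) in simp)
qed

text \<open>The trace property moves the basis to one place: \<open>\<Sum> \<tau>(e\<^sup>* X\<^sup>* X e) = \<tau>(X\<^sup>* X \<Sum> e e\<^sup>*)\<close>.\<close>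

lemma Phi_HS: assumes X: "X \<in> N" shows "(\<Sum>e\<in>E. (norm (X e))\<^sup>2) = X (Phi E Om) \<bullet> X Om"
proof -
  have "(norm (X e))\<^sup>2 = X (sym_of e (adj (sym_of e) Om)) \<bullet> X Om" if e: "e \<in> E" for e
  proof -
    define b where "b = sym_of e"
    have b: "b \<in> N" "b Om = e" "clin b" using symE[OF e] B_N N_clin by (auto simp: b_def)
    note cX = N_clin[OF X]
    have "(norm (X e))\<^sup>2 = Re (cip (adj b (adj X (X (b Om)))) Om)"
      using b cX by (simp add: adj_inner' clinD power2_norm_eq_inner)
    also have "\<dots> = Re (cip (b (adj b (adj X (X Om)))) Om)"
      using trace_comm[OF N_comp[OF N_adj[OF b(1)] N_comp[OF N_adj[OF X] X]] b(1)] by simp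
    also have "\<dots> = X (b (adj b Om)) \<bullet> X Om"
      unfolding Re_cip adj_inner[OF clinD(1)[OF b(3)]] adj_inner'[OF clinD(1)[OF b(3)]] adj_inner'[OF clinD(1)[OF cX]]
      by (rule inner_commute)
    finally show ?thesis by (simp add: b_def)
  qed
  then have "(\<Sum>e\<in>E. (norm (X e))\<^sup>2) = (\<Sum>e\<in>E. X (sym_of e (adj (sym_of e) Om)) \<bullet> X Om)"
    by (intro sum.cong) auto
  also have "\<dots> = X (Phi E Om) \<bullet> X Om"
    unfolding Phi_def by (simp add: linear_sum[OF clin_linear[OF N_clin[OF X]]] inner_sum_left)
  finally show ?thesis .
qed

text \<open>Expanding \<open>x e\<close> and \<open>x\<^sup>* f\<close> in the basis turns both sides into the double sum of
  \<open>(x e \<bullet> f) f e\<^sup>*\<close>.\<close>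

lemma Phi_central: assumes x: "x \<in> B" shows "x (Phi E z) = Phi E (x z)"
proof -
  have comb: "(\<lambda>v. \<Sum>f\<in>E. c f *\<^sub>R sym_of f v) \<in> B" for c
  proof (rule B_sum)
    fix e assume e: "e \<in> E"
    show "(\<lambda>v. c e *\<^sub>R sym_of e v) \<in> B"
      using B_closed(4)[OF symE(1)[OF e], of "of_real (c e)"] by simp
  qed
  have left: "(\<lambda>v. x (sym_of e v)) = (\<lambda>v. \<Sum>f\<in>E. (x e \<bullet> f) *\<^sub>R sym_of f v)" if x: "x \<in> B" and e: "e \<in> E" for x e
  proof (rule N_eqI[OF B_N[OF B_closed(3)[OF x symE(1)[OF e]]] B_N[OF comb]])
    have "x e \<in> V" using biidealD(3)[OF V x] E(2) span_base[OF e] by blast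
    from expand_E[OF this] show "x (sym_of e Om) = (\<Sum>f\<in>E. (x e \<bullet> f) *\<^sub>R sym_of f Om)"
      using e by (simp add: symE cong: sum.cong)
  qed
  have right: "adj (sym_of f) (x z) = (\<Sum>e\<in>E. (f \<bullet> x e) *\<^sub>R adj (sym_of e) z)" if f: "f \<in> E" for f z
  proof -
    note ax = B_closed(5)[OF x]
    have bl: "bounded_linear (sym_of e)" if "e \<in> E" for e using that by (simp add: symE B_clin clinD)
    have "adj (sym_of f) (x z) = adj (\<lambda>v. adj x (sym_of f v)) z"
      using x f by (simp add: adj_comp B_clin clinD clin_adj adj_adj symE)
    also have "\<dots> = adj (\<lambda>v. \<Sum>e\<in>E. (adj x f \<bullet> e) *\<^sub>R sym_of e v) z"
      by (simp add: left[OF ax f])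
    also have "adj (\<lambda>v. \<Sum>e\<in>E. (adj x f \<bullet> e) *\<^sub>R sym_of e v) = (\<lambda>v. \<Sum>e\<in>E. (adj x f \<bullet> e) *\<^sub>R adj (sym_of e) v)"
      by (rule adj_unique) (simp add: inner_sum_left inner_sum_right adj_inner[OF bl] cong: sum.cong)
    finally show ?thesis using x by (simp add: adj_inner' B_clin clinD)
  qed
  have "x (Phi E z) = (\<Sum>e\<in>E. x (sym_of e (adj (sym_of e) z)))"
    unfolding Phi_def by (rule linear_sum[OF clin_linear[OF B_clin[OF x]]])
  also have "\<dots> = (\<Sum>e\<in>E. \<Sum>f\<in>E. (x e \<bullet> f) *\<^sub>R sym_of f (adj (sym_of e) z))"
    by (rule sum.cong) (use fun_cong[OF left[OF x]] in auto)
  also have "\<dots> = (\<Sum>f\<in>E. \<Sum>e\<in>E. (x e \<bullet> f) *\<^sub>R sym_of f (adj (sym_of e) z))"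
    by (rule sum.swap)
  also have "\<dots> = Phi E (x z)"
    unfolding Phi_def
    by (rule sum.cong) (simp_all add: right linear_sum[OF clin_linear[OF B_clin[OF symE(1)]]]
       linear_scale[OF clin_linear[OF B_clin[OF symE(1)]]] inner_commute)
  finally show ?thesis .
qed

lemma eigen_biideal: "biideal {v \<in> V. Phi E v = scaleC z v}"
  unfolding biideal_def
proof (intro conjI ballI)
  note lP = clin_linear[OF B_clin[OF Phi_B]]
  show "subspace {v \<in> V. Phi E v = scaleC z v}"
    using biidealD(1)[OF V]
    by (intro subspaceI) (auto simp: linear_0[OF lP] linear_add[OF lP] linear_scale[OF lP] scaleC_add_right
      subspace_0 subspace_add subspace_scale linear_scale[OF clin_linear[OF clin_scaleC_op[OF clin_id, of z]]])
  show "{v \<in> V. Phi E v = scaleC z v} \<subseteq> W" using biidealD(2)[OF V] by blast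
  fix b v assume b: "b \<in> B" and v: "v \<in> {v \<in> V. Phi E v = scaleC z v}"
  have "Phi E (b v) = scaleC z (b v)"
    using v Phi_central[OF b, of v] by (simp add: clin_scaleC[OF B_clin[OF b]])
  then show "b v \<in> {v \<in> V. Phi E v = scaleC z v}" using v biidealD(3)[OF V b] by blast
  have "Phi E (J (b (J v))) = J (b (J (Phi E v)))"
    by (rule N_comm_J_N_J[OF B_N[OF Phi_B] B_N[OF b]])
  then have "Phi E (J (b (J v))) = scaleC z (J (b (J v)))"
    using v clin_scaleC[OF clin_JJ[OF B_clin[OF b]], of z v] by simp
  then show "J (b (J v)) \<in> {v \<in> V. Phi E v = scaleC z v}" using v biidealD(4)[OF V b] by blast
qed

end

lemma biideal_complement:
  assumes V: "biideal V" and U: "biideal U"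
  shows "biideal {v \<in> V. \<forall>u\<in>U. v \<bullet> u = 0}"
  unfolding biideal_def
proof (intro conjI ballI)
  show "subspace {v \<in> V. \<forall>u\<in>U. v \<bullet> u = 0}"
    using biidealD(1)[OF V] by (intro subspaceI) (auto simp: subspace_0 subspace_add subspace_scale inner_add_left)
  show "{v \<in> V. \<forall>u\<in>U. v \<bullet> u = 0} \<subseteq> W" using biidealD(2)[OF V] by blast
  fix b v assume b: "b \<in> B" and v: "v \<in> {v \<in> V. \<forall>u\<in>U. v \<bullet> u = 0}"
  have "b v \<bullet> u = 0" if "u \<in> U" for u
    using v biidealD(3)[OF U B_closed(5)[OF b] that] by (simp add: adj_inner clinD B_clin b)
  then show "b v \<in> {v \<in> V. \<forall>u\<in>U. v \<bullet> u = 0}" using v biidealD(3)[OF V b] by blast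
  have "J (b (J v)) \<bullet> u = 0" if "u \<in> U" for u
    using v biidealD(4)[OF U B_closed(5)[OF b] that] by (simp add: J_left adj_inner clinD B_clin b)
  then show "J (b (J v)) \<in> {v \<in> V. \<forall>u\<in>U. v \<bullet> u = 0}" using v biidealD(4)[OF V b] by blast
qed

lemma proj_Om_nonzero:
  assumes V: "biideal V" "orthonormal E" "span E = V" "V \<noteq> {0}" shows "proj E Om \<noteq> 0"
proof
  assume "proj E Om = 0"
  then have o: "Om \<bullet> u = 0" if "u \<in> V" for u
    using proj_orth[OF V(2), of u Om] that V(3) by simp
  obtain v where v: "v \<in> V" "v \<noteq> 0" using V(4) subspace_0[OF biidealD(1)[OF V(1)]] by blast
  then obtain b where b: "b \<in> B" "v = b Om" using biidealD(2)[OF V(1)] by (auto simp: W_def)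
  have "v \<bullet> v = Om \<bullet> adj b v" unfolding b(2) using b(1) by (simp add: adj_inner clinD B_clin)
  also have "\<dots> = 0" using o biidealD(3)[OF V(1) B_closed(5)[OF b(1)] v(1)] by blast
  finally show False using v by simp
qed

text \<open>The subalgebra \<open>B\<close> is a direct sum of matrix algebras of different sizes, with different weights
  under the trace, so operators that are small in the 2-norm need not be small in the normalised
  Hilbert-Schmidt norm on all of \<open>W\<close>.  But they are so on a suitable ideal.  Among the ideals on whose
  unit \<open>p\<close> the averages of \<open>X\<^sup>* X\<close> are at most \<open>\<delta> \<tau>(p)\<close>, take one of least dimension.  As the unit of an
  ideal is the sum of the units of a subideal and of its orthogonal complement, one of the two would
  again qualify; hence the central operator \<open>Phi E\<close> has only one eigenspace and is the multiple
  \<open>dim / \<tau>(p)\<close> of \<open>p\<close>.  With \<open>Phi_HS\<close> this is the claim.\<close>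

lemma ex_good_ideal:
  fixes X :: "'i \<Rightarrow> 'h \<Rightarrow> 'h"
  assumes X: "\<And>s. s \<in> A \<Longrightarrow> X s \<in> N" and \<delta>: "(\<Sum>s\<in>A. (norm (X s Om))\<^sup>2) \<le> \<delta>"
  shows "\<exists>E. orthonormal E \<and> E \<noteq> {} \<and> E \<subseteq> W \<and> (\<forall>b\<in>B. \<forall>v\<in>span E. b v \<in> span E) \<and>
     (\<Sum>s\<in>A. \<Sum>e\<in>E. (norm (X s e))\<^sup>2) \<le> \<delta> * card E"
proof -
  define f where "f v = (\<Sum>s\<in>A. X s v \<bullet> X s Om)" for v
  have f_add: "f (u + v) = f u + f v" for u v
    unfolding f_def sum.distrib[symmetric]
    by (rule sum.cong) (simp_all add: linear_add[OF clin_linear[OF N_clin[OF X]]] inner_add_left)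
  have f_scale: "f (r *\<^sub>R v) = r * f v" for r v
    unfolding f_def sum_distrib_left
    by (rule sum.cong) (simp_all add: linear_scale[OF clin_linear[OF N_clin[OF X]]])
  define good where "good E \<longleftrightarrow> orthonormal E \<and> biideal (span E) \<and> span E \<noteq> {0} \<and>
    f (proj E Om) \<le> \<delta> * (norm (proj E Om))\<^sup>2" for E
  obtain EW where EW: "orthonormal EW" "span EW = W" using biideal_basis[OF biideal_W] by blast
  have pW: "proj EW Om = Om" by (rule proj_id[OF EW(1)]) (simp add: EW(2) Om_W)
  have Om0: "Om \<noteq> 0" using norm_Om by (metis norm_zero zero_neq_one)
  have "f Om \<le> \<delta>" using \<delta> by (simp add: f_def power2_norm_eq_inner)
  then have "good EW" using EW pW biideal_W Om_W Om0 by (auto simp: good_def)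
  then obtain E where good: "good E" and min: "\<And>E'. good E' \<Longrightarrow> card E \<le> card E'"
    using ex_has_least_nat[of good EW card] by blast
  define V where "V = span E"
  have V: "biideal V" and E: "orthonormal E" "span E = V" and V0: "V \<noteq> {0}" using good by (auto simp: good_def V_def)
  define p where "p = proj E Om"
  have fp: "f p \<le> \<delta> * (norm p)\<^sup>2" using good by (simp add: good_def p_def)
  have pV: "p \<in> V" using proj_in_span[of E Om] by (simp add: p_def E(2))
  have p0: "p \<noteq> 0" unfolding p_def by (rule proj_Om_nonzero[OF V E V0])
  have p_orth: "(Om - p) \<bullet> u = 0" if "u \<in> V" for u
    using proj_orth[OF E(1), of u Om] that by (simp add: p_def E(2))
  obtain v0 where v0: "v0 \<in> V" "v0 \<noteq> 0" using V0 subspace_0[OF biidealD(1)[OF V]] by blast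
  note cP = B_clin[OF Phi_B[OF V E]]
  obtain z w where w: "w \<in> V" "w \<noteq> 0" "Phi E w = scaleC z w"
    using eigenvector_exists[OF cP orthonormalD(1)[OF E(1)], of V, OF _ biidealD(1)[OF V] biideal_im[OF V]
      biidealD(3)[OF V Phi_B[OF V E]] v0] E(2) by blast
  define U where "U = {v \<in> V. Phi E v = scaleC z v}"
  have U: "biideal U" unfolding U_def by (rule eigen_biideal[OF V E])
  have UV: "U \<subseteq> V" by (auto simp: U_def)
  define U' where "U' = {v \<in> V. \<forall>u\<in>U. v \<bullet> u = 0}"
  have U': "biideal U'" unfolding U'_def by (rule biideal_complement[OF V U])
  have "V = U"
  proof (rule ccontr)
    assume "V \<noteq> U"
    then obtain x where x: "x \<in> V" "x \<notin> U" using UV by blast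
    obtain E1 where E1: "orthonormal E1" "span E1 = U" using biideal_basis[OF U] by blast
    obtain E2 where E2: "orthonormal E2" "span E2 = U'" using biideal_basis[OF U'] by blast
    have "x - proj E1 x \<in> U'"
      unfolding U'_def using x(1) UV proj_in_span[of E1 x] proj_orth[OF E1(1), of _ x]
      by (auto simp: E1(2) intro!: subspace_diff[OF biidealD(1)[OF V]])
    moreover have "x - proj E1 x \<noteq> 0" using x(2) proj_in_span[of E1 x] by (auto simp: E1(2))
    ultimately have U'0: "U' \<noteq> {0}" by blast
    have U0: "U \<noteq> {0}" using w by (auto simp: U_def)
    have orth12: "a \<bullet> b = 0" if "a \<in> E1" "b \<in> E2" for a b
      using span_base[OF that(1)] span_base[OF that(2)] unfolding E1(2) E2(2) U'_def by (simp add: inner_commute)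
    have disj: "E1 \<inter> E2 = {}"
      using orth12 orthonormalD(2)[OF E1(1)] by force
    have "orthonormal (E1 \<union> E2)"
      unfolding orthonormal_def
    proof (intro conjI ballI)
      show "finite (E1 \<union> E2)" using E1 E2 orthonormalD by blast
      fix a b assume "a \<in> E1 \<union> E2" "b \<in> E1 \<union> E2"
      then show "a \<bullet> b = (if a = b then 1 else 0)"
        using orth12[of a b] orth12[of b a] disj orthonormalD(2)[OF E1(1), of a b] orthonormalD(2)[OF E2(1), of a b]
        by (auto simp: inner_commute[of b a])
    qed
    moreover have "E1 \<union> E2 \<subseteq> span E"
      using span_superset[of E1] span_superset[of E2] UV by (auto simp: E1(2) E2(2) E(2) U'_def)
    ultimately have "card (E1 \<union> E2) \<le> card E"
      using independent_span_bound[OF orthonormalD(1)[OF E(1)] orthonormal_independent] by blast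
    then have card: "card E1 + card E2 \<le> card E"
      using card_Un_disjoint[OF orthonormalD(1)[OF E1(1)] orthonormalD(1)[OF E2(1)] disj] by simp
    have "E1 \<noteq> {}" "E2 \<noteq> {}" using U0 U'0 E1(2) E2(2) by auto
    then have "card E1 > 0" "card E2 > 0" using orthonormalD(1)[OF E1(1)] orthonormalD(1)[OF E2(1)] by (auto simp: card_gt_0_iff)
    then have lt: "card E1 < card E" "card E2 < card E" using card by auto
    define p1 where "p1 = proj E1 Om"
    define p2 where "p2 = proj E2 Om"
    have p1U: "p1 \<in> U" and p2U: "p2 \<in> U'" using proj_in_span[of E1 Om] proj_in_span[of E2 Om] by (simp_all add: p1_def p2_def E1 E2)
    have p12: "p1 \<bullet> p2 = 0" using p1U p2U by (simp add: U'_def inner_commute)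
    have "p = p1 + p2"
    proof -
      define q where "q = p - p1 - p2"
      have qV: "q \<in> V" unfolding q_def using pV p1U p2U UV by (intro subspace_diff[OF biidealD(1)[OF V]]) (auto simp: U'_def)
      have q1: "q \<bullet> u = 0" if u: "u \<in> U" for u
      proof -
        have "q \<bullet> u = (Om - p1) \<bullet> u - (Om - p) \<bullet> u - p2 \<bullet> u" by (simp add: q_def inner_diff_left)
        also have "\<dots> = 0" using proj_orth[OF E1(1), of u Om] p_orth[of u] p2U u UV by (auto simp: p1_def E1(2) U'_def)
        finally show ?thesis .
      qed
      then have "q \<in> U'" using qV by (simp add: U'_def)
      then have "q \<bullet> q = (Om - p2) \<bullet> q - (Om - p) \<bullet> q - p1 \<bullet> q" by (simp add: q_def inner_diff_left inner_diff_right)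
      also have "\<dots> = 0" using proj_orth[OF E2(1), of q Om] p_orth[OF qV] q1[OF p1U] \<open>q \<in> U'\<close> by (simp add: p2_def E2(2) inner_commute)
      finally show ?thesis by (simp add: q_def diff_diff_eq)
    qed
    then have "f p1 + f p2 \<le> \<delta> * ((norm p1)\<^sup>2 + (norm p2)\<^sup>2)"
      using fp norm_add_Pythagorean[of p1 p2] p12 by (simp add: f_add orthogonal_def)
    then have "f p1 \<le> \<delta> * (norm p1)\<^sup>2 \<or> f p2 \<le> \<delta> * (norm p2)\<^sup>2" by (auto simp: distrib_left)
    then have "good E1 \<or> good E2"
      using E1 E2 U U' U0 U'0 by (auto simp: good_def p1_def p2_def)
    then show False using min lt by fastforce
  qed
  then have eig: "Phi E v = scaleC z v" if "v \<in> V" for v using that by (auto simp: U_def)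
  have PhiOm: "Phi E Om = Phi E p"
  proof -
    define q where "q = Om - p"
    have qW: "q \<in> W" unfolding q_def
      using Om_W pV biidealD(2)[OF V] by (intro subspace_diff[OF biidealD(1)[OF biideal_W]]) auto
    have "Phi E q \<in> W" by (rule biidealD(3)[OF biideal_W Phi_B[OF V E] qW])
    then obtain c where c: "c \<in> B" "Phi E q = c Om" by (auto simp: W_def)
    have "Phi E (Phi E q) = c (Phi E Om)" unfolding c(2) by (rule Phi_central[OF V E c(1), symmetric])
    moreover have "c (Phi E Om) \<in> V" by (rule biidealD(3)[OF V c(1) Phi_Om_V[OF V E]])
    ultimately have "q \<bullet> Phi E (Phi E q) = 0" using p_orth by (simp add: q_def)
    then have "Phi E q \<bullet> Phi E q = 0" by (simp only: Phi_sym[OF V E, of q])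
    then have "Phi E q = 0" by simp
    then show ?thesis by (simp add: q_def linear_diff[OF clin_linear[OF cP]])
  qed
  define r where "r = Re z"
  have "Im z = 0"
  proof -
    have "Phi E p \<bullet> im p = p \<bullet> im (Phi E p)" by (simp add: Phi_sym[OF V E] clinD(2)[OF cP])
    also have "\<dots> = - (Phi E p \<bullet> im p)" using inner_im_left[of p "Phi E p"] by (simp add: inner_commute)
    finally have "scaleC z p \<bullet> im p = 0" using eig[OF pV] by simp
    then show ?thesis using p0 by (simp add: scaleC_def inner_add_left)
  qed
  then have PhiOm_r: "Phi E Om = r *\<^sub>R p"
    using PhiOm eig[OF pV] by (simp add: scaleC_def r_def)
  have pOm: "p \<bullet> Om = (norm p)\<^sup>2"
    using p_orth[OF pV] unfolding inner_diff_left power2_norm_eq_inner inner_commute[of p Om] by simp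
  have card: "real (card E) = r * (norm p)\<^sup>2"
  proof -
    have "(\<Sum>e\<in>E. (norm e)\<^sup>2) = (\<Sum>e\<in>E. 1)"
      by (rule sum.cong) (use orthonormalD(2)[OF E(1)] in \<open>auto simp: power2_norm_eq_inner\<close>)
    then show ?thesis using Phi_HS[OF V E N_id] by (simp add: PhiOm_r pOm)
  qed
  have "r \<ge> 0"
  proof (rule ccontr)
    assume "\<not> r \<ge> 0"
    then have "r * (norm p)\<^sup>2 < 0" using p0 by (simp add: mult_neg_pos)
    then show False using card by simp
  qed
  have "(\<Sum>s\<in>A. \<Sum>e\<in>E. (norm (X s e))\<^sup>2) = f (Phi E Om)"
    unfolding f_def by (rule sum.cong) (simp_all add: Phi_HS[OF V E X])
  also have "\<dots> \<le> r * (\<delta> * (norm p)\<^sup>2)"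
    unfolding PhiOm_r f_scale using fp \<open>r \<ge> 0\<close> by (rule mult_left_mono)
  also have "\<dots> = \<delta> * card E" by (simp add: card)
  finally have "(\<Sum>s\<in>A. \<Sum>e\<in>E. (norm (X s e))\<^sup>2) \<le> \<delta> * card E" .
  moreover have "E \<noteq> {}" using V0 E(2) by auto
  moreover have "E \<subseteq> W" using span_superset[of E] E(2) biidealD(2)[OF V] by blast
  moreover have "\<forall>b\<in>B. \<forall>v\<in>span E. b v \<in> span E" using biidealD(3)[OF V] by (simp add: E(2))
  ultimately show ?thesis using E(1) by blast
qed

end

end

section \<open>Words in five involutions\<close>

text \<open>The square \<open>(x a \<bullet> y b)\<^sup>2\<close> is the inner product of \<open>x a \<otimes> x a\<close> and \<open>y b \<otimes> y b\<close>, here in coordinates.\<close>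

lemma gram_expand:
  fixes x :: "'i \<Rightarrow> 'a::real_inner" and y :: "'j \<Rightarrow> 'a"
  assumes E: "orthonormal E" and x: "\<And>a. a \<in> A \<Longrightarrow> x a \<in> span E"
  shows "(\<Sum>a\<in>A. \<Sum>b\<in>B. (x a \<bullet> y b)\<^sup>2) =
    (\<Sum>m\<in>E \<times> E. (\<Sum>a\<in>A. (x a \<bullet> fst m) * (x a \<bullet> snd m)) * (\<Sum>b\<in>B. (y b \<bullet> fst m) * (y b \<bullet> snd m)))"
proof -
  have "(x a \<bullet> v)\<^sup>2 = (\<Sum>m\<in>E \<times> E. ((x a \<bullet> fst m) * (x a \<bullet> snd m)) * ((v \<bullet> fst m) * (v \<bullet> snd m)))"
    if a: "a \<in> A" for a v
  proof -
    have "x a \<bullet> v = (\<Sum>m\<in>E. (x a \<bullet> m) * (v \<bullet> m))"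
      using arg_cong[OF proj_id[OF E x[OF a]], of "\<lambda>u. u \<bullet> v"]
      by (simp add: proj_def inner_sum_left inner_commute[of v])
    then have "(x a \<bullet> v)\<^sup>2 = (\<Sum>m\<in>E. \<Sum>n\<in>E. ((x a \<bullet> m) * (v \<bullet> m)) * ((x a \<bullet> n) * (v \<bullet> n)))"
      by (simp add: power2_eq_square sum_product)
    also have "\<dots> = (\<Sum>(m, n)\<in>E \<times> E. ((x a \<bullet> m) * (v \<bullet> m)) * ((x a \<bullet> n) * (v \<bullet> n)))"
      by (rule sum.cartesian_product)
    also have "\<dots> = (\<Sum>m\<in>E \<times> E. ((x a \<bullet> fst m) * (x a \<bullet> snd m)) * ((v \<bullet> fst m) * (v \<bullet> snd m)))"
      by (rule sum.cong) (auto simp: ac_simps)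
    finally show ?thesis .
  qed
  then have "(\<Sum>a\<in>A. \<Sum>b\<in>B. (x a \<bullet> y b)\<^sup>2) =
      (\<Sum>a\<in>A. \<Sum>b\<in>B. \<Sum>m\<in>E \<times> E. ((x a \<bullet> fst m) * (x a \<bullet> snd m)) * ((y b \<bullet> fst m) * (y b \<bullet> snd m)))"
    by simp
  also have "\<dots> = (\<Sum>a\<in>A. \<Sum>m\<in>E \<times> E. \<Sum>b\<in>B. ((x a \<bullet> fst m) * (x a \<bullet> snd m)) * ((y b \<bullet> fst m) * (y b \<bullet> snd m)))"
    by (intro sum.cong refl) (rule sum.swap)
  also have "\<dots> = (\<Sum>m\<in>E \<times> E. \<Sum>a\<in>A. \<Sum>b\<in>B. ((x a \<bullet> fst m) * (x a \<bullet> snd m)) * ((y b \<bullet> fst m) * (y b \<bullet> snd m)))"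
    by (rule sum.swap)
  finally show ?thesis by (simp add: sum_product)
qed

lemma gram_cauchy_schwarz:
  fixes x :: "'i \<Rightarrow> 'a::real_inner" and y :: "'j \<Rightarrow> 'a"
  assumes fin: "finite A" "finite B"
  shows "(\<Sum>a\<in>A. \<Sum>b\<in>B. (x a \<bullet> y b)\<^sup>2)\<^sup>2 \<le>
    (\<Sum>a\<in>A. \<Sum>a'\<in>A. (x a \<bullet> x a')\<^sup>2) * (\<Sum>b\<in>B. \<Sum>b'\<in>B. (y b \<bullet> y b')\<^sup>2)"
proof -
  obtain E where E: "orthonormal E" "span E = span (x ` A \<union> y ` B)"
    using ex_orthonormal_basis[OF subspace_span order_refl, of "x ` A \<union> y ` B"] fin by auto
  have x: "x a \<in> span E" if "a \<in> A" for a using that E(2) by (simp add: span_base)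
  have y: "y b \<in> span E" if "b \<in> B" for b using that E(2) by (simp add: span_base)
  have gy: "(\<Sum>a\<in>B. \<Sum>b\<in>B. (y a \<bullet> y b)\<^sup>2) =
      (\<Sum>m\<in>E \<times> E. (\<Sum>a\<in>B. (y a \<bullet> fst m) * (y a \<bullet> snd m)) * (\<Sum>b\<in>B. (y b \<bullet> fst m) * (y b \<bullet> snd m)))"
    by (rule gram_expand[OF E(1) y])
  have gx: "(\<Sum>a\<in>A. \<Sum>b\<in>A. (x a \<bullet> x b)\<^sup>2) =
      (\<Sum>m\<in>E \<times> E. (\<Sum>a\<in>A. (x a \<bullet> fst m) * (x a \<bullet> snd m)) * (\<Sum>b\<in>A. (x b \<bullet> fst m) * (x b \<bullet> snd m)))"
    by (rule gram_expand[OF E(1) x])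
  have gxy: "(\<Sum>a\<in>A. \<Sum>b\<in>B. (x a \<bullet> y b)\<^sup>2) =
      (\<Sum>m\<in>E \<times> E. (\<Sum>a\<in>A. (x a \<bullet> fst m) * (x a \<bullet> snd m)) * (\<Sum>b\<in>B. (y b \<bullet> fst m) * (y b \<bullet> snd m)))"
    by (rule gram_expand[OF E(1) x])
  show ?thesis
    unfolding gx gy gxy
    using Cauchy_Schwarz_ineq_sum[of "\<lambda>m. \<Sum>a\<in>A. (x a \<bullet> fst m) * (x a \<bullet> snd m)"
      "\<lambda>m. \<Sum>b\<in>B. (y b \<bullet> fst m) * (y b \<bullet> snd m)" "E \<times> E"]
    by (simp only: power2_eq_square)
qed

text \<open>Multiplication of a reduced word by a generator in the free product of groups of order two; the
  reduced words over five letters form the vertices of the 5-regular tree.\<close>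

fun act :: "nat \<Rightarrow> nat list \<Rightarrow> nat list" where
  "act s [] = [s]"
| "act s (t # w) = (if s = t then w else s # t # w)"

fun red :: "nat list \<Rightarrow> nat list" where
  "red [] = []"
| "red (s # w) = act s (red w)"

lemma distinct_adj_act: "distinct_adj w \<Longrightarrow> distinct_adj (act s w)"
  by (cases w) (auto dest: distinct_adj_ConsD)

lemma act_act: "distinct_adj w \<Longrightarrow> act s (act s w) = w"
  by (cases w rule: remdups_adj.cases) auto

lemma distinct_adj_red: "distinct_adj (red w)"
  by (induction w) (auto intro: distinct_adj_act)

lemma set_act: "set (act s w) \<subseteq> insert s (set w)"
  by (cases w) auto

lemma set_red: "set (red w) \<subseteq> set w"
  by (induction w) (use set_act in fastforce)+

definition wds :: "nat \<Rightarrow> nat list set" where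
  "wds n = {w. set w \<subseteq> {..<5} \<and> length w = n}"

lemma finite_wds: "finite (wds n)"
  unfolding wds_def by (rule finite_lists_length_eq) simp

lemma wds_Suc: "wds (Suc n) = (\<lambda>(s, w). s # w) ` ({..<5} \<times> wds n)"
  by (auto simp: wds_def length_Suc_conv image_iff)

lemma sum_wds_Suc: "(\<Sum>w\<in>wds (Suc n). f w) = (\<Sum>s<5. \<Sum>w\<in>wds n. f (s # w))"
proof -
  have "inj_on (\<lambda>(s, w). s # w) ({..<5::nat} \<times> wds n)" by (auto simp: inj_on_def)
  then show ?thesis
    unfolding wds_Suc by (simp add: sum.reindex sum.cartesian_product case_prod_unfold o_def)
qed

text \<open>Schur's test on the 5-regular tree: of the five neighbours of a vertex one is closer to the root
  and four are further away, and \<open>2 + 4 / 2 = 4\<close>.  The constant 4, being less than the degree 5, expresses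
  that the tree is not amenable.\<close>

lemma act_weight: "(\<Sum>s<5. (1/2::real) ^ length (act s g)) \<le> 4 * (1/2) ^ length g"
proof (cases g)
  case (Cons t u)
  have "(\<Sum>s<5. (1/2::real) ^ length (act s g)) =
      (\<Sum>s<5. (1/2) ^ (length u + 2) + (if s = t then (1/2) ^ length u - (1/2) ^ (length u + 2) else 0))"
    by (rule sum.cong) (auto simp: Cons)
  also have "\<dots> = 5 * (1/2) ^ (length u + 2) + (if t < 5 then (1/2) ^ length u - (1/2) ^ (length u + 2) else 0)"
    by (simp add: sum.distrib)
  also have "\<dots> \<le> 4 * (1/2) ^ length g" by (simp add: Cons)
  finally show ?thesis .
qed simp

lemma count_red: "(\<Sum>w\<in>wds n. of_bool (red w = g)) \<le> (4::real) ^ n * (1/2) ^ length g"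
proof (induction n arbitrary: g)
  case 0
  have "wds 0 = {[]}" by (auto simp: wds_def)
  then show ?case by (cases g) auto
next
  case (Suc n)
  show ?case
  proof (cases "distinct_adj g")
    case False
    then have "(\<Sum>w\<in>wds (Suc n). of_bool (red w = g)) = (0::real)"
      using distinct_adj_red by (intro sum.neutral) (metis of_bool_eq(1))
    then show ?thesis by simp
  next
    case True
    have eq: "red (s # w) = g \<longleftrightarrow> red w = act s g" for s w
      using act_act[OF True, of s] act_act[OF distinct_adj_red, of s w] by auto
    have "(\<Sum>w\<in>wds (Suc n). of_bool (red w = g)) = (\<Sum>s<5. \<Sum>w\<in>wds n. of_bool (red w = act s g) :: real)"
      unfolding sum_wds_Suc eq ..
    also have "\<dots> \<le> (\<Sum>s<5. 4 ^ n * (1/2) ^ length (act s g))"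
      by (intro sum_mono Suc)
    also have "\<dots> = 4 ^ n * (\<Sum>s<5. (1/2) ^ length (act s g))" by (simp add: sum_distrib_left)
    also have "\<dots> \<le> 4 ^ n * (4 * (1/2) ^ length g)" by (intro mult_left_mono act_weight) simp
    finally show ?thesis by simp
  qed
qed

lemma sum_over_reduced:
  fixes Q :: "nat list \<Rightarrow> real"
  assumes Q: "\<And>g. Q g \<ge> 0" and C: "\<And>G. finite G \<Longrightarrow> (\<And>g. g \<in> G \<Longrightarrow> distinct_adj g \<and> set g \<subseteq> {..<5}) \<Longrightarrow> (\<Sum>g\<in>G. Q g) \<le> C"
  shows "(\<Sum>w\<in>wds n. Q (red w)) \<le> 4 ^ n * C"
proof -
  let ?G = "red ` wds n"
  have "(\<Sum>w\<in>wds n. Q (red w)) = (\<Sum>w\<in>wds n. \<Sum>g\<in>?G. of_bool (red w = g) * Q g)"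
  proof (rule sum.cong)
    fix w assume w: "w \<in> wds n"
    have "(\<Sum>g\<in>?G. of_bool (red w = g) * Q g) = (\<Sum>g\<in>?G. if g = red w then Q g else 0)"
      by (rule sum.cong) auto
    then show "Q (red w) = (\<Sum>g\<in>?G. of_bool (red w = g) * Q g)" using w by (simp add: finite_wds)
  qed simp
  also have "\<dots> = (\<Sum>g\<in>?G. (\<Sum>w\<in>wds n. of_bool (red w = g)) * Q g)"
    unfolding sum_distrib_right by (rule sum.swap)
  also have "\<dots> \<le> (\<Sum>g\<in>?G. 4 ^ n * Q g)"
  proof (rule sum_mono)
    fix g
    have "(\<Sum>w\<in>wds n. of_bool (red w = g)) \<le> (4::real) ^ n * (1/2) ^ length g" by (rule count_red)
    also have "\<dots> \<le> 4 ^ n" by (simp add: power_le_one)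
    finally show "(\<Sum>w\<in>wds n. of_bool (red w = g)) * Q g \<le> 4 ^ n * Q g" by (rule mult_right_mono) (rule Q)
  qed
  also have "\<dots> = 4 ^ n * (\<Sum>g\<in>?G. Q g)" by (simp add: sum_distrib_left)
  also have "\<dots> \<le> 4 ^ n * C"
  proof (rule mult_left_mono)
    show "(\<Sum>g\<in>?G. Q g) \<le> C"
    proof (rule C)
      show "finite ?G" by (simp add: finite_wds)
      fix g assume "g \<in> ?G"
      then obtain w where "w \<in> wds n" "g = red w" by blast
      then show "distinct_adj g \<and> set g \<subseteq> {..<5}"
        using set_red[of w] by (auto simp: distinct_adj_red wds_def)
    qed
  qed simp
  finally show ?thesis .
qed

text \<open>The generators act on the ball of radius \<open>n\<close> of the tree by multiplication, as long as this does not
  leave the ball; the ball is coded into the natural numbers.  A reduced word of length at most \<open>n\<close> sends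
  the root to itself read as a vertex, so distinct ones give distinct permutations.\<close>

definition tree_ball :: "nat \<Rightarrow> nat list set" where
  "tree_ball n = {w. set w \<subseteq> {..<5} \<and> distinct_adj w \<and> length w \<le> n}"

definition tree_step :: "nat \<Rightarrow> nat \<Rightarrow> nat list \<Rightarrow> nat list" where
  "tree_step n s w = (if act s w \<in> tree_ball n then act s w else w)"

definition gen_fun :: "nat \<Rightarrow> nat \<Rightarrow> nat \<Rightarrow> nat" where
  "gen_fun n s k = (if k \<in> to_nat ` tree_ball n then to_nat (tree_step n s (from_nat k)) else k)"

definition gen :: "nat \<Rightarrow> nat \<Rightarrow> fsym" where
  "gen n s = (SOME g. apply g = gen_fun n s)"

lemma finite_tree_ball: "finite (tree_ball n)"
  by (rule finite_subset[OF _ finite_lists_length_le[of "{..<5::nat}" n]]) (auto simp: tree_ball_def)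

lemma tree_step: "w \<in> tree_ball n \<Longrightarrow> tree_step n s w \<in> tree_ball n \<and> tree_step n s (tree_step n s w) = w"
  using act_act[of w s] by (auto simp: tree_step_def tree_ball_def)

lemma gen_fun_involution: "gen_fun n s (gen_fun n s k) = k"
  using tree_step by (fastforce simp: gen_fun_def)

lemma apply_gen: "apply (gen n s) = gen_fun n s"
proof -
  obtain N where N: "to_nat ` tree_ball n \<subseteq> {..<N}"
    using finite_tree_ball[of n] by (meson finite_imageI finite_nat_iff_bounded)
  have "\<exists>g::fsym. apply g = gen_fun n s"
    by (rule ex_perm_involution[of _ N, OF gen_fun_involution]) (use N in \<open>force simp: gen_fun_def\<close>)
  then show ?thesis unfolding gen_def by (rule someI_ex)
qed

lemma gen_gen: "gen n s * gen n s = 1"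
  by (rule perm_eqI) (simp add: apply_times apply_gen gen_fun_involution)

fun word_perm :: "nat \<Rightarrow> nat list \<Rightarrow> fsym" where
  "word_perm n [] = 1"
| "word_perm n (s # w) = gen n s * word_perm n w"

lemma word_perm_append: "word_perm n (v @ w) = word_perm n v * word_perm n w"
  by (induction v) (simp_all add: mult.assoc)

lemma word_perm_rev: "word_perm n (rev w) = inverse (word_perm n w)"
proof -
  have "word_perm n (rev w) * word_perm n w = 1"
    by (induction w) (simp_all add: word_perm_append mult.assoc, simp add: mult.assoc[symmetric] gen_gen)
  then have "word_perm n (rev w) * word_perm n w * inverse (word_perm n w) = inverse (word_perm n w)" by simp
  then show ?thesis by simp
qed

lemma apply_word_perm: "w \<in> tree_ball n \<Longrightarrow> apply (word_perm n w) (to_nat ([] :: nat list)) = to_nat w"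
proof (induction w)
  case (Cons s w)
  then have w: "w \<in> tree_ball n" by (auto simp: tree_ball_def dest: distinct_adj_ConsD)
  have "act s w = s # w" using Cons.prems by (cases w) (auto simp: tree_ball_def)
  then show ?case
    using Cons w by (simp add: apply_times apply_gen gen_fun_def tree_step_def)
qed simp

lemma word_perm_inj: "v \<in> tree_ball n \<Longrightarrow> w \<in> tree_ball n \<Longrightarrow> word_perm n v = word_perm n w \<longleftrightarrow> v = w"
  using apply_word_perm by (metis to_nat_split inj_eq inj_to_nat)

lemma lam_one_fun: "lam 1 = (\<lambda>x. x)"
  by (rule ext) simp

lemma sum_pairs: "(\<Sum>p\<in>A \<times> B. f (fst p) (snd p)) = (\<Sum>a\<in>A. \<Sum>b\<in>B. f a b)"
  by (simp add: sum.cartesian_product case_prod_unfold)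

text \<open>The unitaries of the ultrapower given by the words.\<close>

definition Uw :: "nat list \<Rightarrow> hN \<Rightarrow> hN" where
  "Uw w = Lam (\<lambda>i. lam (word_perm i w))"

lemma Uw_N: "Uw w \<in> NN.N"
  unfolding Uw_def by (rule Lam_in_N[OF linf_lam])

lemma Uw_append: "Uw (v @ w) h = Uw v (Uw w h)"
proof -
  have "Uw v (Uw w h) = Lam (\<lambda>i x. lam (word_perm i v) (lam (word_perm i w) x)) h"
    unfolding Uw_def by (rule Lam_comp[OF linf_lam linf_lam, symmetric])
  then show ?thesis by (simp add: Uw_def lam_lam word_perm_append)
qed

lemma Uw_Nil: "Uw [] h = h"
  by (simp add: Uw_def lam_one_fun Lam_id)

lemma Uw_square: "Uw [s] (Uw [s] h) = h"
  using Uw_append[of "[s]" "[s]" h] by (simp add: Uw_def gen_gen lam_one_fun Lam_id)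

lemma Uw_act: "Uw (act s w) h = Uw [s] (Uw w h)"
proof (cases w)
  case Nil then show ?thesis by (simp add: Uw_Nil)
next
  case (Cons t u)
  have "Uw (t # u) h = Uw [t] (Uw u h)" using Uw_append[of "[t]" u h] by simp
  then show ?thesis
    using Uw_append[of "[s]" "t # u" h] by (simp add: Cons Uw_square)
qed

lemma Uw_red: "Uw (red w) h = Uw w h"
proof (induction w arbitrary: h)
  case (Cons s w)
  then show ?case using Uw_append[of "[s]" w h] by (simp add: Uw_act)
qed simp

lemma adj_Uw: "adj (Uw w) = Uw (rev w)"
  unfolding Uw_def by (simp add: Lam_adj linf_lam adj_lam word_perm_rev)

lemma Uw_inner: "Uw w x \<bullet> y = x \<bullet> Uw (rev w) y"
  using adj_inner[OF clinD(1)[OF NN.N_clin[OF Uw_N[of w]]]] by (simp add: adj_Uw)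

lemma Uw_isometry: "norm (Uw w x) = norm x"
proof -
  have "Uw (rev w) (Uw w x) = Uw (rev w @ w) x" by (simp add: Uw_append)
  also have "\<dots> = x"
    by (simp add: Uw_def word_perm_append word_perm_rev perm.left_inverse lam_one_fun Lam_id)
  finally have "Uw w x \<bullet> Uw w x = x \<bullet> x" by (simp add: Uw_inner)
  then show ?thesis by (simp add: norm_eq_sqrt_inner)
qed

lemma Uw_orth:
  assumes "distinct_adj v" "distinct_adj w" "set v \<subseteq> {..<5}" "set w \<subseteq> {..<5}"
  shows "Uw v OmN \<bullet> Uw w OmN = (if v = w then 1 else 0)"
  unfolding Uw_def
proof (rule Lam_lam_inner)
  fix i assume "max (length v) (length w) \<le> i"
  then show "word_perm i v = word_perm i w \<longleftrightarrow> v = w"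
    using assms by (intro word_perm_inj) (auto simp: tree_ball_def)
qed

section \<open>The ultrapower is not hyperfinite\<close>

text \<open>The Hilbert-Schmidt inner product of the projection onto the span of \<open>E\<close> and its conjugate by \<open>Uw w\<close>.\<close>

definition Qw :: "hN set \<Rightarrow> nat list \<Rightarrow> real" where
  "Qw E w = (\<Sum>a\<in>E. \<Sum>b\<in>E. (Uw w a \<bullet> b)\<^sup>2)"

lemma Qw_nonneg: "Qw E w \<ge> 0"
  unfolding Qw_def by (intro sum_nonneg) simp

text \<open>By the trace property \<open>Uw g a \<bullet> b\<close> is the coefficient at the orthonormal vector \<open>Uw (rev g) OmN\<close> of a vector
  that does not depend on \<open>g\<close>, so Bessel's inequality applies.\<close>

lemma Qw_summable:
  assumes E: "E \<subseteq> (\<lambda>T. T OmN) ` NN.N"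
  shows "\<exists>C. \<forall>G. finite G \<and> (\<forall>g\<in>G. distinct_adj g \<and> set g \<subseteq> {..<5}) \<longrightarrow> (\<Sum>g\<in>G. Qw E g) \<le> C"
proof -
  have pair: "\<exists>u. \<forall>g. Uw g a \<bullet> b = u \<bullet> Uw (rev g) OmN" if ab: "a \<in> E" "b \<in> E" for a b
  proof -
    obtain X Y where X: "X \<in> NN.N" "a = X OmN" and Y: "Y \<in> NN.N" "b = Y OmN" using ab E by blast
    have "Uw g a \<bullet> b = X (adj Y OmN) \<bullet> Uw (rev g) OmN" for g
    proof -
      have "Uw g a \<bullet> b = Re (cip (adj Y (Uw g (X OmN))) OmN)"
        using Y by (simp add: X adj_inner' NN.N_clin clinD)
      also have "\<dots> = Re (cip (Uw g (X (adj Y OmN))) OmN)"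
        using NN.trace_comm[OF NN.N_adj[OF Y(1)] NN.N_comp[OF Uw_N[of g] X(1)]] by simp
      also have "\<dots> = X (adj Y OmN) \<bullet> Uw (rev g) OmN" by (simp add: Uw_inner)
      finally show ?thesis .
    qed
    then show ?thesis by blast
  qed
  then have "\<forall>p. \<exists>u. p \<in> E \<times> E \<longrightarrow> (\<forall>g. Uw g (fst p) \<bullet> snd p = u \<bullet> Uw (rev g) OmN)" by auto
  then obtain u where u: "\<And>p g. p \<in> E \<times> E \<Longrightarrow> Uw g (fst p) \<bullet> snd p = u p \<bullet> Uw (rev g) OmN"
    by (metis (no_types))
  have bound: "(\<Sum>g\<in>G. Qw E g) \<le> (\<Sum>p\<in>E \<times> E. (norm (u p))\<^sup>2)"
    if G: "finite G" "\<And>g. g \<in> G \<Longrightarrow> distinct_adj g \<and> set g \<subseteq> {..<5}" for G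
  proof -
    let ?f = "\<lambda>g. Uw (rev g) OmN"
    have ff: "?f g \<bullet> ?f h = (if g = h then 1 else 0)" if "g \<in> G" "h \<in> G" for g h
      using Uw_orth[of "rev g" "rev h"] G(2)[OF that(1)] G(2)[OF that(2)] by simp
    have inj: "inj_on ?f G"
      by (rule inj_onI) (metis ff zero_neq_one)
    have "orthonormal (?f ` G)"
      unfolding orthonormal_def using G(1) by (auto simp: ff dest: inj_onD[OF inj])
    then have bes: "(\<Sum>g\<in>G. (u p \<bullet> ?f g)\<^sup>2) \<le> (norm (u p))\<^sup>2" for p
      using bessel[of "?f ` G" "u p"] by (simp add: sum.reindex[OF inj])
    have "(\<Sum>g\<in>G. Qw E g) = (\<Sum>g\<in>G. \<Sum>p\<in>E \<times> E. (u p \<bullet> ?f g)\<^sup>2)"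
      unfolding Qw_def sum.cartesian_product
      by (intro sum.cong refl) (use u in \<open>auto simp: case_prod_unfold\<close>)
    also have "\<dots> = (\<Sum>p\<in>E \<times> E. \<Sum>g\<in>G. (u p \<bullet> ?f g)\<^sup>2)" by (rule sum.swap)
    also have "\<dots> \<le> (\<Sum>p\<in>E \<times> E. (norm (u p))\<^sup>2)" by (intro sum_mono bes)
    finally show ?thesis .
  qed
  show ?thesis
  proof (intro exI allI impI)
    fix G :: "nat list set" assume "finite G \<and> (\<forall>g\<in>G. distinct_adj g \<and> set g \<subseteq> {..<5})"
    then show "(\<Sum>g\<in>G. Qw E g) \<le> (\<Sum>p\<in>E \<times> E. (norm (u p))\<^sup>2)" by (intro bound) auto
  qed
qed

text \<open>Cauchy-Schwarz between the projection onto the span of \<open>E\<close> and the sum of its conjugates by the words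
  of length \<open>n\<close>; the square of the latter involves the conjugates by words of length \<open>2 n\<close>.\<close>

lemma Qw_square:
  assumes E: "orthonormal E"
  shows "(\<Sum>w\<in>wds n. Qw E w)\<^sup>2 \<le> (\<Sum>w\<in>wds (2 * n). Qw E w) * card E"
proof -
  note fE = orthonormalD(1)[OF E]
  have gcs: "(\<Sum>p\<in>wds n \<times> E. \<Sum>b\<in>E. (Uw (fst p) (snd p) \<bullet> b)\<^sup>2)\<^sup>2 \<le>
    (\<Sum>p\<in>wds n \<times> E. \<Sum>q\<in>wds n \<times> E. (Uw (fst p) (snd p) \<bullet> Uw (fst q) (snd q))\<^sup>2) * (\<Sum>b\<in>E. \<Sum>b'\<in>E. (b \<bullet> b')\<^sup>2)"
    by (rule gram_cauchy_schwarz) (simp_all add: fE finite_wds)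
  have e1: "(\<Sum>p\<in>wds n \<times> E. \<Sum>b\<in>E. (Uw (fst p) (snd p) \<bullet> b)\<^sup>2) = (\<Sum>w\<in>wds n. Qw E w)"
    unfolding Qw_def by (rule sum_pairs[of "\<lambda>w a. \<Sum>b\<in>E. (Uw w a \<bullet> b)\<^sup>2"])
  have e2: "(\<Sum>b\<in>E. \<Sum>b'\<in>E. (b \<bullet> b')\<^sup>2) = card E"
  proof -
    have "(\<Sum>b\<in>E. \<Sum>b'\<in>E. (b \<bullet> b')\<^sup>2) = (\<Sum>b\<in>E. \<Sum>b'\<in>E. if b' = b then 1 else 0)"
      by (intro sum.cong refl) (use orthonormalD(2)[OF E] in auto)
    then show ?thesis by (simp add: fE)
  qed
  have e3: "(\<Sum>p\<in>wds n \<times> E. \<Sum>q\<in>wds n \<times> E. (Uw (fst p) (snd p) \<bullet> Uw (fst q) (snd q))\<^sup>2) \<le> (\<Sum>w\<in>wds (2 * n). Qw E w)"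
  proof -
    have inner: "(\<Sum>q\<in>wds n \<times> E. (h \<bullet> Uw (fst q) (snd q))\<^sup>2) = (\<Sum>w\<in>wds n. \<Sum>b\<in>E. (h \<bullet> Uw w b)\<^sup>2)" for h
      by (rule sum_pairs[of "\<lambda>w b. (h \<bullet> Uw w b)\<^sup>2"])
    have "(\<Sum>p\<in>wds n \<times> E. \<Sum>q\<in>wds n \<times> E. (Uw (fst p) (snd p) \<bullet> Uw (fst q) (snd q))\<^sup>2) =
       (\<Sum>v\<in>wds n. \<Sum>a\<in>E. \<Sum>w\<in>wds n. \<Sum>b\<in>E. (Uw v a \<bullet> Uw w b)\<^sup>2)"
      unfolding inner by (rule sum_pairs[of "\<lambda>v a. \<Sum>w\<in>wds n. \<Sum>b\<in>E. (Uw v a \<bullet> Uw w b)\<^sup>2"])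
    also have "\<dots> = (\<Sum>v\<in>wds n. \<Sum>w\<in>wds n. \<Sum>a\<in>E. \<Sum>b\<in>E. (Uw v a \<bullet> Uw w b)\<^sup>2)"
      by (intro sum.cong refl) (rule sum.swap)
    also have "\<dots> = (\<Sum>v\<in>wds n. \<Sum>w\<in>wds n. Qw E (rev w @ v))"
      unfolding Qw_def Uw_append by (intro sum.cong refl) (simp add: Uw_inner[of "rev _"])
    also have "\<dots> = (\<Sum>p\<in>wds n \<times> wds n. Qw E (rev (snd p) @ fst p))"
      by (rule sum_pairs[symmetric])
    also have "\<dots> = sum (Qw E) ((\<lambda>p. rev (snd p) @ fst p) ` (wds n \<times> wds n))"
    proof (rule sum.reindex[symmetric, unfolded o_def])
      show "inj_on (\<lambda>p. rev (snd p) @ fst p) (wds n \<times> wds n)"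
        by (auto simp: inj_on_def wds_def)
    qed
    also have "\<dots> \<le> (\<Sum>w\<in>wds (2 * n). Qw E w)"
      by (rule sum_mono2[OF finite_wds]) (auto simp: Qw_nonneg wds_def)
    finally show ?thesis .
  qed
  show ?thesis
    by (rule order_trans[OF gcs[unfolded e1 e2] mult_right_mono[OF e3]]) simp
qed

text \<open>On the ideal found above the five generators almost preserve the projection, so the sums of \<open>Qw\<close> over
  words of length \<open>n = 2^j\<close> grow at least like \<open>(9/2)^n\<close>.  But \<open>Qw\<close> is summable over reduced words, and at most
  \<open>4^n\<close> words of length \<open>n\<close> have a given reduction.\<close>

theorem NN_not_hyperfinite:
  assumes B: "B \<subseteq> NN.N" "star_subalg B" "findim B"
    and near: "\<And>s. s < 5 \<Longrightarrow> \<exists>y\<in>B. norm (Uw [s] OmN - y OmN) < 3/10"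
  shows False
proof -
  have "\<forall>s. \<exists>y. s < 5 \<longrightarrow> y \<in> B \<and> norm (Uw [s] OmN - y OmN) < 3/10" using near by blast
  then have "\<exists>y. \<forall>s. s < 5 \<longrightarrow> y s \<in> B \<and> norm (Uw [s] OmN - y s OmN) < 3/10" by (rule choice)
  then obtain y where y: "\<And>s. s < 5 \<Longrightarrow> y s \<in> B" "\<And>s. s < 5 \<Longrightarrow> norm (Uw [s] OmN - y s OmN) < 3/10" by blast
  define X where "X s v = Uw [s] v - y s v" for s v
  have XN: "X s \<in> NN.N" if "s \<in> {..<5}" for s
    unfolding X_def[abs_def] using NN.N_diff[OF Uw_N, of "y s" "[s]"] y(1) that B(1) by auto
  \<comment> \<open>the tolerance \<open>3/10\<close> is chosen so that \<open>5 * (3/10)^2 \<le> 1/2\<close>, whence \<open>5 - 1/2 > 4\<close> below\<close>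
  have \<delta>: "(\<Sum>s<5. (norm (X s OmN))\<^sup>2) \<le> 1/2"
  proof -
    have "(norm (X s OmN))\<^sup>2 \<le> (3/10)\<^sup>2" if "s \<in> {..<5}" for s
      unfolding X_def using y(2)[of s] that by (intro power_mono) auto
    then have "(\<Sum>s<5. (norm (X s OmN))\<^sup>2) \<le> (\<Sum>s<5::nat. (3/10)\<^sup>2)" by (rule sum_mono)
    then show ?thesis by (simp add: power_divide)
  qed
  obtain E where E: "orthonormal E" "E \<noteq> {}" and EW: "E \<subseteq> (\<lambda>b. b OmN) ` B"
    and inv: "\<And>b v. b \<in> B \<Longrightarrow> v \<in> span E \<Longrightarrow> b v \<in> span E"
    and HS: "(\<Sum>s<5. \<Sum>e\<in>E. (norm (X s e))\<^sup>2) \<le> 1/2 * card E"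
    using NN.ex_good_ideal[OF B, of "{..<5}" X "1/2", OF XN \<delta>] unfolding NN.W_def[OF B] by blast
  define d where "d = real (card E)"
  have d: "d > 0" using E orthonormalD(1)[OF E(1)] by (simp add: d_def card_gt_0_iff)
  define a where "a n = (\<Sum>w\<in>wds n. Qw E w)" for n
  have EN: "E \<subseteq> (\<lambda>T. T OmN) ` NN.N" by (rule subset_trans[OF EW image_mono[OF B(1)]])
  obtain C where C0: "\<forall>G. finite G \<and> (\<forall>g\<in>G. distinct_adj g \<and> set g \<subseteq> {..<5}) \<longrightarrow> (\<Sum>g\<in>G. Qw E g) \<le> C"
    using Qw_summable[OF EN] by (elim exE)
  have C: "(\<Sum>g\<in>G. Qw E g) \<le> C" if "finite G" "\<And>g. g \<in> G \<Longrightarrow> distinct_adj g \<and> set g \<subseteq> {..<5}" for G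
    using C0 that by simp
  have upper: "a n \<le> 4 ^ n * C" for n
  proof -
    have "Qw E (red w) = Qw E w" for w by (simp add: Qw_def Uw_red)
    then show ?thesis using sum_over_reduced[of "Qw E" C n] C Qw_nonneg by (simp add: a_def)
  qed
  have Q1: "Qw E [s] \<ge> d - (\<Sum>e\<in>E. (norm (X s e))\<^sup>2)" if s: "s < 5" for s
  proof -
    have "(\<Sum>e\<in>E. 1 - (norm (X s e))\<^sup>2) \<le> Qw E [s]"
      unfolding Qw_def
    proof (rule sum_mono)
      fix e assume e: "e \<in> E"
      have "norm e = 1" using orthonormalD(2)[OF E(1) e e] by (simp add: norm_eq_sqrt_inner)
      then show "1 - (norm (X s e))\<^sup>2 \<le> (\<Sum>b\<in>E. (Uw [s] e \<bullet> b)\<^sup>2)"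
        using norm_proj_ge[OF E(1) inv[OF y(1)[OF s] span_base[OF e]], of "Uw [s] e"]
        by (simp add: Uw_isometry X_def)
    qed
    then show ?thesis by (simp add: sum_subtractf d_def)
  qed
  have a1: "a 1 \<ge> 9/2 * d"
  proof -
    have w1: "wds 1 = (\<lambda>s. [s]) ` {..<5}" by (auto simp: wds_def length_Suc_conv image_iff)
    have "a 1 = (\<Sum>s<5. Qw E [s])" unfolding a_def w1 by (subst sum.reindex) (auto simp: inj_on_def)
    also have "\<dots> \<ge> (\<Sum>s<5. d - (\<Sum>e\<in>E. (norm (X s e))\<^sup>2))" by (rule sum_mono) (simp add: Q1)
    finally show ?thesis using HS by (simp add: sum_subtractf d_def)
  qed
  have lower: "a (2 ^ j) \<ge> d * (9/2) ^ (2 ^ j)" for j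
  proof (induction j)
    case 0 then show ?case using a1 by simp
  next
    case (Suc j)
    have "(d * (9/2) ^ (2 ^ j))\<^sup>2 \<le> (a (2 ^ j))\<^sup>2" using Suc d by (intro power_mono) auto
    also have "\<dots> \<le> a (2 ^ Suc j) * d" using Qw_square[OF E(1), of "2 ^ j"] by (simp add: a_def d_def)
    finally have "d * (d * (9/2) ^ (2 ^ Suc j)) \<le> d * a (2 ^ Suc j)"
      by (simp add: power2_eq_square power_mult_distrib power_add[symmetric] mult_2 ac_simps)
    then show ?case using d by simp
  qed
  obtain j where j: "C / d < (9/8) ^ j" using real_arch_pow[of "9/8" "C/d"] by auto
  have "(9/8::real) ^ j \<le> (9/8) ^ (2 ^ j)" by (intro power_increasing) (auto simp: less_imp_le)
  then have "(9/8) ^ j * d \<le> (9/8) ^ (2 ^ j) * d" using d by (intro mult_right_mono) auto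
  then have "C < (9/8) ^ (2 ^ j) * d" using j unfolding pos_divide_less_eq[OF d] by (rule order.strict_trans2[rotated])
  then have "C < d * (9/8) ^ (2 ^ j)" by (simp only: mult.commute)
  then have "4 ^ (2 ^ j) * C < 4 ^ (2 ^ j) * (d * (9/8) ^ (2 ^ j))" by simp
  also have "\<dots> = d * (9/2) ^ (2 ^ j)" by (simp add: power_mult_distrib[symmetric] mult.left_commute[of _ d])
  finally show False using lower[of j] upper[of "2 ^ j"] by linarith
qed

section \<open>Cardinalities\<close>

lemma ex_inj_real_nat_set: "\<exists>f :: real \<Rightarrow> nat set. inj f" and ex_inj_nat_set_real: "\<exists>f :: nat set \<Rightarrow> real. inj f"
proof -
  have "(UNIV::real set) \<lesssim> (UNIV::nat set set)"
    using eqpoll_sym[OF nat_sets_eqpoll_reals] by (rule eqpoll_imp_lepoll)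
  then show "\<exists>f :: real \<Rightarrow> nat set. inj f" by (auto simp: lepoll_def)
  have "(UNIV::nat set set) \<lesssim> (UNIV::real set)"
    using nat_sets_eqpoll_reals by (rule eqpoll_imp_lepoll)
  then show "\<exists>f :: nat set \<Rightarrow> real. inj f" by (auto simp: lepoll_def)
qed

lemma inj_pairing: "inj (\<lambda>F :: nat \<Rightarrow> nat set. {prod_encode (i, k) | i k. k \<in> F i})"
proof (rule injI, rule ext)
  fix F G :: "nat \<Rightarrow> nat set" and i
  assume e: "{prod_encode (i, k) | i k. k \<in> F i} = {prod_encode (i, k) | i k. k \<in> G i}"
  have m: "k \<in> F i \<longleftrightarrow> prod_encode (i, k) \<in> {prod_encode (i, k) | i k. k \<in> F i}" for k F
    by auto
  show "F i = G i"
  proof (rule Set.set_eqI)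
    fix k
    show "k \<in> F i \<longleftrightarrow> k \<in> G i" using m[of k F] m[of k G] unfolding e by blast
  qed
qed

lemma ex_inj_real_of_nat_fun:
  fixes F :: "'b \<Rightarrow> nat \<Rightarrow> real"
  assumes "inj F" shows "\<exists>f :: 'b \<Rightarrow> real. inj f"
proof -
  obtain r :: "real \<Rightarrow> nat set" where r: "inj r" using ex_inj_real_nat_set by blast
  obtain s :: "nat set \<Rightarrow> real" where s: "inj s" using ex_inj_nat_set_real by blast
  have "inj (\<lambda>x. r \<circ> F x)"
  proof (rule injI)
    fix x y assume e: "r \<circ> F x = r \<circ> F y"
    have "F x n = F y n" for n using fun_cong[OF e, of n] injD[OF r] by simp
    then show "x = y" by (intro injD[OF assms] ext)
  qed
  from inj_compose[OF s inj_compose[OF inj_pairing this]] show ?thesis by blast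
qed

lemma countable_fsym: "countable (UNIV :: fsym set)"
proof -
  have "g \<in> (\<Union>n. {g. affected g \<subseteq> {..<n}})" for g :: fsym
  proof -
    obtain n where "affected g \<subseteq> {..<n}" using finite_affected[of g] unfolding finite_nat_iff_bounded by blast
    then show ?thesis by blast
  qed
  then have U: "(UNIV :: fsym set) = (\<Union>n. {g. affected g \<subseteq> {..<n}})" by blast
  show ?thesis unfolding U
    by (rule countable_UN[OF countableI_type]) (rule countable_finite, rule finite_perms_affected, simp)
qed

text \<open>The group is countable, so vectors are sequences of reals; even and odd positions hold real and
  imaginary parts.\<close>

lemma ex_inj_l2_real: "\<exists>f :: fsym l2 \<Rightarrow> real. inj f"
proof -
  define e :: "fsym \<Rightarrow> nat" where "e = to_nat_on UNIV"
  have e: "inj e" unfolding e_def by (rule inj_on_to_nat_on[OF countable_fsym])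
  define F :: "fsym l2 \<Rightarrow> nat \<Rightarrow> real" where
    "F x n = (let g = inv_into UNIV e (n div 2) in if even n then Re (coef x g) else Im (coef x g))" for x n
  have "F x (2 * e g) = Re (coef x g)" "F x (2 * e g + 1) = Im (coef x g)" for x g
    using inv_f_f[OF e] by (simp_all add: F_def Let_def)
  then have "inj F"
    by (intro injI l2_eqI complex_eqI) metis+
  then show ?thesis by (rule ex_inj_real_of_nat_fun)
qed

lemma ex_inj_hN_real: "\<exists>f :: hN \<Rightarrow> real. inj f"
proof -
  obtain f :: "fsym l2 \<Rightarrow> real" where f: "inj f" using ex_inj_l2_real by blast
  have "inj (\<lambda>h. f \<circ> rep_hN h)"
  proof (rule injI)
    fix h k assume "f \<circ> rep_hN h = f \<circ> rep_hN k"
    then have "rep_hN h i = rep_hN k i" for i using injD[OF f] by (simp add: fun_eq_iff)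
    then have "rep_hN h = rep_hN k" by (rule ext)
    then have "cls (rep_hN h) = cls (rep_hN k)" by simp
    then show "h = k" by simp
  qed
  then show ?thesis by (rule ex_inj_real_of_nat_fun)
qed

section \<open>Identification with the ultrapower\<close>

context
  fixes jM :: "fsym l2 \<Rightarrow> 'v" and jN :: "hN \<Rightarrow> 'v" and jI :: "nat \<Rightarrow> 'v"
  assumes jM: "inj jM" and jN: "inj jN" and jI: "inj jI"
begin

abbreviation "MM \<equiv> talg jM R.N e0"
abbreviation "linfM \<equiv> l_infinity (range jI) MM"
abbreviation "UI \<equiv> filtermap jI UF"

text \<open>The bounded sequences indexed by the copy \<open>range jI\<close> of the natural numbers in the universe.\<close>

definition code :: "(nat \<Rightarrow> fsym l2 \<Rightarrow> fsym l2) \<Rightarrow> 'v \<Rightarrow> 'v \<Rightarrow> 'v" where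
  "code y = (\<lambda>i\<in>range jI. op_of jM (y (dec jI i)))"

lemma code_apply [simp]: "code y (jI n) = op_of jM (y n)"
  by (simp add: code_def jI)

lemma code_inject: "code y = code z \<longleftrightarrow> y = z"
proof
  assume e: "code y = code z"
  have "y n = z n" for n using fun_cong[OF e, of "jI n"] by (simp add: op_of_eq_iff jM)
  then show "y = z" by (rule ext)
qed simp

lemma ultrafilter_UI: "ultrafilter_on (range jI) UI"
  unfolding ultrafilter_on_def
  using UF by (auto simp: filtermap_bot_iff eventually_filtermap)

lemma carrier_linfM: "carrier linfM = code ` linf"
proof (intro equalityI subsetI)
  fix x assume "x \<in> carrier linfM"
  then have xE: "x \<in> range jI \<rightarrow>\<^sub>E op_of jM ` R.N" and "\<exists>C. \<forall>i\<in>range jI. op_norm (hilb_of jM) (x i) \<le> C"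
    by (simp_all add: l_infinity_def Let_def)
  then obtain C where C: "\<And>n. op_norm (hilb_of jM) (x (jI n)) \<le> C" by blast
  have "\<forall>n. \<exists>T. T \<in> R.N \<and> x (jI n) = op_of jM T" using xE by (auto dest!: PiE_mem)
  then have "\<exists>y. \<forall>n. y n \<in> R.N \<and> x (jI n) = op_of jM (y n)" by (rule choice)
  then obtain y where y: "\<And>n. y n \<in> R.N" "\<And>n. x (jI n) = op_of jM (y n)" by blast
  have "y \<in> linf"
    by (rule linfI[OF y(1)]) (rule op_norm_op_of_ge[OF jM R.N_clin[OF y(1)] C[unfolded y(2)]])
  moreover have "x = code y"
  proof
    fix i show "x i = code y i"
    proof (cases "i \<in> range jI")
      case True
      then obtain n where "i = jI n" by blast
      then show ?thesis by (simp add: y)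
    next
      case False
      then show ?thesis using PiE_arb[OF xE False] by (simp add: code_def)
    qed
  qed
  ultimately show "x \<in> code ` linf" by blast
next
  fix x assume "x \<in> code ` linf"
  then obtain y where y: "y \<in> linf" "x = code y" by blast
  obtain K where K: "K \<ge> 0" "\<forall>i v. norm (y i v) \<le> K * norm v" using linf_bound[OF y(1)] by blast
  have "op_norm (hilb_of jM) (x i) \<le> K" if "i \<in> range jI" for i
    using that op_norm_op_of_le[OF jM, of _ K] K by (auto simp: y(2))
  moreover have "x \<in> range jI \<rightarrow>\<^sub>E op_of jM ` R.N"
    unfolding y(2) code_def using linf_N[OF y(1)] by auto
  ultimately show "x \<in> carrier linfM" by (auto simp: l_infinity_def Let_def)
qed

lemma linfM_ops:
  "code y \<oplus>\<^bsub>linfM\<^esub> code z = code (\<lambda>i v. y i v + z i v)"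
  "code y \<otimes>\<^bsub>linfM\<^esub> code z = code (\<lambda>i v. y i (z i v))"
  "\<one>\<^bsub>linfM\<^esub> = code (\<lambda>i v. v)"
  "c \<odot>\<^bsub>linfM\<^esub> code y = code (\<lambda>i v. scaleC c (y i v))"
  "y \<in> linf \<Longrightarrow> star linfM (code y) = code (\<lambda>i. adj (y i))"
  using jM jI by (auto simp: l_infinity_def Let_def code_def fun_eq_iff restrict_def linf_clin)

definition kerM where
  "kerM = {x \<in> carrier linfM. ((\<lambda>i. norm2 MM (x i)) \<longlongrightarrow> 0) UI}"

lemma Lam_eq_iff: assumes "y \<in> linf" "z \<in> linf"
  shows "Lam y = Lam z \<longleftrightarrow> null_seq (\<lambda>i. y i e0 - z i e0)"
proof -
  have "Lam y = Lam z \<longleftrightarrow> Lam y OmN = Lam z OmN"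
    using NN.N_eqI[OF Lam_in_N[OF assms(1)] Lam_in_N[OF assms(2)]] by auto
  then show ?thesis using assms cls_eq_iff[OF X0_linf[OF assms(1)] X0_linf[OF assms(2)]]
    by (simp add: Lam_OmN)
qed

lemma Lam_zero: "Lam (\<lambda>i v. 0) h = 0"
  by (simp add: Lam_def cls_zero)

lemma Lam_diff: assumes "y \<in> linf" "z \<in> linf" shows "Lam (\<lambda>i v. y i v - z i v) h = Lam y h - Lam z h"
proof -
  obtain \<xi> where "\<xi> \<in> X0" "h = cls \<xi>" by (rule cls_cases)
  then show ?thesis using assms by (simp add: Lam_cls linf_diff X0_op cls_diff)
qed

lemma kerM: "kerM = {code y | y. y \<in> linf \<and> Lam y = (\<lambda>h. 0)}"
proof -
  have "((\<lambda>i. norm2 MM (code y i)) \<longlongrightarrow> 0) UI \<longleftrightarrow> Lam y = (\<lambda>h. 0)" if y: "y \<in> linf" for y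
  proof -
    have "Lam y = (\<lambda>h. 0) \<longleftrightarrow> Lam y = Lam (\<lambda>i v. 0)" by (simp add: Lam_zero[abs_def])
    also have "\<dots> \<longleftrightarrow> null_seq (\<lambda>i. y i e0)" using Lam_eq_iff[OF y linf_const[OF R.N_zero]] by simp
    finally show ?thesis
      by (simp add: filterlim_filtermap null_seq_def R.norm2_op_of[OF jM] linf_N[OF y])
  qed
  then show ?thesis unfolding kerM_def carrier_linfM by auto
qed

text \<open>The isomorphism onto the ultrapower: the coset of all bounded sequences that represent an operator.\<close>

definition lifts :: "('v \<Rightarrow> 'v) \<Rightarrow> ('v \<Rightarrow> 'v \<Rightarrow> 'v) set" where
  "lifts X = {code y | y. y \<in> linf \<and> op_of jN (Lam y) = X}"

lemma lifts_op_of: "lifts (op_of jN T) = {code y | y. y \<in> linf \<and> Lam y = T}"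
  by (simp add: lifts_def op_of_eq_iff jN)

lemma coset_code: assumes y: "y \<in> linf" shows "kerM +>\<^bsub>linfM\<^esub> code y = lifts (op_of jN (Lam y))"
proof (intro equalityI subsetI)
  fix x assume "x \<in> kerM +>\<^bsub>linfM\<^esub> code y"
  then obtain w where w: "w \<in> linf" "Lam w = (\<lambda>h. 0)" "x = code w \<oplus>\<^bsub>linfM\<^esub> code y"
    by (auto simp: a_r_coset_def' kerM)
  have "Lam (\<lambda>i v. w i v + y i v) = Lam y" by (rule ext) (simp add: Lam_add w y)
  then show "x \<in> lifts (op_of jN (Lam y))"
    unfolding lifts_op_of using linf_add[OF w(1) y] w(3) by (auto simp: linfM_ops)
next
  fix x assume "x \<in> lifts (op_of jN (Lam y))"
  then obtain z where z: "z \<in> linf" "Lam z = Lam y" "x = code z" by (auto simp: lifts_op_of)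
  define w where "w = (\<lambda>i v. z i v - y i v)"
  have w: "w \<in> linf" unfolding w_def by (rule linf_diff[OF z(1) y])
  have "Lam w = (\<lambda>h. 0)" unfolding w_def by (rule ext) (simp add: Lam_diff z y)
  then have "code w \<in> kerM" using w by (auto simp: kerM)
  moreover have "x = code w \<oplus>\<^bsub>linfM\<^esub> code y"
    by (simp add: linfM_ops z(3) w_def)
  ultimately show "x \<in> kerM +>\<^bsub>linfM\<^esub> code y" by (auto simp: a_r_coset_def')
qed

lemma NN_cases: assumes "X \<in> op_of jN ` NN.N" obtains y where "y \<in> linf" "X = op_of jN (Lam y)"
  using assms NN_eq by auto

text \<open>The operations of the quotient are unions over representatives; all members of the union coincide.\<close>

lemma UN_lifts:
  assumes y: "y \<in> linf" and f: "\<And>z. z \<in> linf \<Longrightarrow> Lam z = Lam y \<Longrightarrow> f (code z) = A"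
  shows "(\<Union>x\<in>lifts (op_of jN (Lam y)). f x) = A"
proof -
  have "code y \<in> lifts (op_of jN (Lam y))" using y by (auto simp: lifts_op_of)
  moreover have "f x = A" if "x \<in> lifts (op_of jN (Lam y))" for x using that f by (auto simp: lifts_op_of)
  ultimately show ?thesis by blast
qed

abbreviation "NV \<equiv> talg jN NN.N OmN"

lemma ultrapower_iso: "star_isomorphic (algebra_of NV) (ultrapower MM (range jI) UI)"
proof -
  let ?P = "ultrapower MM (range jI) UI"
  have P: "?P = star_quotient linfM kerM" by (simp add: ultrapower_def kerM_def)
  have carP: "carrier ?P = lifts ` op_of jN ` NN.N"
    unfolding P star_quotient_def FactRing_def
    by (auto simp: A_RCOSETS_def' carrier_linfM coset_code NN_eq)
  have comp: "op_of jN (Lam y) \<otimes>\<^bsub>algebra_of NV\<^esub> op_of jN (Lam z) = op_of jN (Lam (\<lambda>i v. y i (z i v)))"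
    if "y \<in> linf" "z \<in> linf" for y z
  proof -
    have "(\<lambda>h. Lam y (Lam z h)) = Lam (\<lambda>i v. y i (z i v))" by (rule ext) (simp add: Lam_comp that)
    then show ?thesis using jN by simp
  qed
  have add: "op_of jN (Lam y) \<oplus>\<^bsub>algebra_of NV\<^esub> op_of jN (Lam z) = op_of jN (Lam (\<lambda>i v. y i v + z i v))"
    if "y \<in> linf" "z \<in> linf" for y z
  proof -
    have "(\<lambda>h. Lam y h + Lam z h) = Lam (\<lambda>i v. y i v + z i v)" by (rule ext) (simp add: Lam_add that)
    then show ?thesis using jN by simp
  qed
  have sc: "c \<odot>\<^bsub>algebra_of NV\<^esub> op_of jN (Lam y) = op_of jN (Lam (\<lambda>i v. scaleC c (y i v)))"
    if "y \<in> linf" for y c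
  proof -
    have "(\<lambda>h. scaleC c (Lam y h)) = Lam (\<lambda>i v. scaleC c (y i v))" by (rule ext) (simp add: Lam_scaleC that)
    then show ?thesis using jN by simp
  qed
  have hom: "lifts \<in> ring_hom (algebra_of NV) ?P"
  proof (rule ring_hom_memI)
    fix X assume "X \<in> carrier (algebra_of NV)"
    then show "lifts X \<in> carrier ?P" unfolding carP by simp
  next
    fix X Y assume "X \<in> carrier (algebra_of NV)" "Y \<in> carrier (algebra_of NV)"
    then obtain y z where y: "y \<in> linf" "X = op_of jN (Lam y)" and z: "z \<in> linf" "Y = op_of jN (Lam z)"
      by (metis NN_cases talg_simps(3))
    have "lifts X \<otimes>\<^bsub>?P\<^esub> lifts Y = (\<Union>a\<in>lifts X. \<Union>b\<in>lifts Y. kerM +>\<^bsub>linfM\<^esub> (a \<otimes>\<^bsub>linfM\<^esub> b))"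
      by (simp add: P star_quotient_def FactRing_def rcoset_mult_def)
    also have "\<dots> = lifts (X \<otimes>\<^bsub>algebra_of NV\<^esub> Y)"
      unfolding y(2)
    proof (rule UN_lifts[OF y(1)])
      fix y' assume y': "y' \<in> linf" "Lam y' = Lam y"
      show "(\<Union>b\<in>lifts Y. kerM +>\<^bsub>linfM\<^esub> (code y' \<otimes>\<^bsub>linfM\<^esub> b)) = lifts (op_of jN (Lam y) \<otimes>\<^bsub>algebra_of NV\<^esub> Y)"
        unfolding z(2)
      proof (rule UN_lifts[OF z(1)])
        fix z' assume z': "z' \<in> linf" "Lam z' = Lam z"
        have "kerM +>\<^bsub>linfM\<^esub> (code y' \<otimes>\<^bsub>linfM\<^esub> code z') = lifts (op_of jN (Lam y') \<otimes>\<^bsub>algebra_of NV\<^esub> op_of jN (Lam z'))"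
          unfolding comp[OF y'(1) z'(1)] linfM_ops by (rule coset_code[OF linf_comp[OF y'(1) z'(1)]])
        then show "kerM +>\<^bsub>linfM\<^esub> (code y' \<otimes>\<^bsub>linfM\<^esub> code z') = lifts (op_of jN (Lam y) \<otimes>\<^bsub>algebra_of NV\<^esub> op_of jN (Lam z))"
          by (simp only: y'(2) z'(2))
      qed
    qed
    finally show "lifts (X \<otimes>\<^bsub>algebra_of NV\<^esub> Y) = lifts X \<otimes>\<^bsub>?P\<^esub> lifts Y" by (rule sym)
    have "lifts X \<oplus>\<^bsub>?P\<^esub> lifts Y = (\<Union>a\<in>lifts X. \<Union>b\<in>lifts Y. {a \<oplus>\<^bsub>linfM\<^esub> b})"
      by (simp add: P star_quotient_def FactRing_def set_add_def')
    also have "\<dots> = lifts (X \<oplus>\<^bsub>algebra_of NV\<^esub> Y)"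
    proof (intro equalityI subsetI)
      fix x assume "x \<in> (\<Union>a\<in>lifts X. \<Union>b\<in>lifts Y. {a \<oplus>\<^bsub>linfM\<^esub> b})"
      then obtain y' z' where y': "y' \<in> linf" "Lam y' = Lam y" and z': "z' \<in> linf" "Lam z' = Lam z"
        and x: "x = code y' \<oplus>\<^bsub>linfM\<^esub> code z'" by (auto simp: y(2) z(2) lifts_op_of)
      have "Lam (\<lambda>i v. y' i v + z' i v) = Lam (\<lambda>i v. y i v + z i v)"
        by (rule ext) (simp add: Lam_add y' z' y z)
      then show "x \<in> lifts (X \<oplus>\<^bsub>algebra_of NV\<^esub> Y)"
        unfolding y(2) z(2) add[OF y(1) z(1)] lifts_op_of x linfM_ops using linf_add[OF y'(1) z'(1)] by blast
    next
      fix x assume "x \<in> lifts (X \<oplus>\<^bsub>algebra_of NV\<^esub> Y)"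
      then obtain w where w: "w \<in> linf" "Lam w = Lam (\<lambda>i v. y i v + z i v)" "x = code w"
        unfolding y(2) z(2) add[OF y(1) z(1)] by (auto simp: lifts_op_of)
      define u where "u = (\<lambda>i v. w i v - y i v)"
      have u: "u \<in> linf" unfolding u_def by (rule linf_diff[OF w(1) y(1)])
      have "Lam u = Lam z" unfolding u_def by (rule ext) (simp add: Lam_diff Lam_add w y z)
      then have "code u \<in> lifts Y" using u by (auto simp: z(2) lifts_op_of)
      moreover have "code y \<in> lifts X" using y by (auto simp: lifts_op_of)
      moreover have "x = code y \<oplus>\<^bsub>linfM\<^esub> code u"
        by (simp add: linfM_ops w(3) u_def)
      ultimately show "x \<in> (\<Union>a\<in>lifts X. \<Union>b\<in>lifts Y. {a \<oplus>\<^bsub>linfM\<^esub> b})" by blast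
    qed
    finally show "lifts (X \<oplus>\<^bsub>algebra_of NV\<^esub> Y) = lifts X \<oplus>\<^bsub>?P\<^esub> lifts Y" by (rule sym)
  next
    have id: "(\<lambda>i v. v) \<in> linf" using linf_const[OF R.N_id] .
    have "\<one>\<^bsub>?P\<^esub> = kerM +>\<^bsub>linfM\<^esub> code (\<lambda>i v. v)"
      by (simp add: P star_quotient_def FactRing_def linfM_ops)
    also have "\<dots> = lifts (op_of jN (Lam (\<lambda>i v. v)))" by (rule coset_code[OF id])
    also have "Lam (\<lambda>i v. v) = (\<lambda>h. h)" by (rule ext) (rule Lam_id)
    finally show "lifts \<one>\<^bsub>algebra_of NV\<^esub> = \<one>\<^bsub>?P\<^esub>" using jN by simp
  qed
  have "inj_on lifts (op_of jN ` NN.N)"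
  proof (rule inj_onI)
    fix X Y assume XY: "X \<in> op_of jN ` NN.N" "Y \<in> op_of jN ` NN.N" "lifts X = lifts Y"
    obtain y where y: "y \<in> linf" "X = op_of jN (Lam y)" using XY(1) by (rule NN_cases)
    have "code y \<in> lifts Y" unfolding XY(3)[symmetric] using y by (auto simp: lifts_op_of)
    then show "X = Y" using y(2) by (auto simp: lifts_def code_inject)
  qed
  then have bij: "bij_betw lifts (carrier (algebra_of NV)) (carrier ?P)"
    unfolding carP by (simp add: bij_betw_def)
  have iso: "lifts \<in> ring_iso (algebra_of NV) ?P" using hom bij by (simp add: ring_iso_def)
  show ?thesis
    unfolding star_isomorphic_def
  proof (intro bexI[OF _ iso] conjI allI ballI)
    fix X assume "X \<in> carrier (algebra_of NV)"
    then obtain y where y: "y \<in> linf" "X = op_of jN (Lam y)" by (metis NN_cases talg_simps(3))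
    fix c
    have "c \<odot>\<^bsub>?P\<^esub> lifts X = (\<Union>x\<in>lifts X. kerM +>\<^bsub>linfM\<^esub> (c \<odot>\<^bsub>linfM\<^esub> x))"
      by (simp add: P star_quotient_def)
    also have "\<dots> = lifts (c \<odot>\<^bsub>algebra_of NV\<^esub> X)"
      unfolding y(2)
    proof (rule UN_lifts[OF y(1)])
      fix z assume z: "z \<in> linf" "Lam z = Lam y"
      have "kerM +>\<^bsub>linfM\<^esub> (c \<odot>\<^bsub>linfM\<^esub> code z) = lifts (c \<odot>\<^bsub>algebra_of NV\<^esub> op_of jN (Lam z))"
        unfolding sc[OF z(1)] linfM_ops by (rule coset_code[OF linf_scaleC[OF z(1)]])
      then show "kerM +>\<^bsub>linfM\<^esub> (c \<odot>\<^bsub>linfM\<^esub> code z) = lifts (c \<odot>\<^bsub>algebra_of NV\<^esub> op_of jN (Lam y))"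
        by (simp only: z(2))
    qed
    finally show "lifts (c \<odot>\<^bsub>algebra_of NV\<^esub> X) = c \<odot>\<^bsub>?P\<^esub> lifts X" by (rule sym)
  next
    fix X assume "X \<in> carrier (algebra_of NV)"
    then obtain y where y: "y \<in> linf" "X = op_of jN (Lam y)" by (metis NN_cases talg_simps(3))
    have "star ?P (lifts X) = (\<Union>x\<in>lifts X. kerM +>\<^bsub>linfM\<^esub> (star linfM x))"
      by (simp add: P star_quotient_def)
    also have "\<dots> = lifts (star (algebra_of NV) X)"
      unfolding y(2)
    proof (rule UN_lifts[OF y(1)])
      fix z assume z: "z \<in> linf" "Lam z = Lam y"
      have "kerM +>\<^bsub>linfM\<^esub> (star linfM (code z)) = lifts (op_of jN (adj (Lam z)))"
        unfolding linfM_ops(5)[OF z(1)] Lam_adj[OF z(1)] by (rule coset_code[OF linf_adj[OF z(1)]])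
      then show "kerM +>\<^bsub>linfM\<^esub> (star linfM (code z)) = lifts (star (algebra_of NV) (op_of jN (Lam y)))"
        using jN by (simp add: z(2) Lam_clin[OF y(1)])
    qed
    finally show "lifts (star (algebra_of NV) X) = star ?P (lifts X)" by (rule sym)
  qed
qed

lemma not_local: "\<not> local_class {M :: 'v traced_algebra. II1_factor M \<and> hyperfinite M}"
proof
  assume L: "local_class {M :: 'v traced_algebra. II1_factor M \<and> hyperfinite M}"
  have M: "II1_factor MM" by (rule R.II1_M[OF jM R_centre R_not_findim])
  have "hyperfinite MM"
    unfolding R.hyperfinite_M[OF jM] using R_hyperfinite by blast
  moreover have "II1_factor NV" by (rule NN.II1_M[OF jN NN_centre NN_not_findim])
  ultimately have "hyperfinite NV"
    using L M ultrafilter_UI ultrapower_iso unfolding local_class_def by blast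
  then have "\<exists>B\<subseteq>NN.N. star_subalg B \<and> findim B \<and> (\<forall>x\<in>(\<lambda>s. Uw [s]) ` {..<5}. \<exists>y\<in>B. norm (x OmN - y OmN) < 3/10)"
    unfolding NN.hyperfinite_M[OF jN] using Uw_N by (elim allE[of _ "(\<lambda>s. Uw [s]) ` {..<5}"] allE[of _ "3/10"]) auto
  then obtain B where B: "B \<subseteq> NN.N" "star_subalg B" "findim B"
    "\<forall>x\<in>(\<lambda>s. Uw [s]) ` {..<5}. \<exists>y\<in>B. norm (x OmN - y OmN) < 3/10" by blast
  show False by (rule NN_not_hyperfinite[OF B(1-3)]) (use B(4) in simp)
qed

end

theorem mainTheorem6:
  assumes "\<exists>f :: real \<Rightarrow> 'v. inj f"
  shows "\<not> local_class {M :: 'v traced_algebra. II1_factor M \<and> hyperfinite M}"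
proof -
  obtain f :: "real \<Rightarrow> 'v" where f: "inj f" using assms by blast
  obtain k :: "fsym l2 \<Rightarrow> real" where k: "inj k" using ex_inj_l2_real by blast
  obtain l :: "hN \<Rightarrow> real" where l: "inj l" using ex_inj_hN_real by blast
  have "inj (\<lambda>n::nat. f (real n))" by (rule injI) (use f in \<open>auto dest: injD\<close>)
  then show ?thesis
    using not_local[OF inj_compose[OF f k] inj_compose[OF f l]] by blast
qed

end
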